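(* Fix Hölder functions $f_0,f_1,f_2:\Omega\to\mathbb R$ satisfying Hypothesis A, and set $H=-f_1$. For $\beta\in\mathbb R$ let $\mu_\beta$ be the equilibrium probability for the potential $\beta f_1=-\beta H$. For $E$ in the range of $\beta\mapsto-\frac{d}{d\beta}\mathfrak P(-\beta H)$, let $\beta(E)$ be the value of $\beta$ with $$-\frac{d\,\mathfrak P(-\beta H)}{d\beta}\Big|_{\beta=\beta(E)}=E,$$ let $1/T(E):=\beta(E)$, and let $h(E):=h(\mu_{\beta(E)})$ be the entropy of $\mu_{\beta(E)}$. Then $$\frac{d\,h(E)}{dE}=\frac1{T(E)}.$$
   Context: Let $d\ge 2$, $\Omega=\{1,\dots,d\}^{\mathbb N}$ with metric $d(x,y)=2^{-N}$, where $N$ is the smallest $j$ with $x_j\ne y_j$ (and $d(x,x)=0$), and let $\sigma$ be the shift. For a Hölder potential $A:\Omega\to\mathbb R$, the topological pressure is $\mathfrak P(A)=\sup\{\int A\,d\mu+h(\mu):\mu\ \sigma\text{-invariant Borel probability}\}$, where $h(\mu)$ is the Shannon-Kolmogorov entropy; the equilibrium probability of $A$ is the unique invariant probability attaining the supremum. A function $L:\Omega\to\mathbb R$ is cohomologous to a constant if there are a continuous $\varphi:\Omega\to\mathbb R$ and $c\in\mathbb R$ with $L=\varphi\circ\sigma-\varphi+c$. Hypothesis A: if $(a_0,a_1,a_2)\in\mathbb R^3$ is such that $a_0f_0+a_1f_1+a_2f_2$ is cohomologous to a constant, then $a_0=a_1=a_2=0$. Under Hypothesis A, $\beta\mapsto\mathfrak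 P(\beta f_1)$ is a strictly convex analytic function, so $\beta(E)$ is well defined. *)

theory Defs
  imports "HOL-Probability.Probability"
begin

text \<open>
  One-sided sequences over a finite alphabet \<open>'d\<close>; the alphabet with \<open>d\<close> symbols is an arbitrary
  finite type with \<open>CARD('d) = d\<close>. A separate type is needed because \<open>nat \<Rightarrow> 'd\<close> already carries a
  different metric in the library. Coordinates are numbered from 0.
\<close>

typedef 'd shift_space = "UNIV :: (nat \<Rightarrow> 'd) set"
  morphisms coord of_coords
  by simp

lemma coord_of_coords [simp]: "coord (of_coords u) = u"
  by (simp add: of_coords_inverse)

lemma shift_space_eqI: "(\<And>n. coord x n = coord y n) \<Longrightarrow> x = y"
  by (rule iffD1[OF coord_inject]) (rule ext)

instantiation shift_space :: (finite) metric_space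
begin

definition dist_shift_space :: "'a shift_space \<Rightarrow> 'a shift_space \<Rightarrow> real" where
  "dist x y = (if x = y then 0 else (1 / 2) ^ (LEAST j. coord x j \<noteq> coord y j))"

definition uniformity_shift_space :: "('a shift_space \<times> 'a shift_space) filter" where
  "(uniformity :: ('a shift_space \<times> 'a shift_space) filter) = (INF e\<in>{0 <..}. principal {(x, y). dist x y < e})"

definition open_shift_space :: "'a shift_space set \<Rightarrow> bool" where
  "open (U :: 'a shift_space set) = (\<forall>x\<in>U. eventually (\<lambda>(x', y). x' = x \<longrightarrow> y \<in> U) uniformity)"

instance
proof
  fix x y z :: "'a shift_space"
  show "dist x y = 0 \<longleftrightarrow> x = y"
    by (simp add: dist_shift_space_def)
  have zero: "dist u u = 0" and nonneg: "0 \<le> dist u v"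
    and sym: "dist u v = dist v u" for u v :: "'a shift_space"
    unfolding dist_shift_space_def
    by (simp, simp, simp only: eq_commute[of u v] eq_commute[of "coord u _" "coord v _"])
  show "dist x y \<le> dist x z + dist y z"
  proof (cases "x = y \<or> x = z \<or> y = z")
    case True
    then show ?thesis
      using nonneg[of x z] nonneg[of y z] zero[of x] zero[of y] zero[of z] sym[of y z]
      by (elim disjE) simp_all
  next
    case False
    let ?m = "\<lambda>u v. LEAST j. coord u j \<noteq> coord v j"
    have "\<exists>j. coord x j \<noteq> coord y j"
      using False shift_space_eqI[of x y] by blast
    then have "coord x (?m x y) \<noteq> coord y (?m x y)"
      by (rule LeastI_ex)
    then consider "coord x (?m x y) \<noteq> coord z (?m x y)" | "coord y (?m x y) \<noteq> coord z (?m x y)"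
      by fastforce
    then show ?thesis
    proof cases
      case 1
      then have "?m x z \<le> ?m x y"
        by (rule Least_le)
      then have "dist x y \<le> dist x z"
        using False by (simp add: dist_shift_space_def power_decreasing)
      then show ?thesis
        using nonneg[of y z] by linarith
    next
      case 2
      then have "?m y z \<le> ?m x y"
        by (rule Least_le)
      then have "dist x y \<le> dist y z"
        using False by (simp add: dist_shift_space_def power_decreasing)
      then show ?thesis
        using nonneg[of x z] by linarith
    qed
  qed
qed (simp_all only: uniformity_shift_space_def open_shift_space_def)

end

definition shift :: "'d shift_space \<Rightarrow> 'd shift_space" where
  "shift x = of_coords (\<lambda>n. coord x (Suc n))"

definition holder :: "('a::metric_space \<Rightarrow> real) \<Rightarrow> bool" where
  "holder f \<longleftrightarrow> (\<exists>\<alpha> C. 0 < \<alpha> \<and> \<alpha> \<le> 1 \<and> (\<forall>x y. \<bar>f x - f y\<bar> \<le> C * dist x y powr \<alpha>))"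

definition invariant_prob :: "'d::finite shift_space measure \<Rightarrow> bool" where
  "invariant_prob \<mu> \<longleftrightarrow> prob_space \<mu> \<and> sets \<mu> = sets borel \<and>
     (\<forall>B\<in>sets borel. measure \<mu> (shift -` B) = measure \<mu> B)"

definition finite_borel_partition :: "'d::finite shift_space set set \<Rightarrow> bool" where
  "finite_borel_partition \<xi> \<longleftrightarrow> finite \<xi> \<and> partition_on UNIV \<xi> \<and> \<xi> \<subseteq> sets borel"

definition partition_entropy :: "'a measure \<Rightarrow> 'a set set \<Rightarrow> real" where
  "partition_entropy \<mu> \<xi> = - (\<Sum>B\<in>\<xi>. measure \<mu> B * ln (measure \<mu> B))"

text \<open>The join of \<open>\<xi>, \<sigma>\<^sup>-\<^sup>1\<xi>, \<dots>, \<sigma>\<^sup>-\<^sup>(\<^sup>n\<^sup>-\<^sup>1\<^sup>)\<xi>\<close>.\<close>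

definition iterated_join :: "'d shift_space set set \<Rightarrow> nat \<Rightarrow> 'd shift_space set set" where
  "iterated_join \<xi> n =
     common_refinement ((\<lambda>i. (\<lambda>B. (shift ^^ i) -` B) ` \<xi>) ` {..<n})"

definition entropy_wrt ::
    "'d::finite shift_space measure \<Rightarrow> 'd shift_space set set \<Rightarrow> real" where
  "entropy_wrt \<mu> \<xi> = lim (\<lambda>n. partition_entropy \<mu> (iterated_join \<xi> n) / real n)"

text \<open>
  For an invariant probability the supremum is finite: it is bounded by \<open>ln (CARD('d))\<close>. Hence it,
  and the supremum in \<open>pressure\<close>, can be taken in the reals.
\<close>

definition KS_entropy :: "'d::finite shift_space measure \<Rightarrow> real" where
  "KS_entropy \<mu> = (SUP \<xi>\<in>{\<xi>. finite_borel_partition \<xi>}. entropy_wrt \<mu> \<xi>)"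

definition pressure :: "('d::finite shift_space \<Rightarrow> real) \<Rightarrow> real" where
  "pressure A = (SUP \<mu>\<in>{\<mu>. invariant_prob \<mu>}. (\<integral>x. A x \<partial>\<mu>) + KS_entropy \<mu>)"

definition equilibrium_prob ::
    "('d::finite shift_space \<Rightarrow> real) \<Rightarrow> 'd shift_space measure" where
  "equilibrium_prob A =
     (THE \<mu>. invariant_prob \<mu> \<and> (\<integral>x. A x \<partial>\<mu>) + KS_entropy \<mu> = pressure A)"

definition cohomologous_to_constant :: "('d::finite shift_space \<Rightarrow> real) \<Rightarrow> bool" where
  "cohomologous_to_constant L \<longleftrightarrow>
     (\<exists>\<phi> c. continuous_on UNIV \<phi> \<and> (\<forall>x. L x = \<phi> (shift x) - \<phi> x + c))"

definition hypothesis_A ::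
    "('d::finite shift_space \<Rightarrow> real) \<Rightarrow> ('d shift_space \<Rightarrow> real) \<Rightarrow> ('d shift_space \<Rightarrow> real) \<Rightarrow> bool"
  where
  "hypothesis_A f0 f1 f2 \<longleftrightarrow>
     (\<forall>a0 a1 a2. cohomologous_to_constant (\<lambda>x. a0 * f0 x + a1 * f1 x + a2 * f2 x) \<longrightarrow>
        a0 = 0 \<and> a1 = 0 \<and> a2 = 0)"

text \<open>\<open>H\<close> is the Hamiltonian and \<open>b\<close> the inverse temperature.\<close>

definition has_energy :: "('d::finite shift_space \<Rightarrow> real) \<Rightarrow> real \<Rightarrow> real \<Rightarrow> bool" where
  "has_energy H b E \<longleftrightarrow>
     ((\<lambda>t. pressure (\<lambda>x. - t * H x)) has_real_derivative - E) (at b)"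

definition energy_range :: "('d::finite shift_space \<Rightarrow> real) \<Rightarrow> real set" where
  "energy_range H = {E. \<exists>b. has_energy H b E}"

text \<open>
  The quantity \<open>\<beta>(E) = 1/T(E)\<close>. It is introduced directly, rather than as the reciprocal of a
  temperature, so that \<open>\<beta>(E) = 0\<close> (infinite temperature) needs no special treatment.
\<close>

definition inverse_temperature :: "('d::finite shift_space \<Rightarrow> real) \<Rightarrow> real \<Rightarrow> real" where
  "inverse_temperature H E = (THE b. has_energy H b E)"

definition gibbs_prob :: "('d::finite shift_space \<Rightarrow> real) \<Rightarrow> real \<Rightarrow> 'd shift_space measure" where
  "gibbs_prob H b = equilibrium_prob (\<lambda>x. - b * H x)"

definition entropy_at_energy :: "('d::finite shift_space \<Rightarrow> real) \<Rightarrow> real \<Rightarrow> real" where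
  "entropy_at_energy H E = KS_entropy (gibbs_prob H (inverse_temperature H E))"

end

theory Submission
  imports Defs
begin

text \<open>
Let \<open>f = f1\<close>, let \<open>p b\<close> be the pressure of \<open>b * f\<close> and \<open>\<mu> b\<close> its equilibrium probability. Suppose that \<open>p\<close> is
differentiable with derivative \<open>\<integral>f d\<mu> b\<close> and strictly convex. The energy that belongs to \<open>b\<close> is \<open>E = - p' b\<close>, and
since \<open>\<mu> b\<close> attains the supremum in the definition of \<open>p b\<close>, its entropy is \<open>p b - b * p' b = p b + b * E\<close>. So the
entropy as a function of the energy is the Legendre transform \<open>min t. p t + t * E\<close>, and the derivative of
such a minimum with respect to \<open>E\<close> is the minimizer, which is \<open>b\<close> (\<open>legendre_derivative\<close>).

The two properties of the pressure rest on the transfer operator of a Hoelder potential. Averages over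
preimages contract oscillations exponentially (\<open>exponential_contraction\<close>). Applied to the quotients of
successive iterates this yields a positive eigenfunction, by which the potential is normalized up to a
coboundary and a constant (\<open>eigenfunction_exists\<close>, \<open>normalized_cohomologous\<close>). Applied to a normalized
potential it yields a unique stationary measure, which is invariant and charges every cylinder, and
which in turn determines the normalized potential (\<open>stationary_exists\<close>, \<open>stationary_unique\<close>,
\<open>stationary_determines_potential\<close>).

The link with entropy is the Kolmogorov-Sinai theorem: the entropy of an invariant probability is the
limit of the conditional entropies of the first letter given the next \<open>n\<close> letters (\<open>kolmogorov_sinai\<close>).
For a normalized potential \<open>L\<close>, entropy plus \<open>\<integral>L\<close> is then a limit of negative relative entropies. It is at
most zero, with equality exactly for the stationary measure (\<open>KS_entropy_le\<close>, \<open>equality_imp_stationary\<close>,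
\<open>stationary_imp_equality\<close>). So the pressure is the logarithm of the eigenvalue, and the equilibrium
probability exists and is unique (\<open>equilibrium_state\<close>).

Differentiability follows by perturbation of the eigenvalue equation (\<open>pressure_derivative\<close>). If the
pressure were not strictly convex, two parameters would share their equilibrium probability, hence
their normalized potential, and a nonzero multiple of \<open>f\<close> would be cohomologous to a constant, against the
hypothesis (\<open>pressure_strictly_convex\<close>).
\<close>

section \<open>Sequences that agree on an initial segment\<close>

definition agree :: "nat \<Rightarrow> 'd shift_space \<Rightarrow> 'd shift_space \<Rightarrow> bool" where
  "agree n x y \<longleftrightarrow> (\<forall>i<n. coord x i = coord y i)"

text \<open>The Lipschitz condition for the ultrametric \<open>\<theta> ^ n\<close>, where \<open>n\<close> is the first place at which two sequences
differ. A function that is Hoelder with exponent \<open>\<alpha>\<close> satisfies it for \<open>\<theta> = 2 powr (-\<alpha>)\<close>. Agreement up to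
\<open>n\<close> replaces the first disagreement, because prepending a letter or shifting just changes \<open>n\<close> by one.
The case \<open>n = 0\<close> bounds the oscillation of \<open>f\<close> by \<open>s\<close>.\<close>

definition lip :: "real \<Rightarrow> real \<Rightarrow> ('d shift_space \<Rightarrow> real) \<Rightarrow> bool" where
  "lip \<theta> s f \<longleftrightarrow> (\<forall>n x y. agree n x y \<longrightarrow> \<bar>f x - f y\<bar> \<le> s * \<theta> ^ n)"

definition prepend :: "'d \<Rightarrow> 'd shift_space \<Rightarrow> 'd shift_space" where
  "prepend a x = of_coords (case_nat a (coord x))"

lemma agree_refl [simp]: "agree n x x"
  by (simp add: agree_def)

lemma agree_0 [simp]: "agree 0 x y"
  by (simp add: agree_def)

lemma agree_sym: "agree n x y \<Longrightarrow> agree n y x"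
  by (simp add: agree_def)

lemma agree_mono: "agree n x y \<Longrightarrow> m \<le> n \<Longrightarrow> agree m x y"
  by (simp add: agree_def)

lemma coord_shift [simp]: "coord (shift x) n = coord x (Suc n)"
  by (simp add: shift_def)

lemma coord_shift_funpow [simp]: "coord ((shift ^^ k) x) n = coord x (n + k)"
  by (induction k arbitrary: n) auto

lemma coord_prepend: "coord (prepend a x) n = (case n of 0 \<Rightarrow> a | Suc m \<Rightarrow> coord x m)"
  by (simp add: prepend_def)

lemma coord_prepend_0 [simp]: "coord (prepend a x) 0 = a"
  and coord_prepend_Suc [simp]: "coord (prepend a x) (Suc n) = coord x n"
  by (simp_all add: coord_prepend)

lemma shift_prepend [simp]: "shift (prepend a x) = x"
  by (rule shift_space_eqI) simp

lemma prepend_shift [simp]: "prepend (coord x 0) (shift x) = x"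
  by (rule shift_space_eqI) (simp add: coord_prepend split: nat.split)

lemma agree_prepend_iff [simp]: "agree (Suc n) (prepend a x) (prepend b y) \<longleftrightarrow> a = b \<and> agree n x y"
  unfolding agree_def by (auto simp: All_less_Suc2)

lemma agree_shift: "agree (Suc n) x y \<Longrightarrow> agree n (shift x) (shift y)"
  by (simp add: agree_def)

lemma dist_le_of_agree:
  fixes x y :: "'d::finite shift_space"
  assumes "agree n x y"
  shows "dist x y \<le> (1 / 2) ^ n"
proof (cases "x = y")
  case False
  then have "\<exists>j. coord x j \<noteq> coord y j"
    using shift_space_eqI[of x y] by blast
  then have "coord x (LEAST j. coord x j \<noteq> coord y j) \<noteq> coord y (LEAST j. coord x j \<noteq> coord y j)"
    by (rule LeastI_ex)
  then have "n \<le> (LEAST j. coord x j \<noteq> coord y j)"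
    using assms unfolding agree_def by (meson not_le)
  then show ?thesis
    using False by (simp add: dist_shift_space_def power_decreasing)
qed simp

lemma agree_of_dist_less:
  fixes x y :: "'d::finite shift_space"
  assumes "dist x y < (1 / 2) ^ n"
  shows "agree (Suc n) x y"
proof (cases "x = y")
  case False
  then have "(1 / 2 :: real) ^ (LEAST j. coord x j \<noteq> coord y j) < (1 / 2) ^ n"
    using assms by (simp add: dist_shift_space_def)
  then have "n < (LEAST j. coord x j \<noteq> coord y j)"
    by (subst (asm) power_strict_decreasing_iff) auto
  then show ?thesis
    unfolding agree_def using not_less_Least[of _ "\<lambda>j. coord x j \<noteq> coord y j"]
    by (meson less_Suc_eq_le order_le_less_trans)
qed simp

lemma lipD: "lip \<theta> s f \<Longrightarrow> agree n x y \<Longrightarrow> \<bar>f x - f y\<bar> \<le> s * \<theta> ^ n"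
  by (simp add: lip_def)

lemma lip_osc: "lip \<theta> s f \<Longrightarrow> \<bar>f x - f y\<bar> \<le> s"
  using lipD[of \<theta> s f 0 x y] by simp

lemma lip_nonneg: "lip \<theta> s f \<Longrightarrow> 0 \<le> s"
  using lip_osc[of \<theta> s f undefined undefined] by simp

lemma lip_bounded: "lip \<theta> s f \<Longrightarrow> \<bar>f x\<bar> \<le> \<bar>f z\<bar> + s"
  using lip_osc[of \<theta> s f x z] by linarith

lemma lip_mono: "lip \<theta> s f \<Longrightarrow> s \<le> t \<Longrightarrow> 0 \<le> \<theta> \<Longrightarrow> lip \<theta> t f"
  unfolding lip_def by (meson mult_right_mono order_trans zero_le_power)

lemma lip_const [simp]: "lip \<theta> 0 (\<lambda>x. c)"
  by (simp add: lip_def)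

lemma lip_add: "lip \<theta> s f \<Longrightarrow> lip \<theta> t g \<Longrightarrow> lip \<theta> (s + t) (\<lambda>x. f x + g x)"
  unfolding lip_def by (smt (verit) distrib_right)

lemma lip_diff: "lip \<theta> s f \<Longrightarrow> lip \<theta> t g \<Longrightarrow> lip \<theta> (s + t) (\<lambda>x. f x - g x)"
  unfolding lip_def by (smt (verit) distrib_right)

lemma lip_cmult: "lip \<theta> s f \<Longrightarrow> lip \<theta> (\<bar>c\<bar> * s) (\<lambda>x. c * f x)"
  unfolding lip_def
  by (metis (no_types, opaque_lifting) abs_ge_zero abs_mult mult.assoc mult_left_mono right_diff_distrib)

lemma lip_mult:
  assumes f: "lip \<theta> s f" "\<And>x. \<bar>f x\<bar> \<le> B" and g: "lip \<theta> t g" "\<And>x. \<bar>g x\<bar> \<le> D"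
  shows "lip \<theta> (s * D + B * t) (\<lambda>x. f x * g x)"
  unfolding lip_def
proof (intro allI impI)
  fix n and x y :: "'a shift_space" assume a: "agree n x y"
  have "f x * g x - f y * g y = (f x - f y) * g x + f y * (g x - g y)"
    by (simp add: algebra_simps)
  then have "\<bar>f x * g x - f y * g y\<bar> \<le> \<bar>f x - f y\<bar> * \<bar>g x\<bar> + \<bar>f y\<bar> * \<bar>g x - g y\<bar>"
    by (metis abs_mult abs_triangle_ineq)
  also have "\<dots> \<le> (s * \<theta> ^ n) * D + B * (t * \<theta> ^ n)"
    using lipD[OF f(1) a] lipD[OF g(1) a] f(2)[of y] g(2)[of x]
    by (intro add_mono mult_mono) (auto intro: order_trans[OF abs_ge_zero])
  finally show "\<bar>f x * g x - f y * g y\<bar> \<le> (s * D + B * t) * \<theta> ^ n"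
    by (simp add: algebra_simps)
qed

text \<open>Hoelder regularity is carried by logarithms throughout; this inequality returns to the
functions themselves.\<close>

lemma abs_exp_diff_le:
  fixes u v B :: real
  assumes "u \<le> B" "v \<le> B"
  shows "\<bar>exp u - exp v\<bar> \<le> exp B * \<bar>u - v\<bar>"
proof -
  have *: "exp u - exp v \<le> exp B * (u - v)" if "v \<le> u" "u \<le> B" for u v :: real
  proof -
    have "exp u - exp v = exp u * (1 - exp (v - u))"
      by (simp add: algebra_simps flip: exp_add)
    also have "\<dots> \<le> exp u * (u - v)"
      using exp_ge_add_one_self[of "v - u"] by (intro mult_left_mono) (linarith, simp)
    also have "\<dots> \<le> exp B * (u - v)"
      using that by (intro mult_right_mono) auto
    finally show ?thesis .
  qed
  show ?thesis
    using *[of u v] *[of v u] assms by (cases "v \<le> u") auto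
qed

lemma lip_exp:
  assumes "lip \<theta> s f" "\<And>x. f x \<le> B"
  shows "lip \<theta> (exp B * s) (\<lambda>x. exp (f x))"
  unfolding lip_def
proof (intro allI impI)
  fix n and x y :: "'a shift_space" assume "agree n x y"
  then have "exp B * \<bar>f x - f y\<bar> \<le> exp B * (s * \<theta> ^ n)"
    using lipD[OF assms(1)] by (intro mult_left_mono) auto
  then show "\<bar>exp (f x) - exp (f y)\<bar> \<le> exp B * s * \<theta> ^ n"
    using abs_exp_diff_le[OF assms(2)[of x] assms(2)[of y]] unfolding mult.assoc by linarith
qed

lemma lip_prepend:
  assumes "lip \<theta> s f"
  shows "lip \<theta> (\<theta> * s) (\<lambda>x. f (prepend a x))"
  unfolding lip_def using lipD[OF assms, of "Suc _" "prepend a _" "prepend a _"] by (auto simp: mult_ac)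

lemma lip_shift:
  assumes "lip \<theta> s f" "0 < \<theta>" "\<theta> < 1"
  shows "lip \<theta> (s / \<theta>) (\<lambda>x. f (shift x))"
  unfolding lip_def
proof (intro allI impI)
  fix n and x y :: "'a shift_space" assume a: "agree n x y"
  show "\<bar>f (shift x) - f (shift y)\<bar> \<le> s / \<theta> * \<theta> ^ n"
  proof (cases n)
    case 0
    have "s * \<theta> \<le> s * 1"
      using assms lip_nonneg[OF assms(1)] by (intro mult_left_mono) auto
    then have "s \<le> s / \<theta>"
      using assms by (simp add: field_simps)
    then show ?thesis
      using 0 lip_osc[OF assms(1), of "shift x" "shift y"] by simp
  next
    case (Suc m)
    then show ?thesis
      using lipD[OF assms(1) agree_shift[of m x y]] a assms by simp
  qed
qed

lemma lip_sum:
  assumes "\<And>i. i \<in> I \<Longrightarrow> lip \<theta> (s i) (f i)"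
  shows "lip \<theta> (\<Sum>i\<in>I. s i) (\<lambda>x. \<Sum>i\<in>I. f i x)"
  unfolding lip_def
proof (intro allI impI)
  fix n and x y :: "'b shift_space" assume a: "agree n x y"
  have "\<bar>(\<Sum>i\<in>I. f i x) - (\<Sum>i\<in>I. f i y)\<bar> \<le> (\<Sum>i\<in>I. \<bar>f i x - f i y\<bar>)"
    by (simp add: sum_subtractf[symmetric] sum_abs)
  also have "\<dots> \<le> (\<Sum>i\<in>I. s i * \<theta> ^ n)"
    using lipD[OF assms a] by (rule sum_mono)
  finally show "\<bar>(\<Sum>i\<in>I. f i x) - (\<Sum>i\<in>I. f i y)\<bar> \<le> (\<Sum>i\<in>I. s i) * \<theta> ^ n"
    by (simp add: sum_distrib_right)
qed

lemma lip_if_finite_memory: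
  assumes "\<And>x y. agree n x y \<Longrightarrow> f x = f y" "\<And>x. \<bar>f x\<bar> \<le> B" "0 < \<theta>" "\<theta> < 1"
  shows "lip \<theta> (2 * B / \<theta> ^ n) f"
  unfolding lip_def
proof (intro allI impI)
  fix m and x y :: "'a shift_space" assume a: "agree m x y"
  show "\<bar>f x - f y\<bar> \<le> 2 * B / \<theta> ^ n * \<theta> ^ m"
  proof (cases "n \<le> m")
    case True
    have "0 \<le> B" using assms(2)[of x] by linarith
    then show ?thesis
      using assms(1)[OF agree_mono[OF a True]] assms(3) by simp
  next
    case False
    then have "\<theta> ^ n \<le> \<theta> ^ m"
      using assms by (intro power_decreasing) auto
    moreover have "\<bar>f x - f y\<bar> \<le> 2 * B"
      using assms(2)[of x] assms(2)[of y] by linarith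
    ultimately have "\<bar>f x - f y\<bar> * \<theta> ^ n \<le> 2 * B * \<theta> ^ m"
      using assms(3) by (intro mult_mono) auto
    then show ?thesis
      using assms(3) by (simp add: field_simps)
  qed
qed

lemma lip_imp_continuous:
  fixes f :: "'d::finite shift_space \<Rightarrow> real"
  assumes "lip \<theta> s f" "0 < \<theta>" "\<theta> < 1"
  shows "continuous_on UNIV f"
  unfolding continuous_on_iff
proof (intro ballI allI impI)
  fix x :: "'d shift_space" and e :: real assume "0 < e"
  have "(\<lambda>n. s * \<theta> ^ n) \<longlonglongrightarrow> s * 0"
    using assms by (intro tendsto_mult LIMSEQ_power_zero tendsto_const) auto
  then have "eventually (\<lambda>n. s * \<theta> ^ n < e) sequentially"
    using \<open>0 < e\<close> by (simp add: order_tendstoD)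
  then obtain n where n: "s * \<theta> ^ n < e"
    by (auto simp: eventually_sequentially)
  have "dist (f y) (f x) < e" if "dist y x < (1 / 2) ^ n" for y
    using lipD[OF assms(1) agree_mono[OF agree_of_dist_less[OF that], of n]] n
    by (simp add: dist_real_def)
  then show "\<exists>d>0. \<forall>x'\<in>UNIV. dist x' x < d \<longrightarrow> dist (f x') (f x) < e"
    by (intro exI[of _ "(1 / 2) ^ n"]) simp
qed

lemma borel_measurable_lip:
  fixes f :: "'d::finite shift_space \<Rightarrow> real"
  assumes "lip \<theta> s f" "0 < \<theta>" "\<theta> < 1"
  shows "f \<in> borel_measurable borel"
  by (rule borel_measurable_continuous_onI) (rule lip_imp_continuous[OF assms])

lemma integrable_lip:
  fixes f :: "'d::finite shift_space \<Rightarrow> real"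
  assumes "lip \<theta> s f" "0 < \<theta>" "\<theta> < 1" "prob_space M" "sets M = sets borel"
  shows "integrable M f"
proof -
  interpret prob_space M by (rule assms)
  have "f \<in> borel_measurable M"
    using borel_measurable_lip[OF assms(1-3)] by (simp add: measurable_cong_sets[OF assms(5) refl])
  then show ?thesis
    using lip_bounded[OF assms(1), of _ undefined] by (intro integrable_const_bound) auto
qed

lemma holder_imp_lip:
  fixes f :: "'d::finite shift_space \<Rightarrow> real"
  assumes "holder f"
  obtains \<theta> s where "0 < \<theta>" "\<theta> < 1" "lip \<theta> s f"
proof -
  obtain \<alpha> C where h: "0 < \<alpha>" "\<And>x y. \<bar>f x - f y\<bar> \<le> C * dist x y powr \<alpha>"
    using assms unfolding holder_def by blast
  define \<theta> :: real where "\<theta> = (1 / 2) powr \<alpha>"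
  have \<theta>: "0 < \<theta>" "\<theta> < 1"
    using h(1) powr_less_mono2[of \<alpha> "1 / 2 :: real" 1] by (auto simp: \<theta>_def)
  have "lip \<theta> \<bar>C\<bar> f"
    unfolding lip_def
  proof (intro allI impI)
    fix n and x y :: "'d shift_space" assume "agree n x y"
    then have "dist x y powr \<alpha> \<le> ((1 / 2) ^ n) powr \<alpha>"
      using h(1) by (intro powr_mono2 dist_le_of_agree) auto
    also have "\<dots> = \<theta> ^ n"
      by (simp add: \<theta>_def powr_power powr_powr flip: powr_realpow) (simp add: mult.commute)
    finally have "\<bar>C\<bar> * dist x y powr \<alpha> \<le> \<bar>C\<bar> * \<theta> ^ n"
      by (intro mult_left_mono) auto
    moreover have "C * dist x y powr \<alpha> \<le> \<bar>C\<bar> * dist x y powr \<alpha>"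
      by (intro mult_right_mono) auto
    ultimately show "\<bar>f x - f y\<bar> \<le> \<bar>C\<bar> * \<theta> ^ n"
      using h(2)[of x y] by linarith
  qed
  with \<theta> show thesis by (rule that)
qed

section \<open>Clopen sets and the Borel sets\<close>

definition depends_on_first :: "nat \<Rightarrow> 'd shift_space set \<Rightarrow> bool" where
  "depends_on_first n C \<longleftrightarrow> (\<forall>x y. agree n x y \<longrightarrow> x \<in> C \<longrightarrow> y \<in> C)"

definition clopens :: "'d shift_space set set" where
  "clopens = {C. \<exists>n. depends_on_first n C}"

definition word :: "nat \<Rightarrow> 'd shift_space \<Rightarrow> 'd list" where
  "word n x = map (coord x) [0..<n]"

lemma length_word [simp]: "length (word n x) = n"
  by (simp add: word_def)

text \<open>A point of the cylinder of \<open>w\<close>, at which functions are evaluated to replace integrals by finite sums.\<close>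

definition point :: "'d list \<Rightarrow> 'd shift_space" where
  "point w = of_coords (\<lambda>i. if i < length w then w ! i else undefined)"

definition words :: "nat \<Rightarrow> 'd list set" where
  "words n = {w. length w = n}"

lemma finite_words [simp]: "finite (words n :: 'd::finite list set)"
  using finite_lists_length_eq[of "UNIV :: 'd set" n] by (simp add: words_def)

lemma word_in_words [simp]: "word n x \<in> words n"
  by (simp add: words_def)

lemma word_point [simp]: "w \<in> words n \<Longrightarrow> word n (point w) = w"
  by (auto simp: word_def point_def words_def intro: nth_equalityI)

lemma word_eq_iff: "word n x = word n y \<longleftrightarrow> agree n x y"
  by (auto simp: word_def agree_def)

lemma depends_on_first_mono: "depends_on_first n C \<Longrightarrow> n \<le> m \<Longrightarrow> depends_on_first m C"
  unfolding depends_on_first_def using agree_mono by blast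

lemma depends_on_first_iff: "depends_on_first n C \<Longrightarrow> agree n x y \<Longrightarrow> x \<in> C \<longleftrightarrow> y \<in> C"
  unfolding depends_on_first_def using agree_sym by blast

lemma depends_on_first_word: "depends_on_first n {x. P (word n x)}"
  unfolding depends_on_first_def by (metis mem_Collect_eq word_eq_iff)

lemma agree_point: "agree n x (point (word n x))"
  by (simp flip: word_eq_iff)

lemma depends_on_first_Un: "depends_on_first n C \<Longrightarrow> depends_on_first n D \<Longrightarrow> depends_on_first n (C \<union> D)"
  unfolding depends_on_first_def by blast

lemma depends_on_first_Diff: "depends_on_first n C \<Longrightarrow> depends_on_first n D \<Longrightarrow> depends_on_first n (C - D)"
  unfolding depends_on_first_def by (meson DiffD1 DiffD2 DiffI agree_sym)

lemma algebra_clopens: "algebra UNIV (clopens :: 'd shift_space set set)"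
  unfolding algebra_iff_Un
proof (intro conjI ballI)
  show "{} \<in> (clopens :: 'd shift_space set set)"
    by (simp add: clopens_def depends_on_first_def)
next
  fix C :: "'d shift_space set" assume "C \<in> clopens"
  then obtain n where n: "depends_on_first n C" by (auto simp: clopens_def)
  have "depends_on_first n (UNIV - C)"
    using n by (rule depends_on_first_Diff[rotated]) (simp add: depends_on_first_def)
  then show "UNIV - C \<in> clopens" by (auto simp: clopens_def)
next
  fix C D :: "'d shift_space set" assume "C \<in> clopens" "D \<in> clopens"
  then obtain n m where "depends_on_first n C" "depends_on_first m D" by (auto simp: clopens_def)
  then have "depends_on_first (max n m) (C \<union> D)"
    by (intro depends_on_first_Un) (auto elim: depends_on_first_mono)
  then show "C \<union> D \<in> clopens" by (auto simp: clopens_def)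
qed auto

lemma Int_stable_clopens: "Int_stable (clopens :: 'd shift_space set set)"
  using algebra_clopens[where 'd = 'd] unfolding Int_stable_def by (simp add: algebra_iff_Int)

lemma open_clopens:
  fixes C :: "'d::finite shift_space set"
  assumes "C \<in> clopens"
  shows "open C"
proof -
  obtain n where n: "depends_on_first n C" using assms by (auto simp: clopens_def)
  have "y \<in> C" if "x \<in> C" "dist y x < (1 / 2) ^ n" for x y
    using depends_on_first_iff[OF depends_on_first_mono[OF n, of "Suc n"] agree_of_dist_less[OF that(2)]] that(1)
    by simp
  then show ?thesis
    unfolding open_dist by (metis half_gt_zero_iff zero_less_one zero_less_power)
qed

text \<open>Open sets are unions of cylinders, and there are only countably many cylinders.\<close>

lemma sets_borel_eq_clopens:
  "sets (borel :: 'd::finite shift_space measure) = sigma_sets UNIV clopens"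
proof
  show "sigma_sets UNIV clopens \<subseteq> sets (borel :: 'd shift_space measure)"
  proof
    fix B :: "'d shift_space set" assume "B \<in> sigma_sets UNIV clopens"
    then show "B \<in> sets borel"
      by (induction rule: sigma_sets.induct)
        (auto intro: borel_open open_clopens sets.Diff sets.countable_UN' simp: Compl_eq_Diff_UNIV[symmetric])
  qed
  have "U \<in> sigma_sets UNIV clopens" if "open U" for U :: "'d shift_space set"
  proof -
    let ?N = "{(n, w). {x. word n x = w} \<subseteq> U}"
    have "\<exists>n. {y. word n y = word n x} \<subseteq> U" if x: "x \<in> U" for x
    proof -
      obtain e where e: "0 < e" "\<And>y. dist y x < e \<Longrightarrow> y \<in> U"
        using \<open>open U\<close> x unfolding open_dist by blast
      obtain n where "(1 / 2 :: real) ^ n < e"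
        using real_arch_pow_inv[OF e(1), of "1 / 2"] by auto
      then show ?thesis
        using e(2) order_le_less_trans[OF dist_le_of_agree[of n _ x]] unfolding word_eq_iff
        by (intro exI[of _ n]) blast
    qed
    then have "U = (\<Union>(n, w)\<in>?N. {x. word n x = w})"
      by (intro equalityI subsetI) (fast, auto)
    moreover have "(\<Union>(n, w)\<in>?N. {x. word n x = w}) \<in> sigma_sets UNIV (clopens :: 'd shift_space set set)"
    proof (rule sigma_sets_UNION)
      show "countable ((\<lambda>(n, w). {x :: 'd shift_space. word n x = w}) ` ?N)"
        by (rule countable_image) (rule countableI_type)
    next
      fix b assume "b \<in> (\<lambda>(n, w). {x :: 'd shift_space. word n x = w}) ` ?N"
      then show "b \<in> sigma_sets UNIV clopens"
        by (auto simp: clopens_def intro!: sigma_sets.Basic depends_on_first_word)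
    qed
    ultimately show ?thesis by metis
  qed
  then have "sigma_sets UNIV {S. open S} \<subseteq> sigma_sets UNIV (clopens :: 'd shift_space set set)"
    by (intro sigma_sets_mono) auto
  then show "sets (borel :: 'd shift_space measure) \<subseteq> sigma_sets UNIV clopens"
    by (simp add: borel_def)
qed

text \<open>The compactness of the sequence space, in the form in which the extension of a measure needs it.
A word is kept as long as its cylinder meets every set of the decreasing sequence. As the alphabet is
finite, such a word always has such a continuation, and the infinite sequence built in this way lies
in all the sets.\<close>

lemma clopens_decseq_empty:
  fixes A :: "nat \<Rightarrow> 'd::finite shift_space set"
  assumes A: "\<And>i. A i \<in> clopens" "decseq A" and empty: "(\<Inter>i. A i) = {}"
  shows "\<exists>i. A i = {}"
proof (rule ccontr)
  assume ne: "\<nexists>i. A i = {}"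
  define P where "P n w \<longleftrightarrow> length w = n \<and> (\<forall>i. \<exists>z\<in>A i. word n z = w)" for n and w :: "'d list"
  have "\<exists>f. \<forall>n. P n (f n) \<and> (\<exists>a. f (Suc n) = f n @ [a])"
  proof (rule dependent_nat_choice)
    show "\<exists>w. P 0 w" using ne by (auto simp: P_def word_def)
    fix w n assume w: "P n w"
    have "\<exists>a. P (Suc n) (w @ [a])"
    proof (rule ccontr)
      assume "\<nexists>a. P (Suc n) (w @ [a])"
      then have "\<forall>a. \<exists>i. \<forall>z\<in>A i. word (Suc n) z \<noteq> w @ [a]"
        using w by (auto simp: P_def)
      then obtain i where i: "\<And>a z. z \<in> A (i a) \<Longrightarrow> word (Suc n) z \<noteq> w @ [a]" by metis
      obtain z where z: "z \<in> A (Max (range i))" "word n z = w"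
        using w by (auto simp: P_def)
      have "z \<in> A (i (coord z n))"
        using z(1) decseqD[OF A(2), of "i (coord z n)" "Max (range i)"] by (auto intro: Max_ge)
      moreover have "word (Suc n) z = w @ [coord z n]"
        using z(2) by (simp add: word_def)
      ultimately show False using i by blast
    qed
    then show "\<exists>w'. P (Suc n) w' \<and> (\<exists>a. w' = w @ [a])" by blast
  qed
  then obtain f where f: "\<And>n. P n (f n)" "\<And>n. \<exists>a. f (Suc n) = f n @ [a]" by blast
  define x where "x = of_coords (\<lambda>k. f (Suc k) ! k)"
  have "word n x = f n" for n
  proof (induction n)
    case (Suc n)
    obtain a where a: "f (Suc n) = f n @ [a]" using f(2) by blast
    then have "f (Suc n) ! n = a" using f(1)[of n] by (simp add: P_def nth_append)
    then show ?case using Suc a by (simp add: word_def x_def)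
  qed (use f(1)[of 0] in \<open>simp add: P_def word_def\<close>)
  then have "\<exists>z\<in>A i. agree n z x" for n i
    using f(1)[of n] by (auto simp: P_def simp flip: word_eq_iff)
  then have "x \<in> A i" for i
    using A(1)[of i] depends_on_first_iff by (fastforce simp: clopens_def)
  then show False using empty by blast
qed

lemma clopens_subset_borel: "C \<in> clopens \<Longrightarrow> C \<in> sets (borel :: 'd::finite shift_space measure)"
  by (simp add: borel_open open_clopens)



lemma shift_measurable [measurable]:
  "shift \<in> borel \<rightarrow>\<^sub>M (borel :: 'd::finite shift_space measure)"
proof (rule borel_measurable_continuous_onI, unfold continuous_on_iff, intro ballI allI impI)
  fix x :: "'d shift_space" and e :: real assume "0 < e"
  then obtain n where n: "(1 / 2 :: real) ^ n < e"
    using real_arch_pow_inv[of e "1 / 2"] by auto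
  have "dist (shift y) (shift x) < e" if "dist y x < (1 / 2) ^ n" for y
    using dist_le_of_agree[OF agree_shift[OF agree_of_dist_less[OF that]]] n by linarith
  then show "\<exists>d>0. \<forall>x'\<in>UNIV. dist x' x < d \<longrightarrow> dist (shift x') (shift x) < e"
    by (intro exI[of _ "(1 / 2) ^ n"]) simp
qed

section \<open>Exponential contraction of averaging operators\<close>

lemma weighted_sum_diff_le:
  fixes u v \<alpha> \<beta> :: "'d::finite \<Rightarrow> real"
  assumes "\<And>a. 0 \<le> u a" "\<And>a. 0 \<le> v a" "(\<Sum>a\<in>UNIV. u a) = r" "(\<Sum>a\<in>UNIV. v a) = r"
    and "\<And>a b. \<alpha> a - \<beta> b \<le> o'"
  shows "(\<Sum>a\<in>UNIV. u a * \<alpha> a) - (\<Sum>a\<in>UNIV. v a * \<beta> a) \<le> r * o'"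
proof -
  obtain b where b: "\<And>a. \<beta> b \<le> \<beta> a"
    using ex_min_if_finite[of "range \<beta>"] by (metis UNIV_not_empty empty_is_image finite_class.finite_UNIV finite_imageI not_less rangeE rangeI)
  have "(\<Sum>a\<in>UNIV. u a * \<alpha> a) \<le> (\<Sum>a\<in>UNIV. u a * (\<beta> b + o'))"
    using assms(1,5) by (intro sum_mono mult_left_mono) (auto simp: algebra_simps)
  also have "\<dots> = r * \<beta> b + r * o'"
    using assms(3) by (subst sum_distrib_right[symmetric]) (simp add: distrib_left)
  also have "r * \<beta> b = (\<Sum>a\<in>UNIV. v a * \<beta> b)"
    using assms(4) by (simp add: sum_distrib_right[symmetric])
  also have "\<dots> \<le> (\<Sum>a\<in>UNIV. v a * \<beta> a)"
    using assms(2) b by (intro sum_mono mult_left_mono) auto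
  finally show ?thesis by simp
qed

text \<open>One step replaces a function by averages of its values at the preimages \<^term>\<open>prepend a x\<close>. The weights
may change from step to step, since the weights that belong to the iterates of a transfer operator do
so until these are normalized by the eigenfunction.\<close>

locale kernel_sequence =
  fixes \<theta> \<delta> K :: real and p :: "nat \<Rightarrow> 'd::finite \<Rightarrow> 'd shift_space \<Rightarrow> real"
    and \<psi> :: "nat \<Rightarrow> 'd shift_space \<Rightarrow> real"
  assumes theta: "0 < \<theta>" "\<theta> < 1" and delta: "0 < \<delta>" and K: "0 \<le> K"
    and p_ge: "\<And>k a x. \<delta> \<le> p k a x"
    and p_sum: "\<And>k x. (\<Sum>a\<in>UNIV. p k a x) = 1"
    and p_lip: "\<And>k a. lip \<theta> K (p k a)"
    and step: "\<And>k x. \<psi> (Suc k) x = (\<Sum>a\<in>UNIV. p k a x * \<psi> k (prepend a x))"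

text \<open>\<open>\<epsilon>\<close> is the mass that two averages certainly have in common, and \<open>K2\<close> is the sum of the geometric
series of the errors that the variation of the weights causes.\<close>

locale kernel_sequence_rates = kernel_sequence \<theta> \<delta> K p \<psi>
    for \<theta> \<delta> K and p :: "nat \<Rightarrow> 'd::finite \<Rightarrow> 'd shift_space \<Rightarrow> real" and \<psi> +
  fixes \<epsilon> K2 :: real
  assumes \<epsilon>_def: "\<epsilon> = real CARD('d) * \<delta>"
    and K2_def: "K2 = real CARD('d) * K / (1 - \<theta>)"
begin

lemma eps: "0 < \<epsilon>" "\<epsilon> \<le> 1"
proof -
  have "(\<Sum>a\<in>(UNIV :: 'd set). \<delta>) \<le> 1"
    using sum_mono[of UNIV "\<lambda>a. \<delta>" "\<lambda>a. p 0 a undefined"] p_ge p_sum by simp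
  then show "0 < \<epsilon>" "\<epsilon> \<le> 1"
    using delta by (auto simp: \<epsilon>_def)
qed

lemma K2_nonneg: "0 \<le> K2"
  using theta K by (auto simp: K2_def)

lemma K2_eq: "\<theta> * K2 + real CARD('d) * K = K2"
  using theta by (simp add: K2_def field_simps)

lemma p_nonneg: "0 \<le> p k a x"
  using p_ge[of k a x] delta by linarith

text \<open>Give the weight \<open>\<delta>\<close> to each letter for both points. This part of the two averages compares points that
agree in one more place; the rest has mass \<open>1 - \<epsilon>\<close> and costs at most the oscillation.\<close>

lemma coupling_step:
  assumes "\<And>x y. \<bar>\<psi> k x - \<psi> k y\<bar> \<le> o'" and "\<And>x y. agree (Suc n) x y \<Longrightarrow> \<bar>\<psi> k x - \<psi> k y\<bar> \<le> v"
    and "agree n x y"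
  shows "\<bar>\<psi> (Suc k) x - \<psi> (Suc k) y\<bar> \<le> \<epsilon> * v + (1 - \<epsilon>) * o'"
proof -
  have *: "\<psi> (Suc k) x - \<psi> (Suc k) y \<le> \<epsilon> * v + (1 - \<epsilon>) * o'" if a: "agree n x y" for x y
  proof -
    have "\<psi> (Suc k) x - \<psi> (Suc k) y = (\<Sum>a\<in>UNIV. \<delta> * (\<psi> k (prepend a x) - \<psi> k (prepend a y)))
      + ((\<Sum>a\<in>UNIV. (p k a x - \<delta>) * \<psi> k (prepend a x)) - (\<Sum>a\<in>UNIV. (p k a y - \<delta>) * \<psi> k (prepend a y)))"
      by (simp add: step algebra_simps sum.distrib sum_subtractf)
    also have "\<dots> \<le> (\<Sum>a\<in>(UNIV :: 'd set). \<delta> * v) + (1 - \<epsilon>) * o'"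
    proof (intro add_mono sum_mono mult_left_mono weighted_sum_diff_le)
      fix a show "\<psi> k (prepend a x) - \<psi> k (prepend a y) \<le> v"
        using assms(2)[of "prepend a x" "prepend a y"] a by simp
    next
      fix a b show "\<psi> k (prepend a x) - \<psi> k (prepend b y) \<le> o'"
        using assms(1)[of "prepend a x" "prepend b y"] by linarith
    qed (use p_ge p_sum delta in \<open>auto simp: sum_subtractf \<epsilon>_def\<close>)
    finally show ?thesis by (simp add: \<epsilon>_def mult.assoc)
  qed
  show ?thesis
    using *[OF assms(3)] *[OF agree_sym[OF assms(3)]] by linarith
qed

text \<open>Prepending the same letter shrinks distances by \<open>\<theta>\<close>. The variation of the weights costs only the
oscillation, not the size, of the function, because the weights sum to one.\<close>

lemma lip_step:
  assumes o': "\<And>x y. \<bar>\<psi> k x - \<psi> k y\<bar> \<le> o'" and s: "lip \<theta> s (\<psi> k)"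
  shows "lip \<theta> (\<theta> * s + real CARD('d) * K * o') (\<psi> (Suc k))"
  unfolding lip_def
proof (intro allI impI)
  fix n and x y :: "'d shift_space" assume a: "agree n x y"
  let ?z = "undefined :: 'd shift_space"
  have "(\<Sum>a\<in>UNIV. (p k a x - p k a y) * \<psi> k ?z) = 0"
    by (simp add: sum_distrib_right[symmetric] sum_subtractf p_sum)
  then have "\<psi> (Suc k) x - \<psi> (Suc k) y = (\<Sum>a\<in>UNIV. p k a x * (\<psi> k (prepend a x) - \<psi> k (prepend a y)))
     + (\<Sum>a\<in>UNIV. (p k a x - p k a y) * (\<psi> k (prepend a y) - \<psi> k ?z))"
    by (simp add: step algebra_simps sum.distrib sum_subtractf)
  also have "\<bar>\<dots>\<bar> \<le> (\<Sum>a\<in>UNIV. \<bar>p k a x * (\<psi> k (prepend a x) - \<psi> k (prepend a y))\<bar>)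
     + (\<Sum>a\<in>UNIV. \<bar>(p k a x - p k a y) * (\<psi> k (prepend a y) - \<psi> k ?z)\<bar>)"
    by (rule order_trans[OF abs_triangle_ineq]) (intro add_mono sum_abs)
  also have "\<dots> \<le> (\<Sum>a\<in>UNIV. p k a x * (s * \<theta> ^ Suc n)) + (\<Sum>a\<in>(UNIV::'d set). (K * \<theta> ^ n) * o')"
  proof (intro add_mono sum_mono, goal_cases)
    case (1 a)
    then show ?case
      using lipD[OF s, of "Suc n" "prepend a x" "prepend a y"] a p_nonneg[of k a x]
      by (simp add: abs_mult mult_left_mono)
  next
    case (2 a)
    then show ?case
      using lipD[OF p_lip a, of k a] o'[of "prepend a y" ?z] K theta
      unfolding abs_mult by (intro mult_mono) auto
  qed
  also have "\<dots> = (\<theta> * s + real CARD('d) * K * o') * \<theta> ^ n"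
    by (subst sum_distrib_right[symmetric]) (simp add: p_sum algebra_simps)
  finally show "\<bar>\<psi> (Suc k) x - \<psi> (Suc k) y\<bar> \<le> (\<theta> * s + real CARD('d) * K * o') * \<theta> ^ n" .
qed

lemma osc_mono:
  assumes "\<And>x y. \<bar>\<psi> k x - \<psi> k y\<bar> \<le> o'"
  shows "\<bar>\<psi> (k + n) x - \<psi> (k + n) y\<bar> \<le> o'"
proof (induction n arbitrary: x y)
  case (Suc n)
  then show ?case
    using coupling_step[of "k + n" o' 0 o' x y] by (simp add: algebra_simps)
qed (use assms in simp)

text \<open>After \<open>n\<close> steps two arbitrary points have been given the same \<open>n\<close> letters with mass \<open>\<epsilon> ^ n\<close>, and then the
Lipschitz constant counts only with the factor \<open>\<theta> ^ n\<close>.\<close>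

lemma block_bounds:
  assumes o': "\<And>x y. \<bar>\<psi> k x - \<psi> k y\<bar> \<le> o'" and s: "lip \<theta> s (\<psi> k)"
  shows "lip \<theta> (\<theta> ^ n * s + K2 * o') (\<psi> (k + n))"
    and "agree j x y \<Longrightarrow> \<bar>\<psi> (k + n) x - \<psi> (k + n) y\<bar> \<le> \<epsilon> ^ n * s * \<theta> ^ (j + n) + (1 - \<epsilon> ^ n) * o'"
proof -
  have o0: "0 \<le> o'" using o'[of undefined undefined] by simp
  show "lip \<theta> (\<theta> ^ n * s + K2 * o') (\<psi> (k + n))"
  proof (induction n)
    case 0
    then show ?case using lip_mono[OF s, of "s + K2 * o'"] o0 K2_nonneg theta by simp
  next
    case (Suc n)
    have "\<theta> * (\<theta> ^ n * s + K2 * o') + real CARD('d) * K * o' = \<theta> ^ Suc n * s + (\<theta> * K2 + real CARD('d) * K) * o'"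
      by (simp add: algebra_simps)
    also have "\<dots> = \<theta> ^ Suc n * s + K2 * o'"
      by (simp only: K2_eq)
    finally show ?case
      using lip_step[OF osc_mono[OF o'] Suc] by simp
  qed
  show "agree j x y \<Longrightarrow> \<bar>\<psi> (k + n) x - \<psi> (k + n) y\<bar> \<le> \<epsilon> ^ n * s * \<theta> ^ (j + n) + (1 - \<epsilon> ^ n) * o'"
  proof (induction n arbitrary: j x y)
    case 0
    then show ?case using lipD[OF s] by simp
  next
    case (Suc n)
    have "\<bar>\<psi> (Suc (k + n)) x - \<psi> (Suc (k + n)) y\<bar>
        \<le> \<epsilon> * (\<epsilon> ^ n * s * \<theta> ^ (Suc j + n) + (1 - \<epsilon> ^ n) * o') + (1 - \<epsilon>) * o'"
      by (rule coupling_step[OF osc_mono[OF o'] Suc.IH Suc.prems])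
    also have "\<dots> = \<epsilon> ^ Suc n * s * \<theta> ^ (j + Suc n) + (1 - \<epsilon> ^ Suc n) * o'"
      by (simp add: algebra_simps)
    finally show ?case by simp
  qed
qed

text \<open>A single step need not contract anything, since it can turn oscillation into a large Lipschitz
constant. A block of \<open>m\<close> steps contracts the weighted norm "\<open>B\<close> times oscillation plus Lipschitz
constant", once \<open>\<theta> ^ m\<close> is small enough and \<open>B\<close> is of the order of \<open>1 / \<epsilon> ^ m\<close>.\<close>

lemma block_contraction:
  assumes m: "\<theta> ^ m * (2 * K2 + 2) \<le> 1 / 2"
    and s: "lip \<theta> s (\<psi> 0)"
  shows "\<bar>\<psi> (m * q) x - \<psi> (m * q) y\<bar> \<le> ((2 * K2 + 1) / \<epsilon> ^ m + 1) * s * (1 - \<epsilon> ^ m / 2) ^ q"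
proof -
  define B where "B = (2 * K2 + 1) / \<epsilon> ^ m"
  define \<kappa> where "\<kappa> = 1 - \<epsilon> ^ m / 2"
  have em: "0 < \<epsilon> ^ m" "\<epsilon> ^ m \<le> 1"
    using eps by (auto intro: power_le_one)
  have B1: "1 \<le> B" 
    using em K2_nonneg by (simp add: B_def)
  have Be: "B * \<epsilon> ^ m = 2 * K2 + 1"
    using eps by (simp add: B_def)
  have "\<exists>o' t. (\<forall>x y. \<bar>\<psi> (m * q) x - \<psi> (m * q) y\<bar> \<le> o') \<and> lip \<theta> t (\<psi> (m * q)) \<and> 
      B * o' + t \<le> (B + 1) * s * \<kappa> ^ q"
  proof (induction q)
    case 0
    then show ?case using s lip_osc[OF s] by (intro exI[of _ s]) (auto simp: algebra_simps)
  next
    case (Suc q)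
    then obtain o' t where IH: "\<And>x y. \<bar>\<psi> (m * q) x - \<psi> (m * q) y\<bar> \<le> o'" "lip \<theta> t (\<psi> (m * q))"
      "B * o' + t \<le> (B + 1) * s * \<kappa> ^ q" by blast
    have nn: "0 \<le> o'" "0 \<le> t" using IH(1)[of undefined undefined] lip_nonneg[OF IH(2)] by auto
    let ?o = "\<epsilon> ^ m * t * \<theta> ^ m + (1 - \<epsilon> ^ m) * o'" and ?t = "\<theta> ^ m * t + K2 * o'"
    have "B * ?o + ?t = (\<theta> ^ m * (B * \<epsilon> ^ m + 1)) * t + (B - B * \<epsilon> ^ m + K2) * o'"
      by (simp add: algebra_simps)
    also have "\<dots> \<le> (1 / 2) * t + (B - B * \<epsilon> ^ m / 2) * o'"
      using nn m K2_nonneg unfolding Be by (intro add_mono mult_right_mono) (simp_all add: algebra_simps)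
    also have "\<dots> \<le> \<kappa> * t + (\<kappa> * B) * o'"
      using nn em unfolding \<kappa>_def by (intro add_mono mult_right_mono) (auto simp: algebra_simps)
    also have "\<dots> = \<kappa> * (B * o' + t)" by (simp add: algebra_simps)
    also have "\<dots> \<le> \<kappa> * ((B + 1) * s * \<kappa> ^ q)"
      using em by (intro mult_left_mono IH) (auto simp: \<kappa>_def)
    finally have "B * ?o + ?t \<le> (B + 1) * s * \<kappa> ^ Suc q" by (simp add: mult_ac)
    moreover have "\<bar>\<psi> (m * Suc q) x - \<psi> (m * Suc q) y\<bar> \<le> ?o" for x y
      using block_bounds(2)[OF IH(1,2), of 0 x y m] by (simp add: add.commute)
    moreover have "lip \<theta> ?t (\<psi> (m * Suc q))"
      using block_bounds(1)[OF IH(1,2), of m] by (simp add: add.commute)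
    ultimately show ?case by blast
  qed
  then obtain o' t where IH: "\<And>x y. \<bar>\<psi> (m * q) x - \<psi> (m * q) y\<bar> \<le> o'" "lip \<theta> t (\<psi> (m * q))"
      "B * o' + t \<le> (B + 1) * s * \<kappa> ^ q" by blast
  have "1 * o' \<le> B * o'"
    using B1 IH(1)[of undefined undefined] by (intro mult_right_mono) auto
  then show ?thesis
    using IH(1)[of x y] IH(3) lip_nonneg[OF IH(2)] unfolding B_def[symmetric] \<kappa>_def[symmetric] by linarith
qed

end

text \<open>The constants are uniform in the kernels and in the function: they depend on \<open>\<theta>\<close>, \<open>\<delta>\<close>, \<open>K\<close> and the size of
the alphabet alone. One pair of constants thus serves all test functions of a transfer operator.\<close>

theorem exponential_contraction:
  fixes \<theta> \<delta> K :: real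
  assumes theta: "0 < \<theta>" "\<theta> < 1" and delta: "0 < \<delta>" "real CARD('d::finite) * \<delta> \<le> 1" and "0 \<le> K"
  obtains C \<tau> where "0 \<le> C" "0 < \<tau>" "\<tau> < 1"
    "\<And>(p :: nat \<Rightarrow> 'd \<Rightarrow> _) \<psi> s n x y. kernel_sequence \<theta> \<delta> K p \<psi> \<Longrightarrow> lip \<theta> s (\<psi> 0) \<Longrightarrow>
       \<bar>\<psi> n x - \<psi> n y\<bar> \<le> C * s * \<tau> ^ n"
proof -
  define \<epsilon> where "\<epsilon> = real CARD('d) * \<delta>"
  define K2 where "K2 = real CARD('d) * K / (1 - \<theta>)"
  have eps: "0 < \<epsilon>" "\<epsilon> \<le> 1" and K2_nonneg: "0 \<le> K2"
    using assms by (auto simp: \<epsilon>_def K2_def)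
  have "(\<lambda>m. \<theta> ^ m * (2 * K2 + 2)) \<longlonglongrightarrow> 0 * (2 * K2 + 2)"
    using theta by (intro tendsto_mult LIMSEQ_power_zero tendsto_const) auto
  then have "eventually (\<lambda>m. \<theta> ^ m * (2 * K2 + 2) < 1 / 2) sequentially"
    by (rule order_tendstoD) simp
  then obtain m0 where m0: "\<And>m. m \<ge> m0 \<Longrightarrow> \<theta> ^ m * (2 * K2 + 2) < 1 / 2"
    by (auto simp: eventually_sequentially)
  define m where "m = Suc m0"
  have m: "\<theta> ^ m * (2 * K2 + 2) \<le> 1 / 2" "0 < m"
    using m0[of m] by (auto simp: m_def)
  define \<kappa> where "\<kappa> = 1 - \<epsilon> ^ m / 2"
  have em: "0 < \<epsilon> ^ m" "\<epsilon> ^ m \<le> 1"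
    using eps by (auto intro: power_le_one)
  then have \<kappa>: "0 < \<kappa>" "\<kappa> < 1" by (auto simp: \<kappa>_def)
  \<comment> \<open>\<open>\<kappa>\<close> is the factor for a block of \<open>m\<close> steps; the incomplete block at the end costs one more factor.\<close>
  define \<tau> where "\<tau> = root m \<kappa>"
  have \<tau>: "0 < \<tau>" "\<tau> < 1" "\<tau> ^ m = \<kappa>"
    using \<kappa> m(2) by (auto simp: \<tau>_def)
  define B where "B = (2 * K2 + 1) / \<epsilon> ^ m + 1"
  have B: "0 \<le> B" using em K2_nonneg by (simp add: B_def)
  have "\<bar>\<psi> n x - \<psi> n y\<bar> \<le> B / \<kappa> * s * \<tau> ^ n"
    if ker: "kernel_sequence \<theta> \<delta> K p \<psi>" and s: "lip \<theta> s (\<psi> 0)"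
    for p :: "nat \<Rightarrow> 'd \<Rightarrow> _" and \<psi> s n x y
  proof -
    interpret kernel_sequence_rates \<theta> \<delta> K p \<psi> \<epsilon> K2
      using ker by (intro kernel_sequence_rates.intro kernel_sequence_rates_axioms.intro) (simp_all add: \<epsilon>_def K2_def)
    have n: "m * (n div m) + n mod m = n" by simp
    have "\<bar>\<psi> (m * (n div m) + n mod m) x - \<psi> (m * (n div m) + n mod m) y\<bar> \<le> B * s * \<kappa> ^ (n div m)"
      by (rule osc_mono) (use block_contraction[OF m(1) s] in \<open>simp add: B_def \<kappa>_def\<close>)
    then have "\<bar>\<psi> n x - \<psi> n y\<bar> \<le> B * s * \<kappa> ^ (n div m)" unfolding n .
    also have "\<kappa> ^ (n div m) \<le> \<tau> ^ n / \<kappa>"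
    proof -
      have "\<kappa> * \<kappa> ^ (n div m) = \<tau> ^ (m + m * (n div m))"
        unfolding power_add power_mult \<tau>(3) ..
      also have "\<dots> \<le> \<tau> ^ n"
      proof (rule power_decreasing)
        show "n \<le> m + m * (n div m)"
          using m(2) n by (metis add.commute mod_less_divisor nat_add_left_cancel_le less_imp_le)
      qed (use \<tau> in auto)
      finally show ?thesis using \<kappa> by (simp add: field_simps)
    qed
    then have "B * s * \<kappa> ^ (n div m) \<le> B * s * (\<tau> ^ n / \<kappa>)"
      using B lip_nonneg[OF s] by (intro mult_left_mono) auto
    finally show ?thesis by (simp add: field_simps)
  qed
  then show thesis
    using B \<kappa> \<tau> by (intro that[of "B / \<kappa>" \<tau>]) auto
qed

section \<open>The transfer operator and its eigenfunction\<close>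

definition transfer :: "('d::finite shift_space \<Rightarrow> real) \<Rightarrow> ('d shift_space \<Rightarrow> real) \<Rightarrow> 'd shift_space \<Rightarrow> real" where
  "transfer A \<phi> x = (\<Sum>a\<in>UNIV. exp (A (prepend a x)) * \<phi> (prepend a x))"

lemma transfer_pos: "(\<And>x. 0 < \<phi> x) \<Longrightarrow> 0 < transfer A \<phi> x"
  unfolding transfer_def by (intro sum_pos) auto

text \<open>The key to all uniform bounds: applied to a positive function, the transfer operator adds the variation
of the potential to that of the logarithm and multiplies the sum by \<open>\<theta>\<close>.\<close>

lemma transfer_log_le:
  assumes A: "lip \<theta> C A" and f: "\<And>x. 0 < f x" "lip \<theta> K (\<lambda>x. ln (f x))" and a: "agree n x y"
  shows "transfer A f x \<le> exp (\<theta> * (C + K) * \<theta> ^ n) * transfer A f y"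
  unfolding transfer_def sum_distrib_left
proof (rule sum_mono)
  fix a :: 'a
  let ?x = "prepend a x" and ?y = "prepend a y"
  have "A ?x + ln (f ?x) \<le> \<theta> * (C + K) * \<theta> ^ n + (A ?y + ln (f ?y))"
    using lipD[OF A, of "Suc n" ?x ?y] lipD[OF f(2), of "Suc n" ?x ?y] a by (simp add: algebra_simps)
  then have "exp (A ?x + ln (f ?x)) \<le> exp (\<theta> * (C + K) * \<theta> ^ n + (A ?y + ln (f ?y)))"
    by simp
  then show "exp (A ?x) * f ?x \<le> exp (\<theta> * (C + K) * \<theta> ^ n) * (exp (A ?y) * f ?y)"
    by (simp only: exp_add exp_ln f)
qed

lemma lip_lnI:
  assumes "\<And>x. 0 < f x" "\<And>n x y. agree n x y \<Longrightarrow> f x \<le> exp (K * \<theta> ^ n) * f y"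
  shows "lip \<theta> K (\<lambda>x. ln (f x))"
  unfolding lip_def
proof (intro allI impI)
  fix n and x y :: "'a shift_space"
  have "ln (f x) \<le> K * \<theta> ^ n + ln (f y)" if "agree n x y" for x y
    using assms(2)[OF that] assms(1)[of x] assms(1)[of y]
    by (metis exp_gt_zero ln_exp ln_le_cancel_iff ln_mult_pos mult_pos_pos)
  from this[of x y] this[of y x]
  show "agree n x y \<Longrightarrow> \<bar>ln (f x) - ln (f y)\<bar> \<le> K * \<theta> ^ n"
    using agree_sym[of n x y] by force
qed

lemma lip_ln_le:
  assumes "\<And>x. 0 < f x" "lip \<theta> K (\<lambda>x. ln (f x))" "agree n x y"
  shows "f x \<le> exp (K * \<theta> ^ n) * f y"
proof -
  have "exp (ln (f x)) \<le> exp (K * \<theta> ^ n + ln (f y))"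
    using lipD[OF assms(2,3)] by simp
  then show ?thesis by (simp add: exp_add assms(1))
qed

lemma lip_transfer_ln:
  assumes "lip \<theta> C A" "\<And>x. 0 < f x" "lip \<theta> K (\<lambda>x. ln (f x))"
  shows "lip \<theta> (\<theta> * (C + K)) (\<lambda>x. ln (transfer A f x))"
  using transfer_log_le[OF assms] assms(2) by (intro lip_lnI transfer_pos)

locale ruelle =
  fixes \<theta> C :: real and A :: "'d::finite shift_space \<Rightarrow> real"
  assumes theta: "0 < \<theta>" "\<theta> < 1" and A: "lip \<theta> C A"
begin

text \<open>The fixed point of \<open>k \<mapsto> \<theta> * (C + k)\<close>, hence a bound for the logarithmic variation of all iterates.\<close>

definition "K = \<theta> * C / (1 - \<theta>)"

definition "F n = (transfer A ^^ n) (\<lambda>_. 1)"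

lemma C_nonneg: "0 \<le> C"
  using lip_nonneg[OF A] .

lemma K_nonneg: "0 \<le> K"
  using C_nonneg theta by (simp add: K_def)

lemma K_eq: "\<theta> * (C + K) = K"
  using theta by (simp add: K_def field_simps)

lemma F_Suc: "F (Suc n) = transfer A (F n)"
  by (simp add: F_def)

lemma F_pos: "0 < F n x"
proof (induction n arbitrary: x)
  case (Suc n)
  then show ?case unfolding F_Suc by (intro transfer_pos)
qed (simp add: F_def)

lemma F_lip: "lip \<theta> K (\<lambda>x. ln (F n x))"
proof (induction n)
  case 0
  show ?case using lip_mono[OF lip_const K_nonneg, of \<theta> 0] theta by (simp add: F_def)
next
  case (Suc n)
  then show ?case using lip_transfer_ln[OF A F_pos Suc] by (simp add: F_Suc K_eq)
qed

definition "\<delta> = exp (- C - K) / real CARD('d)"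

lemma F_Suc_le: "F (Suc k) x \<le> real CARD('d) * exp (C + K) * (exp (A (prepend a x)) * F k (prepend a x))"
proof -
  have "F (Suc k) x \<le> (\<Sum>b\<in>(UNIV :: 'd set). exp (C + K) * (exp (A (prepend a x)) * F k (prepend a x)))"
    unfolding F_Suc transfer_def
  proof (rule sum_mono)
    fix b :: 'd
    have "A (prepend b x) \<le> C + A (prepend a x)"
      using lip_osc[OF A, of "prepend b x" "prepend a x"] by simp
    moreover have "F k (prepend b x) \<le> exp K * F k (prepend a x)"
      using lip_ln_le[OF F_pos F_lip agree_0, of k "prepend b x" "prepend a x"] by simp
    ultimately have "exp (A (prepend b x)) * F k (prepend b x) \<le> exp (C + A (prepend a x)) * (exp K * F k (prepend a x))"
      using F_pos[of k] by (intro mult_mono) (auto simp: less_imp_le)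
    then show "exp (A (prepend b x)) * F k (prepend b x) \<le> exp (C + K) * (exp (A (prepend a x)) * F k (prepend a x))"
      by (simp add: exp_add mult_ac)
  qed
  then show ?thesis by simp
qed

text \<open>The quotients \<open>\<psi> k\<close> of successive iterates satisfy a recursion by averages, with the weights \<open>p k\<close>.\<close>

definition "p k a x = exp (A (prepend a x)) * F k (prepend a x) / F (Suc k) x"
definition "\<psi> k x = F (Suc k) x / F k x"

lemma p_pos: "0 < p k a x"
  using F_pos by (simp add: p_def)

lemma p_sum: "(\<Sum>a\<in>UNIV. p k a x) = 1"
  using F_pos[of "Suc k" x] by (simp add: p_def sum_divide_distrib[symmetric] F_Suc transfer_def)

lemma p_le_1: "p k a x \<le> 1"
  using member_le_sum[of a UNIV "\<lambda>a. p k a x"] p_pos[THEN less_imp_le] p_sum by simp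

lemma kernel: "kernel_sequence \<theta> \<delta> (2 * K) p \<psi>"
proof
  show "0 < \<theta>" "\<theta> < 1" by (rule theta)+
  show "0 < \<delta>" by (simp add: \<delta>_def)
  show "0 \<le> 2 * K" using K_nonneg by simp
  show "(\<Sum>a\<in>UNIV. p k a x) = 1" for k x by (rule p_sum)
  show "\<delta> \<le> p k a x" for k a x
  proof -
    have "exp (- C - K) * F (Suc k) x \<le> exp (- C - K) * (real CARD('d) * exp (C + K) * (exp (A (prepend a x)) * F k (prepend a x)))"
      by (intro mult_left_mono F_Suc_le) simp
    also have "\<dots> = real CARD('d) * (exp (A (prepend a x)) * F k (prepend a x))"
      by (simp add: exp_minus exp_diff exp_add)
    finally show ?thesis
      using F_pos[of "Suc k" x] by (simp add: \<delta>_def p_def field_simps)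
  qed
  show "\<psi> (Suc k) x = (\<Sum>a\<in>UNIV. p k a x * \<psi> k (prepend a x))" for k x
  proof -
    have "p k a x * \<psi> k (prepend a x) = exp (A (prepend a x)) * F (Suc k) (prepend a x) / F (Suc k) x" for a
      using F_pos[of k "prepend a x"] by (simp add: p_def \<psi>_def)
    then show ?thesis
      by (simp add: \<psi>_def F_Suc[of "Suc k"] transfer_def sum_divide_distrib)
  qed
  show "lip \<theta> (2 * K) (p k a)" for k a
  proof -
    have "lip \<theta> (\<theta> * C + \<theta> * K + K) (\<lambda>x. A (prepend a x) + ln (F k (prepend a x)) - ln (F (Suc k) x))"
      by (intro lip_add lip_diff lip_prepend A F_lip lip_prepend[where f = "\<lambda>x. ln (F k x)"])
    moreover have "\<theta> * C + \<theta> * K + K = 2 * K"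
      using K_eq by (simp add: distrib_left)
    moreover have "A (prepend a x) + ln (F k (prepend a x)) - ln (F (Suc k) x) = ln (p k a x)" for x
      using F_pos by (simp add: p_def ln_div ln_mult less_imp_neq[THEN not_sym])
    ultimately have "lip \<theta> (2 * K) (\<lambda>x. ln (p k a x))" by simp
    then have "lip \<theta> (exp 0 * (2 * K)) (\<lambda>x. exp (ln (p k a x)))"
      by (rule lip_exp) (use p_le_1 p_pos in simp)
    then show ?thesis using p_pos by simp
  qed
qed

text \<open>So the quotients of successive iterates become constant at an exponential rate, which is what makes
the iterates, normalized at one point, converge.\<close>

lemma ratio_oscillation_decays:
  obtains D \<tau> where "0 \<le> D" "0 < \<tau>" "\<tau> < 1" "\<And>n x y. \<bar>\<psi> n x - \<psi> n y\<bar> \<le> D * \<tau> ^ n"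
proof -
  have \<delta>: "0 < \<delta>" "real CARD('d) * \<delta> \<le> 1"
    using C_nonneg K_nonneg by (auto simp: \<delta>_def)
  obtain c \<tau> where c: "0 \<le> c" "0 < \<tau>" "\<tau> < 1"
    "\<And>(p :: nat \<Rightarrow> 'd \<Rightarrow> _) \<psi> s n x y. kernel_sequence \<theta> \<delta> (2 * K) p \<psi> \<Longrightarrow> lip \<theta> s (\<psi> 0) \<Longrightarrow>
       \<bar>\<psi> n x - \<psi> n y\<bar> \<le> c * s * \<tau> ^ n"
    using exponential_contraction[OF theta \<delta>, of "2 * K"] K_nonneg by auto
  let ?B = "\<bar>ln (F 1 undefined)\<bar> + K"
  have "lip \<theta> (exp ?B * K) (\<lambda>x. exp (ln (F 1 x)))"
  proof (rule lip_exp[OF F_lip])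
    show "ln (F 1 x) \<le> ?B" for x
      using lip_bounded[OF F_lip[of 1], of x undefined] by linarith
  qed
  moreover have "\<psi> 0 = (\<lambda>x. exp (ln (F 1 x)))"
    using F_pos[of 1] by (simp add: fun_eq_iff \<psi>_def) (simp add: F_def)
  ultimately have "lip \<theta> (exp ?B * K) (\<psi> 0)"
    by simp
  then show thesis
    using c K_nonneg by (intro that[of "c * (exp ?B * K)" \<tau>] c(4)[OF kernel]) auto
qed

text \<open>The eigenfunction is the limit of the iterates \<open>F n\<close>, divided by their values at one point; the eigenvalue is
the limit of the quotients of successive iterates. The increments of the normalized iterates are
dominated by a geometric series.\<close>

theorem eigenfunction_exists:
  obtains \<rho> h where "0 < \<rho>" "\<And>x. 0 < h x" "h undefined = 1" "lip \<theta> K (\<lambda>x. ln (h x))"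
    "\<And>x. transfer A h x = \<rho> * h x"
proof -
  let ?z = "undefined :: 'd shift_space"
  obtain D \<tau> where D: "0 \<le> D" "0 < \<tau>" "\<tau> < 1" "\<And>n x y. \<bar>\<psi> n x - \<psi> n y\<bar> \<le> D * \<tau> ^ n"
    using ratio_oscillation_decays by blast
  define G where "G n x = F n x / F n ?z" for n x
  have G_pos: "0 < G n x" for n x using F_pos by (simp add: G_def)
  have G_le: "G n x \<le> exp K" for n x
    using lip_ln_le[OF F_pos F_lip agree_0, of n x ?z] F_pos[of n ?z] by (simp add: G_def field_simps)
  have G_Suc: "G (Suc n) x * \<psi> n ?z = transfer A (G n) x" for n x
  proof -
    have "G (Suc n) x * \<psi> n ?z = F (Suc n) x / F n ?z"
      using F_pos[of "Suc n" ?z] by (simp add: G_def \<psi>_def)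
    also have "\<dots> = transfer A (G n) x"
      by (simp add: F_Suc transfer_def G_def sum_divide_distrib)
    finally show ?thesis .
  qed
  \<comment> \<open>A lower bound for all quotients at the base point, from the contribution of a single letter.\<close>
  define r where "r = exp (A (prepend undefined ?z)) * exp (- K)"
  have r: "0 < r" "r \<le> \<psi> n ?z" for n
  proof -
    let ?u = "prepend undefined ?z"
    have "F n ?z \<le> exp K * F n ?u"
      using lip_ln_le[OF F_pos F_lip agree_0, of n ?z ?u] by simp
    then have "exp (A ?u) * exp (- K) * F n ?z \<le> exp (A ?u) * exp (- K) * (exp K * F n ?u)"
      by (intro mult_left_mono) auto
    also have "\<dots> = exp (A ?u) * F n ?u"
      by (simp add: exp_minus)
    also have "\<dots> \<le> F (Suc n) ?z"
      unfolding F_Suc transfer_def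
      using member_le_sum[of undefined UNIV "\<lambda>a. exp (A (prepend a ?z)) * F n (prepend a ?z)"] F_pos
      by (simp add: less_imp_le)
    finally show "r \<le> \<psi> n ?z"
      using F_pos[of n ?z] by (simp add: r_def \<psi>_def field_simps)
  qed (simp add: r_def)
  have "\<exists>l. (\<lambda>n. G n x) \<longlonglongrightarrow> l" for x
  proof -
    have "summable (\<lambda>n. G (Suc n) x - G n x)"
    proof (rule summable_comparison_test')
      show "summable (\<lambda>n. exp K * D / r * \<tau> ^ n)"
        using D by (intro summable_mult summable_geometric) auto
      fix n
      have pz: "0 < \<psi> n ?z" using r(1) r(2)[of n] by linarith
      have "G (Suc n) x = G n x * (\<psi> n x / \<psi> n ?z)"
        using F_pos[of n x] F_pos[of n ?z] F_pos[of "Suc n" ?z] by (simp add: G_def \<psi>_def)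
      then have "G (Suc n) x - G n x = G n x * ((\<psi> n x - \<psi> n ?z) / \<psi> n ?z)"
        using pz by (simp add: field_simps)
      then have "\<bar>G (Suc n) x - G n x\<bar> = G n x * (\<bar>\<psi> n x - \<psi> n ?z\<bar> / \<psi> n ?z)"
        using G_pos[of n x] pz by (simp add: abs_mult)
      also have "\<dots> \<le> exp K * (D * \<tau> ^ n / r)"
        using G_le[of n x] G_pos[of n x] D r(1) r(2)[of n]
        by (intro mult_mono frac_le) (auto simp: less_imp_le)
      finally show "norm (G (Suc n) x - G n x) \<le> exp K * D / r * \<tau> ^ n"
        by simp
    qed
    then have "convergent (\<lambda>n. \<Sum>i<n. G (Suc i) x - G i x)"
      by (simp add: summable_iff_convergent)
    then obtain l where "(\<lambda>n. G n x - G 0 x) \<longlonglongrightarrow> l"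
      unfolding sum_lessThan_telescope[of "\<lambda>n. G n x"] convergent_def by blast
    then have "(\<lambda>n. (G n x - G 0 x) + G 0 x) \<longlonglongrightarrow> l + G 0 x"
      by (intro tendsto_intros)
    then show ?thesis by auto
  qed
  then obtain h where h: "\<And>x. (\<lambda>n. G n x) \<longlonglongrightarrow> h x" by metis
  have T: "(\<lambda>n. transfer A (G n) x) \<longlonglongrightarrow> transfer A h x" for x
    unfolding transfer_def by (intro tendsto_intros h)
  have hz: "h ?z = 1"
  proof -
    have "G n ?z = 1" for n using F_pos[of n ?z] by (simp add: G_def)
    then show ?thesis using h[of ?z] by (simp add: LIMSEQ_const_iff)
  qed
  have h_le: "h x \<le> exp (K * \<theta> ^ n) * h y" if "agree n x y" for n x y
  proof (rule LIMSEQ_le)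
    show "(\<lambda>m. exp (K * \<theta> ^ n) * G m y) \<longlonglongrightarrow> exp (K * \<theta> ^ n) * h y"
      by (intro tendsto_intros h)
    have "G m x \<le> exp (K * \<theta> ^ n) * G m y" for m
      using lip_ln_le[OF F_pos F_lip that, of m] F_pos[of m ?z] by (simp add: G_def divide_right_mono)
    then show "\<exists>N. \<forall>m\<ge>N. G m x \<le> exp (K * \<theta> ^ n) * G m y" by blast
  qed (rule h)
  have h_pos: "0 < h x" for x
    using h_le[OF agree_0, of ?z x] hz by (simp add: zero_less_mult_iff[of "exp K" "h x", simplified])
       (smt (verit) exp_gt_zero mult_nonneg_nonpos)
  have \<psi>_lim: "(\<lambda>n. \<psi> n ?z) \<longlonglongrightarrow> transfer A h ?z"
  proof -
    have "\<psi> n ?z = transfer A (G n) ?z" for n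
      using G_Suc[of n ?z] F_pos[of "Suc n" ?z] by (simp add: G_def)
    then show ?thesis using T[of ?z] by simp
  qed
  have "transfer A h x = transfer A h ?z * h x" for x
  proof (rule LIMSEQ_unique[OF T])
    have "(\<lambda>n. G (Suc n) x * \<psi> n ?z) \<longlonglongrightarrow> h x * transfer A h ?z"
      by (intro tendsto_mult \<psi>_lim LIMSEQ_Suc h)
    then show "(\<lambda>n. transfer A (G n) x) \<longlonglongrightarrow> transfer A h ?z * h x"
      unfolding G_Suc by (simp add: mult.commute)
  qed
  then show thesis
    using transfer_pos[OF h_pos] h_pos hz lip_lnI[OF h_pos h_le] by (rule that[rotated -1])
qed

end

text \<open>The exponentials of a normalized potential are the probabilities of the letter to be prepended; its
transfer operator fixes the constants.\<close>

definition normalized :: "real \<Rightarrow> real \<Rightarrow> ('d::finite shift_space \<Rightarrow> real) \<Rightarrow> bool" where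
  "normalized \<theta> K L \<longleftrightarrow> 0 < \<theta> \<and> \<theta> < 1 \<and> lip \<theta> K L \<and> (\<forall>x. (\<Sum>a\<in>UNIV. exp (L (prepend a x))) = 1)"

text \<open>The eigenfunction changes the potential by a coboundary and a constant into a normalized one, so that
integrals against invariant probabilities change only by the logarithm of the eigenvalue.\<close>

lemma normalized_cohomologous:
  fixes A h :: "'d::finite shift_space \<Rightarrow> real"
  assumes theta: "0 < \<theta>" "\<theta> < 1" and "lip \<theta> C A" "0 < \<rho>" "\<And>x. 0 < h x" "lip \<theta> K (\<lambda>x. ln (h x))"
    "\<And>x. transfer A h x = \<rho> * h x"
  shows "normalized \<theta> (C + K + K / \<theta>) (\<lambda>x. A x + ln (h x) - ln (h (shift x)) - ln \<rho>)"
  unfolding normalized_def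
proof (intro conjI allI theta)
  have "lip \<theta> (C + K + K / \<theta> + 0) (\<lambda>x. A x + ln (h x) - ln (h (shift x)) - ln \<rho>)"
    by (intro lip_add lip_diff assms lip_shift[where f = "\<lambda>x. ln (h x)"] lip_const)
  then show "lip \<theta> (C + K + K / \<theta>) (\<lambda>x. A x + ln (h x) - ln (h (shift x)) - ln \<rho>)" by simp
  fix x
  have "(\<Sum>a\<in>UNIV. exp (A (prepend a x) + ln (h (prepend a x)) - ln (h (shift (prepend a x))) - ln \<rho>))
     = transfer A h x / (h x * \<rho>)"
    using assms(4,5) by (simp add: transfer_def exp_diff exp_add sum_divide_distrib)
  then show "(\<Sum>a\<in>UNIV. exp (A (prepend a x) + ln (h (prepend a x)) - ln (h (shift (prepend a x))) - ln \<rho>)) = 1"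
    using assms(7) less_imp_neq[OF assms(4)] less_imp_neq[OF assms(5)[of x]] by (simp add: mult.commute)
qed

section \<open>Stationary measures of a normalized potential\<close>

text \<open>The fixed points of the dual of the transfer operator, tested on Lipschitz functions.\<close>

definition stationary :: "real \<Rightarrow> ('d::finite shift_space \<Rightarrow> real) \<Rightarrow> 'd shift_space measure \<Rightarrow> bool" where
  "stationary \<theta> L M \<longleftrightarrow> prob_space M \<and> sets M = sets borel \<and>
    (\<forall>s \<phi>. lip \<theta> s \<phi> \<longrightarrow> (\<integral>x. transfer L \<phi> x \<partial>M) = (\<integral>x. \<phi> x \<partial>M))"

lemma transfer_mono: "(\<And>x. \<phi> x \<le> \<psi> x) \<Longrightarrow> transfer A \<phi> x \<le> transfer A \<psi> x"
  unfolding transfer_def by (intro sum_mono mult_left_mono) auto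

lemma transfer_funpow_mono:
  "(\<And>x. \<phi> x \<le> \<psi> x) \<Longrightarrow> (transfer A ^^ n) \<phi> x \<le> (transfer A ^^ n) \<psi> x"
  by (induction n arbitrary: x) (auto intro: transfer_mono)

lemma transfer_sum: "transfer A (\<lambda>x. \<Sum>i\<in>I. c i * f i x) = (\<lambda>x. \<Sum>i\<in>I. c i * transfer A (f i) x)"
  by (rule ext) (simp add: transfer_def sum_distrib_left mult_ac sum.swap[of _ I])

lemma transfer_funpow_sum:
  "(transfer A ^^ n) (\<lambda>x. \<Sum>i\<in>I. c i * f i x) = (\<lambda>x. \<Sum>i\<in>I. c i * (transfer A ^^ n) (f i) x)"
  by (induction n) (simp_all add: transfer_sum)

lemma transfer_funpow_cmult: "(transfer A ^^ n) (\<lambda>x. c * f x) = (\<lambda>x. c * (transfer A ^^ n) f x)"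
  using transfer_funpow_sum[of n A "\<lambda>_. c" "\<lambda>_. f" "{()}"] by simp

lemma lip_indicator:
  assumes "depends_on_first n C" "0 < \<theta>" "\<theta> < 1"
  shows "lip \<theta> (2 * 1 / \<theta> ^ n) (indicator C :: _ \<Rightarrow> real)"
  using assms depends_on_first_iff[OF assms(1)]
  by (intro lip_if_finite_memory) (auto simp: indicator_def)

locale normalized_potential =
  fixes \<theta> K :: real and L :: "'d::finite shift_space \<Rightarrow> real"
  assumes normalized: "normalized \<theta> K L"
begin

lemma theta: "0 < \<theta>" "\<theta> < 1" and L: "lip \<theta> K L"
  and sum_L: "(\<Sum>a\<in>UNIV. exp (L (prepend a x))) = 1"
  using normalized by (auto simp: normalized_def)

lemma K_nonneg: "0 \<le> K"
  using lip_nonneg[OF L] .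

definition "\<delta> = exp (- K) / real CARD('d)"

lemma delta: "0 < \<delta>" "real CARD('d) * \<delta> \<le> 1"
  using K_nonneg by (auto simp: \<delta>_def)

lemma exp_L_ge: "\<delta> \<le> exp (L x)"
proof -
  have "1 \<le> (\<Sum>a\<in>(UNIV :: 'd set). exp (K + L x))"
    unfolding sum_L[of x, symmetric]
  proof (rule sum_mono)
    show "exp (L (prepend a x)) \<le> exp (K + L x)" for a
      using lip_osc[OF L, of "prepend a x" x] by simp
  qed
  then have "exp (- K) * 1 \<le> exp (- K) * (real CARD('d) * exp (K + L x))"
    by (intro mult_left_mono) auto
  then show ?thesis by (simp add: \<delta>_def exp_add exp_minus field_simps)
qed

lemma L_le_0: "L x \<le> 0"
proof -
  have "exp (L (prepend (coord x 0) (shift x))) \<le> (\<Sum>a\<in>UNIV. exp (L (prepend a (shift x))))"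
    by (rule member_le_sum) auto
  then show ?thesis by (simp add: sum_L)
qed

lemma lip_exp_L: "lip \<theta> K (\<lambda>x. exp (L x))"
  using lip_exp[OF L L_le_0] by simp

lemma transfer_const [simp]: "transfer L (\<lambda>_. c) = (\<lambda>_. c)"
  by (rule ext) (simp add: transfer_def sum_L sum_distrib_right[symmetric])

lemma transfer_funpow_const [simp]: "(transfer L ^^ n) (\<lambda>_. c) = (\<lambda>_. c)"
  by (induction n) simp_all

lemma transfer_shift [simp]: "transfer L (\<lambda>x. \<phi> (shift x)) = \<phi>"
  by (rule ext) (simp add: transfer_def sum_L sum_distrib_right[symmetric])

lemma lip_transfer:
  assumes "lip \<theta> s \<phi>"
  obtains t where "lip \<theta> t (transfer L \<phi>)"
proof -
  define B where "B = \<bar>\<phi> undefined\<bar> + s"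
  have b: "\<bar>\<phi> x\<bar> \<le> B" for x using lip_bounded[OF assms, of x undefined] by (simp add: B_def)
  have "lip \<theta> (K * B + 1 * s) (\<lambda>x. exp (L x) * \<phi> x)"
    by (rule lip_mult[OF lip_exp_L _ assms b]) (simp add: L_le_0)
  from lip_sum[OF lip_prepend[OF this], of UNIV "\<lambda>a. a"] show thesis
    by (intro that) (simp add: transfer_def[abs_def])
qed

lemma lip_transfer_funpow: "lip \<theta> s \<phi> \<Longrightarrow> \<exists>t. lip \<theta> t ((transfer L ^^ n) \<phi>)"
  by (induction n) (auto elim: lip_transfer)

lemma kernel: "kernel_sequence \<theta> \<delta> K (\<lambda>k a x. exp (L (prepend a x))) (\<lambda>k. (transfer L ^^ k) \<phi>)"
proof
  show "lip \<theta> K (\<lambda>x. exp (L (prepend a x)))" for a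
    using lip_mono[OF lip_prepend[OF lip_exp_L, of a], of K] theta K_nonneg
    by (simp add: mult_left_le_one_le)
qed (use theta delta K_nonneg exp_L_ge sum_L in \<open>auto simp: transfer_def\<close>)

lemma iterates_oscillation_decays:
  obtains C \<tau> where "0 \<le> C" "0 < \<tau>" "\<tau> < 1"
    "\<And>s \<phi> n x y. lip \<theta> s \<phi> \<Longrightarrow> \<bar>(transfer L ^^ n) \<phi> x - (transfer L ^^ n) \<phi> y\<bar> \<le> C * s * \<tau> ^ n"
proof -
  obtain c \<tau> where c: "0 \<le> c" "0 < \<tau>" "\<tau> < 1"
    "\<And>(p :: nat \<Rightarrow> 'd \<Rightarrow> _) \<psi> s n x y. kernel_sequence \<theta> \<delta> K p \<psi> \<Longrightarrow> lip \<theta> s (\<psi> 0) \<Longrightarrow>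
       \<bar>\<psi> n x - \<psi> n y\<bar> \<le> c * s * \<tau> ^ n"
    using exponential_contraction[OF theta delta, of K] K_nonneg by auto
  show thesis
    using c(4)[OF kernel] by (intro that[OF c(1-3)]) simp
qed

text \<open>For Lipschitz \<open>\<phi>\<close> the iterates of the transfer operator tend to this constant at every point. As a functional
of \<open>\<phi>\<close> it is the integral against the stationary measure.\<close>

definition "\<Lambda> \<phi> = lim (\<lambda>n. (transfer L ^^ n) \<phi> undefined)"

text \<open>All later iterates are averages of the values of the \<open>n\<close>-th one, so that they stay within its
oscillation.\<close>

lemma transfer_funpow_limit:
  obtains C \<tau> where "0 \<le> C" "0 < \<tau>" "\<tau> < 1"
    "\<And>s \<phi> n x. lip \<theta> s \<phi> \<Longrightarrow> \<bar>(transfer L ^^ n) \<phi> x - \<Lambda> \<phi>\<bar> \<le> C * s * \<tau> ^ n"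
proof -
  obtain C \<tau> where C: "0 \<le> C" "0 < \<tau>" "\<tau> < 1"
    "\<And>s \<phi> n x y. lip \<theta> s \<phi> \<Longrightarrow> \<bar>(transfer L ^^ n) \<phi> x - (transfer L ^^ n) \<phi> y\<bar> \<le> C * s * \<tau> ^ n"
    using iterates_oscillation_decays by blast
  have *: "\<bar>(transfer L ^^ n) \<phi> x - \<Lambda> \<phi>\<bar> \<le> C * s * \<tau> ^ n" if \<phi>: "lip \<theta> s \<phi>" for s \<phi> n x
  proof -
    let ?u = "undefined :: 'd shift_space"
    have near: "\<bar>(transfer L ^^ (m + n)) \<phi> y - (transfer L ^^ n) \<phi> x\<bar> \<le> C * s * \<tau> ^ n" for m n x y
    proof -
      have b: "(transfer L ^^ n) \<phi> x - C * s * \<tau> ^ n \<le> (transfer L ^^ n) \<phi> y"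
        "(transfer L ^^ n) \<phi> y \<le> (transfer L ^^ n) \<phi> x + C * s * \<tau> ^ n" for y
        using C(4)[OF \<phi>, of n x y] by linarith+
      show ?thesis
        using transfer_funpow_mono[of "\<lambda>_. (transfer L ^^ n) \<phi> x - C * s * \<tau> ^ n" "(transfer L ^^ n) \<phi>" m L y]
          transfer_funpow_mono[of "(transfer L ^^ n) \<phi>" "\<lambda>_. (transfer L ^^ n) \<phi> x + C * s * \<tau> ^ n" m L y] b
        by (simp add: funpow_add)
    qed
    have lim0: "(\<lambda>n. C * s * \<tau> ^ n) \<longlonglongrightarrow> 0"
      using tendsto_mult[OF tendsto_const LIMSEQ_power_zero[of \<tau>], of "C * s"] C by simp
    have "Cauchy (\<lambda>n. (transfer L ^^ n) \<phi> ?u)"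
    proof (rule CauchyI')
      fix e :: real assume "0 < e"
      then obtain N where N: "C * s * \<tau> ^ N < e / 2"
        using order_tendstoD(2)[OF lim0, of "e / 2"] by (auto simp: eventually_sequentially)
      have "norm ((transfer L ^^ m) \<phi> ?u - (transfer L ^^ n) \<phi> ?u) < e" if "m \<ge> N" "n > m" for m n
        using near[of "m - N" N ?u ?u] near[of "n - N" N ?u ?u] that N by simp
      then show "\<exists>M. \<forall>m\<ge>M. \<forall>n>m. dist ((transfer L ^^ m) \<phi> ?u) ((transfer L ^^ n) \<phi> ?u) < e"
        unfolding dist_norm by blast
    qed
    then have lim: "(\<lambda>n. (transfer L ^^ n) \<phi> ?u) \<longlonglongrightarrow> \<Lambda> \<phi>"
      by (simp add: \<Lambda>_def Cauchy_convergent_iff convergent_LIMSEQ_iff)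
    have "(\<lambda>m. \<bar>(transfer L ^^ (m + n)) \<phi> ?u - (transfer L ^^ n) \<phi> x\<bar>) \<longlonglongrightarrow> \<bar>\<Lambda> \<phi> - (transfer L ^^ n) \<phi> x\<bar>"
      by (intro tendsto_intros LIMSEQ_ignore_initial_segment lim)
    then have "\<bar>\<Lambda> \<phi> - (transfer L ^^ n) \<phi> x\<bar> \<le> C * s * \<tau> ^ n"
      by (rule LIMSEQ_le_const2) (use near in blast)
    then show ?thesis by linarith
  qed
  show thesis by (rule that[OF C(1-3) *])
qed

lemma \<Lambda>_lim:
  assumes "lip \<theta> s \<phi>"
  shows "(\<lambda>n. (transfer L ^^ n) \<phi> x) \<longlonglongrightarrow> \<Lambda> \<phi>"
proof -
  obtain C \<tau> where C: "0 \<le> C" "0 < \<tau>" "\<tau> < 1"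
    "\<And>s \<phi> n x. lip \<theta> s \<phi> \<Longrightarrow> \<bar>(transfer L ^^ n) \<phi> x - \<Lambda> \<phi>\<bar> \<le> C * s * \<tau> ^ n"
    using transfer_funpow_limit by blast
  have "(\<lambda>n. C * s * \<tau> ^ n) \<longlonglongrightarrow> 0"
    using tendsto_mult[OF tendsto_const LIMSEQ_power_zero[of \<tau>], of "C * s"] C by simp
  then have "(\<lambda>n. (transfer L ^^ n) \<phi> x - \<Lambda> \<phi>) \<longlonglongrightarrow> 0"
    by (rule Lim_null_comparison[rotated]) (use C(4)[OF assms] in simp)
  then show ?thesis by (simp add: LIM_zero_iff)
qed

lemma \<Lambda>_mono:
  assumes "lip \<theta> s \<phi>" "lip \<theta> t \<psi>" "\<And>x. \<phi> x \<le> \<psi> x"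
  shows "\<Lambda> \<phi> \<le> \<Lambda> \<psi>"
  using transfer_funpow_mono[of \<phi> \<psi> _ L undefined] assms(3)
  by (intro LIMSEQ_le[OF \<Lambda>_lim[OF assms(1), of undefined] \<Lambda>_lim[OF assms(2), of undefined]]) blast

lemma \<Lambda>_const [simp]: "\<Lambda> (\<lambda>_. c) = c"
  by (simp add: \<Lambda>_def)

lemma \<Lambda>_sum:
  assumes "\<And>i. i \<in> I \<Longrightarrow> lip \<theta> (s i) (f i)"
  shows "\<Lambda> (\<lambda>x. \<Sum>i\<in>I. c i * f i x) = (\<Sum>i\<in>I. c i * \<Lambda> (f i))"
proof -
  have "(\<lambda>n. (transfer L ^^ n) (\<lambda>x. \<Sum>i\<in>I. c i * f i x) undefined) \<longlonglongrightarrow> (\<Sum>i\<in>I. c i * \<Lambda> (f i))"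
    unfolding transfer_funpow_sum by (intro tendsto_intros \<Lambda>_lim[OF assms])
  then show ?thesis unfolding \<Lambda>_def by (rule limI)
qed

lemma \<Lambda>_add:
  assumes "lip \<theta> s f" "lip \<theta> t g"
  shows "\<Lambda> (\<lambda>x. f x + g x) = \<Lambda> f + \<Lambda> g"
  using \<Lambda>_sum[of "UNIV :: bool set" "\<lambda>b. if b then s else t" "\<lambda>b. if b then f else g" "\<lambda>_. 1"] assms
  by (simp add: UNIV_bool add.commute)

lemma \<Lambda>_transfer: "lip \<theta> s \<phi> \<Longrightarrow> \<Lambda> (transfer L \<phi>) = \<Lambda> \<phi>"
  unfolding \<Lambda>_def[of "transfer L \<phi>"] using LIMSEQ_Suc[OF \<Lambda>_lim, of s \<phi> undefined]
  by (intro limI) (simp add: funpow_swap1)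

text \<open>A stationary measure integrates \<open>\<phi>\<close> and all its iterates to the same value, and the iterates converge to
a constant. This gives uniqueness.\<close>

lemma stationary_imp_integral:
  assumes M: "stationary \<theta> L M" and \<phi>: "lip \<theta> s \<phi>"
  shows "(\<integral>x. \<phi> x \<partial>M) = \<Lambda> \<phi>"
proof -
  interpret prob_space M using M by (simp add: stationary_def)
  have b: "sets M = sets borel" using M by (simp add: stationary_def)
  note int = integrable_lip[OF _ theta prob_space_axioms b]
  have *: "(\<integral>x. (transfer L ^^ n) \<phi> x \<partial>M) = (\<integral>x. \<phi> x \<partial>M)" for n
  proof (induction n)
    case (Suc n)
    obtain t where "lip \<theta> t ((transfer L ^^ n) \<phi>)" using lip_transfer_funpow[OF \<phi>] by blast
    then show ?case using M Suc by (simp add: stationary_def)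
  qed simp
  obtain C \<tau> where C: "0 \<le> C" "0 < \<tau>" "\<tau> < 1"
    "\<And>s \<phi> n x. lip \<theta> s \<phi> \<Longrightarrow> \<bar>(transfer L ^^ n) \<phi> x - \<Lambda> \<phi>\<bar> \<le> C * s * \<tau> ^ n"
    using transfer_funpow_limit by blast
  have bd: "\<bar>(\<integral>x. \<phi> x \<partial>M) - \<Lambda> \<phi>\<bar> \<le> C * s * \<tau> ^ n" for n
  proof -
    obtain t where t: "lip \<theta> t ((transfer L ^^ n) \<phi>)" using lip_transfer_funpow[OF \<phi>] by blast
    have "(\<integral>x. \<phi> x \<partial>M) - \<Lambda> \<phi> = (\<integral>x. (transfer L ^^ n) \<phi> x - \<Lambda> \<phi> \<partial>M)"
      using int[OF t] by (simp add: * prob_space)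
    also have "\<bar>\<dots>\<bar> \<le> (\<integral>x. \<bar>(transfer L ^^ n) \<phi> x - \<Lambda> \<phi>\<bar> \<partial>M)"
      by (rule integral_abs_bound)
    also have "\<dots> \<le> (\<integral>x. C * s * \<tau> ^ n \<partial>M)"
      using int[OF t] C(4)[OF \<phi>] by (intro integral_mono) auto
    finally show ?thesis by (simp add: prob_space)
  qed
  have "(\<lambda>n. C * s * \<tau> ^ n) \<longlonglongrightarrow> 0"
    using tendsto_mult[OF tendsto_const LIMSEQ_power_zero[of \<tau>], of "C * s"] C by simp
  then have "\<bar>(\<integral>x. \<phi> x \<partial>M) - \<Lambda> \<phi>\<bar> \<le> 0"
    by (rule LIMSEQ_le_const) (use bd in blast)
  then show ?thesis by simp
qed

end

lemma measure_eq_clopens: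
  fixes M N :: "'d::finite shift_space measure"
  assumes "prob_space M" "sets M = sets borel" "prob_space N" "sets N = sets borel"
    and "\<And>C. C \<in> clopens \<Longrightarrow> measure M C = measure N C"
  shows "M = N"
proof (rule measure_eqI_generator_eq[OF Int_stable_clopens])
  interpret M: prob_space M by fact
  interpret N: prob_space N by fact
  show "emeasure M C = emeasure N C" if "C \<in> clopens" for C
    using assms(5)[OF that] by (simp add: M.emeasure_eq_measure N.emeasure_eq_measure)
  show "sets M = sigma_sets UNIV clopens" "sets N = sigma_sets UNIV clopens"
    using assms by (simp_all add: sets_borel_eq_clopens)
  show "range (\<lambda>_::nat. UNIV) \<subseteq> (clopens :: 'd shift_space set set)"
    using algebra.top[OF algebra_clopens] by auto
  show "emeasure M UNIV \<noteq> \<infinity>" by (simp add: M.emeasure_eq_measure)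
qed auto

lemma integral_indicator_clopen:
  fixes M :: "'d::finite shift_space measure"
  assumes "sets M = sets borel" "C \<in> clopens"
  shows "(\<integral>x. indicator C x \<partial>M) = measure M C"
  using assms sets_eq_imp_space_eq[OF assms(1)] by simp

context normalized_potential begin

lemma stationary_measure_eq:
  assumes "stationary \<theta> L M" "C \<in> clopens"
  shows "measure M C = \<Lambda> (indicator C)"
proof -
  obtain n where n: "depends_on_first n C" using assms(2) by (auto simp: clopens_def)
  show ?thesis
    using stationary_imp_integral[OF assms(1) lip_indicator[OF n theta]] integral_indicator_clopen[OF _ assms(2)] assms(1)
    by (simp add: stationary_def)
qed

lemma stationary_unique:
  assumes "stationary \<theta> L M" "stationary \<theta> L N"
  shows "M = N"
  using assms stationary_measure_eq[OF assms(1)] stationary_measure_eq[OF assms(2)]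
  by (intro measure_eq_clopens) (auto simp: stationary_def)

text \<open>On clopen sets the functional \<open>\<Lambda>\<close> is a finitely additive probability. By compactness it is continuous at
the empty set, and Caratheodory's theorem extends it. It is invariant because the transfer operator
undoes the composition with the shift.\<close>

theorem stationary_exists: obtains M where "stationary \<theta> L M" "invariant_prob M"
proof -
  let ?f = "\<lambda>C. ennreal (\<Lambda> (indicator C))"
  interpret algebra UNIV "clopens :: 'd shift_space set set" by (rule algebra_clopens)
  have lipC: "\<exists>s. lip \<theta> s (indicator C :: _ \<Rightarrow> real)" if "C \<in> clopens" for C
    using that lip_indicator[OF _ theta] by (auto simp: clopens_def)
  have nonneg: "0 \<le> \<Lambda> (indicator C)" if "C \<in> clopens" for C
    using lipC[OF that] \<Lambda>_mono[OF lip_const, of _ "indicator C" 0] by auto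
  have add: "\<Lambda> (indicator (C \<union> D)) = \<Lambda> (indicator C) + \<Lambda> (indicator D)"
    if "C \<in> clopens" "D \<in> clopens" "C \<inter> D = {}" for C D
  proof -
    have "indicator (C \<union> D) = (\<lambda>x. indicator C x + indicator D x :: real)"
      using that(3) by (auto simp: indicator_def fun_eq_iff)
    then show ?thesis using \<Lambda>_add lipC that by metis
  qed
  have emp: "\<Lambda> (indicator {}) = 0"
    using \<Lambda>_const[of 0] by (simp add: indicator_def[abs_def])
  have "\<exists>\<mu>. (\<forall>s\<in>clopens. \<mu> s = ?f s) \<and> measure_space UNIV (sigma_sets UNIV clopens) \<mu>"
  proof (rule caratheodory_empty_continuous)
    show "positive clopens ?f" using emp by (simp add: positive_def)
    show "additive clopens ?f"
      using add nonneg by (simp add: additive_def ennreal_plus)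
    fix A :: "nat \<Rightarrow> 'd shift_space set"
    assume A: "range A \<subseteq> clopens" "decseq A" "(\<Inter>i. A i) = {}"
    then obtain i where "A i = {}" using clopens_decseq_empty[of A] by blast
    then have "A j = {}" if "j \<ge> i" for j using decseqD[OF A(2) that] by blast
    then have "eventually (\<lambda>j. ?f (A j) = 0) sequentially"
      using emp by (intro eventually_sequentiallyI[of i]) simp
    then show "(\<lambda>j. ?f (A j)) \<longlonglongrightarrow> 0"
      by (rule tendsto_eventually)
  qed simp
  then obtain \<mu> where \<mu>: "\<And>C. C \<in> clopens \<Longrightarrow> \<mu> C = ?f C" "measure_space UNIV (sigma_sets UNIV clopens) \<mu>"
    by blast
  define M where "M = measure_of UNIV (sigma_sets UNIV clopens) \<mu>"
  have sets: "sets M = sets borel" 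
    unfolding M_def sets_borel_eq_clopens by (simp add: sigma_sets_sigma_sets_eq)
  have space: "space M = UNIV" using sets_eq_imp_space_eq[OF sets] by simp
  have em: "emeasure M C = ?f C" if "C \<in> clopens" for C
    using \<mu>(2) \<mu>(1)[OF that] that unfolding M_def measure_space_def
    by (subst emeasure_measure_of_sigma) auto
  have me: "measure M C = \<Lambda> (indicator C)" if "C \<in> clopens" for C
    using em[OF that] nonneg[OF that] by (simp add: measure_def)
  have "\<Lambda> (indicator UNIV) = 1"
    using \<Lambda>_const[of 1] by (simp add: indicator_def[abs_def])
  then have prob: "prob_space M"
    using em[OF top] by (intro prob_spaceI) (simp add: space)
  interpret prob_space M by (rule prob)
  note int = integrable_lip[OF _ theta prob sets]
  have I: "(\<integral>x. \<phi> x \<partial>M) = \<Lambda> \<phi>" if \<phi>: "lip \<theta> s \<phi>" for s \<phi>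
  proof -
    have bd: "\<bar>(\<integral>x. \<phi> x \<partial>M) - \<Lambda> \<phi>\<bar> \<le> 2 * (s * \<theta> ^ n)" for n
    proof -
      \<comment> \<open>Compare \<open>\<phi>\<close> with the step function that takes on each cylinder the value at its representative.\<close>
      let ?C = "\<lambda>w. {x. word n x = w}"
      let ?\<phi> = "\<lambda>x. \<Sum>w\<in>words n. \<phi> (point w) * indicator (?C w) x"
      have eq: "?\<phi> x = \<phi> (point (word n x))" for x
      proof -
        have "?\<phi> x = (\<Sum>w\<in>words n. if w = word n x then \<phi> (point w) else 0)"
          by (intro sum.cong) (auto simp: indicator_def)
        then show ?thesis by simp
      qed
      have close: "\<bar>\<phi> x - ?\<phi> x\<bar> \<le> s * \<theta> ^ n" for x
        unfolding eq by (rule lipD[OF \<phi> agree_point])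
      have C: "?C w \<in> clopens" for w :: "'d list"
        using depends_on_first_word[of n "\<lambda>v. v = w"] by (auto simp: clopens_def)
      obtain t where t: "\<And>w :: 'd list. lip \<theta> (t w) (indicator (?C w) :: _ \<Rightarrow> real)"
        using lipC[OF C] by metis
      have lip\<phi>: "lip \<theta> (\<Sum>w\<in>words n. \<bar>\<phi> (point w)\<bar> * t w) ?\<phi>"
        by (intro lip_sum lip_cmult t)
      have "(\<integral>x. ?\<phi> x \<partial>M) = (\<Sum>w\<in>words n. \<phi> (point w) * (\<integral>x. indicator (?C w) x \<partial>M))"
        using int[OF t] by (simp del: sum_mult_indicator integral_indicator)
      also have "\<dots> = \<Lambda> ?\<phi>"
        by (simp only: integral_indicator_clopen[OF sets C] me[OF C] \<Lambda>_sum[OF t])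
      finally have eqn: "(\<integral>x. ?\<phi> x \<partial>M) = \<Lambda> ?\<phi>" .
      have "\<bar>(\<integral>x. \<phi> x \<partial>M) - (\<integral>x. ?\<phi> x \<partial>M)\<bar> = \<bar>\<integral>x. \<phi> x - ?\<phi> x \<partial>M\<bar>"
        using int[OF \<phi>] int[OF lip\<phi>] by simp
      also have "\<dots> \<le> (\<integral>x. \<bar>\<phi> x - ?\<phi> x\<bar> \<partial>M)"
        by (rule integral_abs_bound)
      also have "\<dots> \<le> (\<integral>x. s * \<theta> ^ n \<partial>M)"
        using int[OF \<phi>] int[OF lip\<phi>] close by (intro integral_mono) auto
      finally have 1: "\<bar>(\<integral>x. \<phi> x \<partial>M) - (\<integral>x. ?\<phi> x \<partial>M)\<bar> \<le> s * \<theta> ^ n"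
        by (simp add: prob_space)
      have "\<phi> x \<le> ?\<phi> x + s * \<theta> ^ n" "?\<phi> x \<le> \<phi> x + s * \<theta> ^ n" for x
        using close[of x] by linarith+
      then have "\<Lambda> \<phi> \<le> \<Lambda> (\<lambda>x. ?\<phi> x + s * \<theta> ^ n)" "\<Lambda> ?\<phi> \<le> \<Lambda> (\<lambda>x. \<phi> x + s * \<theta> ^ n)"
        by (intro \<Lambda>_mono[OF \<phi> lip_add[OF lip\<phi> lip_const]] \<Lambda>_mono[OF lip\<phi> lip_add[OF \<phi> lip_const]]; blast)+
      then have "\<bar>\<Lambda> \<phi> - \<Lambda> ?\<phi>\<bar> \<le> s * \<theta> ^ n"
        unfolding \<Lambda>_add[OF lip\<phi> lip_const] \<Lambda>_add[OF \<phi> lip_const] \<Lambda>_const by linarith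
      with 1 show ?thesis unfolding eqn by linarith
    qed
    have "(\<lambda>n. 2 * (s * \<theta> ^ n)) \<longlonglongrightarrow> 2 * (s * 0)"
      using theta by (intro tendsto_mult tendsto_const LIMSEQ_power_zero) auto
    then have "\<bar>(\<integral>x. \<phi> x \<partial>M) - \<Lambda> \<phi>\<bar> \<le> 2 * (s * 0)"
      by (rule LIMSEQ_le_const) (use bd in blast)
    then show ?thesis by simp
  qed
  have stat: "stationary \<theta> L M"
    unfolding stationary_def
  proof (intro conjI allI impI prob sets)
    fix s \<phi> assume \<phi>: "lip \<theta> s (\<phi> :: 'd shift_space \<Rightarrow> real)"
    obtain t where "lip \<theta> t (transfer L \<phi>)" using lip_transfer[OF \<phi>] .
    then show "(\<integral>x. transfer L \<phi> x \<partial>M) = (\<integral>x. \<phi> x \<partial>M)"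
      using I[OF \<phi>] I \<Lambda>_transfer[OF \<phi>] by simp
  qed
  have sh: "shift \<in> M \<rightarrow>\<^sub>M borel"
    using shift_measurable by (simp add: measurable_cong_sets[OF sets refl])
  have "distr M borel shift = M"
  proof (rule measure_eq_clopens)
    show "prob_space (distr M borel shift)" by (rule prob_space_distr[OF sh])
    fix C :: "'d shift_space set" assume C: "C \<in> clopens"
    then obtain n where n: "depends_on_first n C" by (auto simp: clopens_def)
    have "depends_on_first (Suc n) (shift -` C)"
      using n agree_shift unfolding depends_on_first_def by blast
    then have C': "shift -` C \<in> clopens" by (auto simp: clopens_def)
    obtain s where s: "lip \<theta> s (indicator (shift -` C) :: _ \<Rightarrow> real)" using lipC[OF C'] by blast
    have "indicator (shift -` C) = (\<lambda>x. indicator C (shift x) :: real)"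
      by (auto simp: indicator_def)
    then have "transfer L (indicator (shift -` C)) = indicator C"
      using transfer_shift[of "indicator C"] by simp
    then have "\<Lambda> (indicator (shift -` C)) = \<Lambda> (indicator C)"
      using \<Lambda>_transfer[OF s] by simp
    then show "measure (distr M borel shift) C = measure M C"
      using C C' by (simp add: measure_distr[OF sh] clopens_subset_borel me space)
  qed (simp_all add: prob sets)
  then have "measure M (shift -` B) = measure M B" if "B \<in> sets borel" for B
    using measure_distr[OF sh that] by (simp add: space)
  then have "invariant_prob M"
    unfolding invariant_prob_def using prob sets by blast
  with stat show thesis by (rule that)
qed

text \<open>Every point has a preimage under the \<open>n\<close>-th iterate of the shift in \<open>C\<close>, and it is reached with
probability at least \<open>\<delta> ^ n\<close>. So stationary measures charge all cylinders.\<close>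

lemma transfer_funpow_indicator_ge:
  assumes "depends_on_first n C" "C \<noteq> {}"
  shows "\<delta> ^ n \<le> (transfer L ^^ n) (indicator C) y"
  using assms
proof (induction n arbitrary: C)
  case 0
  then have "C = UNIV" by (auto simp: depends_on_first_def)
  then show ?case by simp
next
  case (Suc n)
  then obtain x where x: "x \<in> C" by blast
  let ?a = "coord x 0"
  define D where "D = {y. prepend ?a y \<in> C}"
  have "shift x \<in> D" using x by (simp add: D_def)
  moreover have "depends_on_first n D"
    using Suc.prems(1) unfolding depends_on_first_def D_def by (metis agree_prepend_iff mem_Collect_eq)
  ultimately have IH: "\<delta> ^ n \<le> (transfer L ^^ n) (indicator D) y"
    using Suc.IH[of D] by blast
  have "\<delta> * indicator D z \<le> transfer L (indicator C) z" for z
  proof -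
    have "\<delta> * indicator D z \<le> exp (L (prepend ?a z)) * indicator C (prepend ?a z)"
      using exp_L_ge by (auto simp: D_def indicator_def)
    also have "\<dots> \<le> transfer L (indicator C) z"
      unfolding transfer_def by (rule member_le_sum) auto
    finally show ?thesis .
  qed
  then have "(transfer L ^^ n) (\<lambda>z. \<delta> * indicator D z) y \<le> (transfer L ^^ n) (transfer L (indicator C)) y"
    by (rule transfer_funpow_mono)
  moreover have "\<delta> * \<delta> ^ n \<le> \<delta> * (transfer L ^^ n) (indicator D) y"
    using IH delta by (intro mult_left_mono) auto
  ultimately show ?case
    by (simp add: transfer_funpow_cmult funpow_swap1)
qed

lemma stationary_measure_pos:
  assumes M: "stationary \<theta> L M" and "depends_on_first n C" "C \<noteq> {}"
  shows "0 < measure M C"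
proof -
  have C: "C \<in> clopens" using assms by (auto simp: clopens_def)
  obtain t where "lip \<theta> t (indicator C :: _ \<Rightarrow> real)" using lip_indicator[OF assms(2) theta] by blast
  note lim = \<Lambda>_lim[OF this, of undefined]
  have "\<delta> ^ n \<le> (transfer L ^^ (m + n)) (indicator C) y" for m y
    using transfer_funpow_mono[of "\<lambda>_. \<delta> ^ n" "(transfer L ^^ n) (indicator C)" m L y]
      transfer_funpow_indicator_ge[OF assms(2,3)] by (simp add: funpow_add)
  then have "\<delta> ^ n \<le> \<Lambda> (indicator C)"
    by (intro LIMSEQ_le_const[OF LIMSEQ_ignore_initial_segment[OF lim, of n]]) blast
  then show ?thesis
    using stationary_measure_eq[OF M C] delta(1) by (smt (verit) zero_less_power)
qed

end

text \<open>The exponential of the normalized potential at \<^term>\<open>prepend a x\<close> is the conditional probability of the first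
letter \<open>a\<close> given the rest, so it is determined almost everywhere, and by continuity and full support
everywhere.\<close>

theorem stationary_determines_potential:
  fixes L0 L1 :: "'d::finite shift_space \<Rightarrow> real"
  assumes L0: "normalized \<theta> K0 L0" and L1: "normalized \<theta> K1 L1"
    and M0: "stationary \<theta> L0 M" and M1: "stationary \<theta> L1 M"
  shows "L0 = L1"
proof
  fix z :: "'d shift_space"
  interpret A: normalized_potential \<theta> K0 L0 by standard fact
  interpret B: normalized_potential \<theta> K1 L1 by standard fact
  interpret prob_space M using M0 by (simp add: stationary_def)
  have sets: "sets M = sets borel" using M0 by (simp add: stationary_def)
  note int = integrable_lip[OF _ A.theta prob_space_axioms sets]
  define a where "a = coord z 0"
  define \<psi> where "\<psi> x = exp (L0 (prepend a x)) - exp (L1 (prepend a x))" for x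
  obtain s where \<psi>: "lip \<theta> s \<psi>"
    unfolding \<psi>_def using lip_diff[OF lip_prepend[OF A.lip_exp_L] lip_prepend[OF B.lip_exp_L]] by blast
  \<comment> \<open>Both transfer operators multiply \<open>\<psi>\<close> by the exponential of their potential on this test function.\<close>
  define \<phi> where "\<phi> x = indicator {x. coord x 0 = a} x * \<psi> (shift x)" for x
  have b: "\<bar>\<psi> x\<bar> \<le> \<bar>\<psi> undefined\<bar> + s" for x using lip_bounded[OF \<psi>] .
  have "depends_on_first 1 {x. coord x 0 = a}" by (auto simp: depends_on_first_def agree_def)
  note 1 = lip_indicator[OF this A.theta]
  obtain t where \<phi>: "lip \<theta> t \<phi>"
    unfolding \<phi>_def using lip_mult[OF 1 _ lip_shift[OF \<psi> A.theta] b] by (force simp: indicator_def)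
  have tr: "transfer L \<phi> x = exp (L (prepend a x)) * \<psi> x" for L x
  proof -
    have "transfer L \<phi> x = (\<Sum>b\<in>UNIV. if b = a then exp (L (prepend a x)) * \<psi> x else 0)"
      unfolding transfer_def by (intro sum.cong) (auto simp: \<phi>_def)
    then show ?thesis by simp
  qed
  obtain t0 where t0: "lip \<theta> t0 (transfer L0 \<phi>)" using A.lip_transfer[OF \<phi>] .
  obtain t1 where t1: "lip \<theta> t1 (transfer L1 \<phi>)" using B.lip_transfer[OF \<phi>] .
  have "(\<integral>x. \<psi> x * \<psi> x \<partial>M) = (\<integral>x. transfer L0 \<phi> x - transfer L1 \<phi> x \<partial>M)"
    by (simp add: tr \<psi>_def algebra_simps)
  also have "\<dots> = 0"
    using M0 M1 \<phi> int[OF t0] int[OF t1] by (simp add: stationary_def)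
  finally have 0: "(\<integral>x. \<psi> x * \<psi> x \<partial>M) = 0" .
  have "\<psi> (shift z) = 0"
  proof (rule ccontr)
    let ?z = "shift z"
    assume ne: "\<psi> ?z \<noteq> 0"
    have "(\<lambda>n. s * \<theta> ^ n) \<longlonglongrightarrow> s * 0"
      using A.theta by (intro tendsto_mult LIMSEQ_power_zero tendsto_const) auto
    then have "eventually (\<lambda>n. s * \<theta> ^ n < \<bar>\<psi> ?z\<bar> / 2) sequentially"
      using ne by (intro order_tendstoD) auto
    then obtain n where n: "s * \<theta> ^ n < \<bar>\<psi> ?z\<bar> / 2" by (auto simp: eventually_sequentially)
    let ?C = "{x. word n x = word n ?z}"
    have C: "depends_on_first n ?C" using depends_on_first_word .
    have "0 < measure M ?C" by (rule A.stationary_measure_pos[OF M0 C]) auto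
    then have "0 < (\<psi> ?z)\<^sup>2 / 4 * measure M ?C" using ne by simp
    also have "\<dots> = (\<integral>x. (\<psi> ?z)\<^sup>2 / 4 * indicator ?C x \<partial>M)"
      using C integral_indicator_clopen[OF sets, of ?C] unfolding clopens_def by force
    also have "\<dots> \<le> (\<integral>x. \<psi> x * \<psi> x \<partial>M)"
    proof (rule integral_mono)
      show "integrable M (\<lambda>x. (\<psi> ?z)\<^sup>2 / 4 * indicator ?C x)"
        by (intro integrable_mult_right int[OF lip_indicator[OF C A.theta]])
      show "integrable M (\<lambda>x. \<psi> x * \<psi> x)"
        by (rule int[OF lip_mult[OF \<psi> b \<psi> b]])
      fix x
      have "(\<psi> ?z)\<^sup>2 / 4 \<le> \<psi> x * \<psi> x" if "agree n x ?z"
      proof -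
        have "\<bar>\<psi> ?z\<bar> / 2 \<le> \<bar>\<psi> x\<bar>" using lipD[OF \<psi> that] n by linarith
        then have "(\<bar>\<psi> ?z\<bar> / 2)\<^sup>2 \<le> \<bar>\<psi> x\<bar>\<^sup>2" by (rule power_mono) simp
        then show ?thesis by (simp add: power2_eq_square)
      qed
      then show "(\<psi> ?z)\<^sup>2 / 4 * indicator ?C x \<le> \<psi> x * \<psi> x"
        by (auto simp: indicator_def word_eq_iff)
    qed
    finally show False using 0 by simp
  qed
  then show "L0 z = L1 z" by (simp add: \<psi>_def a_def)
qed

section \<open>Entropy of random variables with finitely many values\<close>

text \<open>Summed over two probability vectors this is Gibbs' inequality with the squared Hellinger distance as
remainder. The remainder is what identifies the case of equality in the variational principle.\<close>

lemma kl_term: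
  fixes p q :: real
  assumes "0 \<le> p" "0 \<le> q" "q = 0 \<Longrightarrow> p = 0"
  shows "p - q + (sqrt p - sqrt q)\<^sup>2 \<le> p * (ln p - ln q)"
proof (cases "p = 0")
  case False
  then have pq: "0 < p" "0 < q" using assms by (auto simp: less_le)
  have "ln (sqrt q / sqrt p) \<le> sqrt q / sqrt p - 1"
    using pq by (intro ln_le_minus_one) auto
  then have "ln q - ln p \<le> 2 * (sqrt q / sqrt p - 1)"
    using pq by (simp add: ln_div ln_sqrt)
  then have "p * (ln q - ln p) \<le> p * (2 * (sqrt q / sqrt p - 1))"
    using pq by (intro mult_left_mono) auto
  also have "\<dots> = 2 * (p / sqrt p * sqrt q) - 2 * p"
    by (simp add: algebra_simps)
  also have "p / sqrt p = sqrt p"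
    using pq by (intro real_div_sqrt) auto
  finally show ?thesis
    using pq by (simp add: power2_diff algebra_simps)
qed (use assms in simp)

lemma tendsto_x_ln_x:
  fixes p :: "nat \<Rightarrow> real"
  assumes p: "p \<longlonglongrightarrow> l" and nn: "\<And>n. 0 \<le> p n"
  shows "(\<lambda>n. p n * ln (p n)) \<longlonglongrightarrow> l * ln l"
proof (cases "l = 0")
  case False
  then show ?thesis using p by (intro tendsto_intros)
next
  case True
  have "\<bar>t * ln t\<bar> \<le> 2 * sqrt t" if "0 \<le> t" "t \<le> 1" for t :: real
  proof (cases "t = 0")
    case False
    then have t: "0 < t" using that by simp
    have "ln (1 / sqrt t) \<le> 1 / sqrt t - 1"
      using t by (intro ln_le_minus_one) auto
    then have "- ln t \<le> 2 * (1 / sqrt t)"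
      using t by (simp add: ln_div ln_sqrt)
    then have "t * (- ln t) \<le> t * (2 * (1 / sqrt t))"
      using t by (intro mult_left_mono) auto
    also have "\<dots> = 2 * (t / sqrt t)"
      by simp
    also have "t / sqrt t = sqrt t"
      using t by (intro real_div_sqrt) auto
    finally show ?thesis
      using that t by (simp add: abs_mult)
  qed simp
  moreover have "eventually (\<lambda>n. p n < 1) sequentially"
    using p True by (intro order_tendstoD) auto
  ultimately have "eventually (\<lambda>n. norm (p n * ln (p n)) \<le> 2 * sqrt (p n)) sequentially"
    using nn by (auto elim!: eventually_mono)
  moreover have "(\<lambda>n. 2 * sqrt (p n)) \<longlonglongrightarrow> 2 * sqrt 0"
    using p True by (intro tendsto_intros) auto
  ultimately show ?thesis
    using True by (auto intro: Lim_null_comparison)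
qed

text \<open>For a concave increasing sequence the increments decrease to a limit, and this is also the limit of the
averages. For block entropies it makes the entropy rate the infimum of the conditional entropies.\<close>

lemma concave_sequence_average:
  fixes e :: "nat \<Rightarrow> real"
  assumes "\<And>n. e (Suc (Suc n)) + e n \<le> 2 * e (Suc n)" "\<And>n. e n \<le> e (Suc n)"
  obtains h where "(\<lambda>n. e (Suc n) - e n) \<longlonglongrightarrow> h" "(\<lambda>n. e n / real n) \<longlonglongrightarrow> h" "\<And>n. h \<le> e (Suc n) - e n"
proof -
  define d where "d n = e (Suc n) - e n" for n
  have dec: "decseq d"
    using assms(1) by (intro decseq_SucI) (simp add: d_def algebra_simps)
  obtain h where h: "d \<longlonglongrightarrow> h" "\<And>n. h \<le> d n"
    using decseq_convergent[OF dec, of 0] assms(2) by (auto simp: d_def)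
  have h0: "0 \<le> h"
    using LIMSEQ_le_const[OF h(1)] assms(2) by (simp add: d_def)
  have lower: "e 0 + real n * h \<le> e n" for n
  proof (induction n)
    case (Suc n)
    then show ?case using h(2)[of n] by (simp add: d_def algebra_simps)
  qed simp
  have "(\<lambda>n. e n / real n) \<longlonglongrightarrow> h"
  proof (rule LIMSEQ_I)
    fix r :: real assume r: "0 < r"
    obtain N where N: "\<And>n. n \<ge> N \<Longrightarrow> d n < h + r / 2"
      using order_tendstoD(2)[OF h(1), of "h + r / 2"] r by (auto simp: eventually_sequentially)
    have upper: "e (N + n) \<le> e N + real n * (h + r / 2)" for n
    proof (induction n)
      case (Suc n)
      then show ?case using N[of "N + n"] by (simp add: d_def algebra_simps add_divide_distrib)
    qed simp
    define c where "c = \<bar>e 0\<bar> + \<bar>e N\<bar>"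
    obtain M where M: "c / (r / 2) < real M" using reals_Archimedean2 by blast
    have "norm (e n / real n - h) < r" if n: "n \<ge> max (Suc M) (Suc N)" for n
    proof -
      have n0: "0 < real n" using n by simp
      have "c < real M * (r / 2)" using M r by (simp add: field_simps)
      also have "\<dots> \<le> real n * (r / 2)" using n r by (intro mult_right_mono) auto
      finally have c: "c < real n * (r / 2)" .
      have "e n \<le> e N + real (n - N) * (h + r / 2)"
        using upper[of "n - N"] n by simp
      also have "real (n - N) * (h + r / 2) \<le> real n * (h + r / 2)"
        using h0 r by (intro mult_right_mono) auto
      finally have "e n < real n * (h + r)" using c by (simp add: c_def algebra_simps)
      moreover have "real n * (h - r) < e n"
        using lower[of n] c r n0 by (simp add: c_def algebra_simps)
      ultimately have "h - r < e n / real n" "e n / real n < h + r"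
        using n0 by (simp_all add: field_simps)
      then show ?thesis by (simp add: abs_less_iff)
    qed
    then show "\<exists>no. \<forall>n\<ge>no. norm (e n / real n - h) < r" by blast
  qed
  then show thesis using h by (intro that) (simp_all add: d_def[abs_def])
qed

text \<open>The entropy of the partition into the level sets of \<open>X\<close>. Random variables are more convenient than
partitions, since joins are just pairs.\<close>

definition ent :: "'a measure \<Rightarrow> ('a \<Rightarrow> 'b) \<Rightarrow> real" where
  "ent M X = - (\<Sum>v\<in>range X. measure M (X -` {v}) * ln (measure M (X -` {v})))"

text \<open>Plain preimages, since every measure considered here lives on the whole type.\<close>

definition finite_rv :: "'a measure \<Rightarrow> ('a \<Rightarrow> 'b) \<Rightarrow> bool" where
  "finite_rv M X \<longleftrightarrow> finite (range X) \<and> (\<forall>v. X -` {v} \<in> sets M)"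

lemma ent_eq_partition_entropy: "ent M X = partition_entropy M ((\<lambda>v. X -` {v}) ` range X)"
proof -
  have "inj_on (\<lambda>v. X -` {v}) (range X)" by (auto simp: inj_on_def)
  then show ?thesis by (simp add: ent_def partition_entropy_def sum.reindex)
qed

text \<open>Entropy depends on the partition only. This lemma rearranges nested pairs and blocks.\<close>

lemma ent_cong:
  assumes "\<And>x y. X x = X y \<longleftrightarrow> Y x = Y y"
  shows "ent M X = ent M Y"
proof -
  have "(\<lambda>v. X -` {v}) ` range X = (\<lambda>v. Y -` {v}) ` range Y"
    using assms by (auto simp: image_iff vimage_def)
  then show ?thesis by (simp add: ent_eq_partition_entropy)
qed

lemma ent_superset:
  assumes "finite S" "range X \<subseteq> S"
  shows "ent M X = - (\<Sum>v\<in>S. measure M (X -` {v}) * ln (measure M (X -` {v})))"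
proof -
  have "X -` {v} = {}" if "v \<notin> range X" for v using that by auto
  then show ?thesis
    unfolding ent_def using assms by (intro arg_cong[where f = uminus] sum.mono_neutral_left) auto
qed

locale full_prob_space = prob_space +
  assumes space: "space M = UNIV"
begin

lemma finite_rv_const: "finite_rv M (\<lambda>_. c)"
proof -
  have "(\<lambda>_. c) -` {v} \<in> sets M" for v
    using sets.top[of M] space by (cases "c = v") (auto simp: vimage_def)
  then show ?thesis by (auto simp: finite_rv_def)
qed

lemma finite_rv_compose:
  assumes "finite_rv M X" shows "finite_rv M (\<lambda>x. f (X x))"
proof -
  have "(\<lambda>x. f (X x)) -` {v} = (\<Union>u\<in>range X \<inter> {u. f u = v}. X -` {u})" for v by auto
  moreover have "(\<Union>u\<in>range X \<inter> {u. f u = v}. X -` {u}) \<in> sets M" for v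
    using assms by (intro sets.finite_UN) (auto simp: finite_rv_def)
  moreover have "finite (range (\<lambda>x. f (X x)))"
    using assms finite_imageI[of "range X" f] by (simp add: finite_rv_def image_image)
  ultimately show ?thesis by (simp add: finite_rv_def)
qed

lemma finite_rv_Pair:
  assumes "finite_rv M X" "finite_rv M Y" shows "finite_rv M (\<lambda>x. (X x, Y x))"
proof -
  have "(\<lambda>x. (X x, Y x)) -` {v} = X -` {fst v} \<inter> Y -` {snd v}" for v by auto
  moreover have "finite (range (\<lambda>x. (X x, Y x)))"
    by (rule finite_subset[of _ "range X \<times> range Y"]) (use assms in \<open>auto simp: finite_rv_def\<close>)
  ultimately show ?thesis using assms by (auto simp: finite_rv_def)
qed

lemma marginal:
  assumes X: "finite_rv M X" and B: "B \<in> sets M"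
  shows "(\<Sum>v\<in>range X. prob (X -` {v} \<inter> B)) = prob B"
proof -
  have "prob (\<Union>v\<in>range X. X -` {v} \<inter> B) = (\<Sum>v\<in>range X. prob (X -` {v} \<inter> B))"
    using X B by (intro finite_measure_finite_Union) (auto simp: finite_rv_def disjoint_family_on_def)
  moreover have "(\<Union>v\<in>range X. X -` {v} \<inter> B) = B" by auto
  ultimately show ?thesis by simp
qed

lemma ent_Pair:
  assumes "finite_rv M X" "finite_rv M Y"
  shows "ent M (\<lambda>x. (X x, Y x)) = - (\<Sum>u\<in>range X. \<Sum>v\<in>range Y. prob (X -` {u} \<inter> Y -` {v}) * ln (prob (X -` {u} \<inter> Y -` {v})))"
proof -
  have "(\<lambda>x. (X x, Y x)) -` {w} = X -` {fst w} \<inter> Y -` {snd w}" for w by (cases w) auto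
  moreover have "ent M (\<lambda>x. (X x, Y x)) = - (\<Sum>w\<in>range X \<times> range Y. prob ((\<lambda>x. (X x, Y x)) -` {w}) * ln (prob ((\<lambda>x. (X x, Y x)) -` {w})))"
    using assms by (intro ent_superset) (auto simp: finite_rv_def)
  ultimately show ?thesis by (simp add: sum.cartesian_product case_prod_beta')
qed

lemma ent_le_Pair:
  assumes X: "finite_rv M X" and Y: "finite_rv M Y"
  shows "ent M Y \<le> ent M (\<lambda>x. (X x, Y x))"
proof -
  let ?p = "\<lambda>u v. prob (X -` {u} \<inter> Y -` {v})" and ?q = "\<lambda>v. prob (Y -` {v})"
  have "(\<Sum>u\<in>range X. \<Sum>v\<in>range Y. ?p u v * ln (?p u v)) \<le> (\<Sum>u\<in>range X. \<Sum>v\<in>range Y. ?p u v * ln (?q v))"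
  proof (intro sum_mono)
    fix u v
    have "?p u v \<le> ?q v" using Y by (intro finite_measure_mono) (auto simp: finite_rv_def)
    then show "?p u v * ln (?p u v) \<le> ?p u v * ln (?q v)"
      using zero_less_measure_iff[of M "X -` {u} \<inter> Y -` {v}"]
      by (cases "?p u v = 0") (auto intro!: mult_left_mono ln_mono)
  qed
  also have "\<dots> = (\<Sum>v\<in>range Y. ?q v * ln (?q v))"
    using marginal[OF X] Y by (subst sum.swap) (simp add: sum_distrib_right[symmetric] finite_rv_def)
  finally show ?thesis unfolding ent_Pair[OF assms] by (simp add: ent_def)
qed

lemma ent_mono:
  assumes X: "finite_rv M X" and f: "\<And>x y. X x = X y \<Longrightarrow> Y x = Y y"
  shows "ent M Y \<le> ent M X"
proof -
  define g where "g u = Y (SOME x. X x = u)" for u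
  have g: "g (X x) = Y x" for x
    unfolding g_def by (rule f) (rule someI[of "\<lambda>y. X y = X x" x], rule refl)
  have "finite_rv M (\<lambda>x. g (X x))" using X by (rule finite_rv_compose)
  then have "finite_rv M Y" by (simp add: g)
  then have "ent M Y \<le> ent M (\<lambda>x. (X x, Y x))" using ent_le_Pair X by blast
  also have "\<dots> = ent M X" by (rule ent_cong) (metis f prod.inject)
  finally show ?thesis .
qed

text \<open>Conditioning on more information decreases entropy: \<open>H(X | Y, Z) \<le> H(X | Z)\<close>, with conditional entropies
written as differences. It is Gibbs' inequality for the joint law against the one that makes \<open>X\<close> and \<open>Y\<close>
independent given \<open>Z\<close>. The properties of entropy rates rest on it.\<close>

theorem strong_subadditivity:
  assumes X: "finite_rv M X" and Y: "finite_rv M Y" and Z: "finite_rv M Z"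
  shows "ent M (\<lambda>x. (X x, Y x, Z x)) + ent M Z \<le> ent M (\<lambda>x. (X x, Z x)) + ent M (\<lambda>x. (Y x, Z x))"
proof -
  let ?A = "range X" and ?B = "range Y" and ?C = "range Z"
  define p where "p u v w = prob (X -` {u} \<inter> Y -` {v} \<inter> Z -` {w})" for u v w
  define px where "px u w = prob (X -` {u} \<inter> Z -` {w})" for u w
  define py where "py v w = prob (Y -` {v} \<inter> Z -` {w})" for v w
  define pz where "pz w = prob (Z -` {w})" for w
  \<comment> \<open>The law that makes \<open>X\<close> and \<open>Y\<close> independent given \<open>Z\<close>.\<close>
  define q where "q u v w = px u w * py v w / pz w" for u v w
  have meas: "X -` {u} \<in> sets M" "Y -` {v} \<in> sets M" "Z -` {w} \<in> sets M" for u v w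
    using X Y Z by (auto simp: finite_rv_def)
  have px_p: "(\<Sum>v\<in>?B. p u v w) = px u w" for u w
    using marginal[OF Y, of "X -` {u} \<inter> Z -` {w}"] meas by (simp add: p_def px_def Int_ac)
  have py_p: "(\<Sum>u\<in>?A. p u v w) = py v w" for v w
    using marginal[OF X, of "Y -` {v} \<inter> Z -` {w}"] meas by (simp add: p_def py_def Int_ac)
  have pz_px: "(\<Sum>u\<in>?A. px u w) = pz w" and pz_py: "(\<Sum>v\<in>?B. py v w) = pz w" for w
    using marginal[OF X, of "Z -` {w}"] marginal[OF Y, of "Z -` {w}"] meas
    by (simp_all add: px_def py_def pz_def)
  have sum_pz: "(\<Sum>w\<in>?C. pz w) = 1"
    using marginal[OF Z, of UNIV] sets.top[of M] prob_space by (simp add: pz_def space)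
  have nn: "0 \<le> p u v w" "0 \<le> px u w" "0 \<le> py v w" "0 \<le> pz w" for u v w
    by (simp_all add: p_def px_def py_def pz_def)
  have le: "p u v w \<le> px u w" "p u v w \<le> py v w" "px u w \<le> pz w" for u v w
    unfolding p_def px_def py_def pz_def using meas by (auto intro!: finite_measure_mono)
  have key: "p u v w - q u v w \<le> p u v w * (ln (p u v w) + ln (pz w) - ln (px u w) - ln (py v w))" for u v w
  proof (cases "p u v w = 0")
    case True
    then show ?thesis using nn by (simp add: q_def)
  next
    case False
    then have pos: "0 < p u v w" "0 < px u w" "0 < py v w" "0 < pz w"
      using False nn(1)[of u v w] le(1)[of u v w] le(2)[of u v w] le(3)[of u w] by linarith+
    then have "0 < q u v w" by (simp add: q_def)
    moreover have ln_q: "ln (p u v w) + ln (pz w) - ln (px u w) - ln (py v w) = ln (p u v w) - ln (q u v w)"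
      using pos by (simp add: q_def ln_div ln_mult)
    ultimately show ?thesis
      using kl_term[of "p u v w" "q u v w"] pos(1) zero_le_power2[of "sqrt (p u v w) - sqrt (q u v w)"]
      unfolding ln_q by linarith
  qed
  have sum_q: "(\<Sum>u\<in>?A. \<Sum>v\<in>?B. \<Sum>w\<in>?C. q u v w) = 1"
  proof -
    have "(\<Sum>u\<in>?A. \<Sum>v\<in>?B. \<Sum>w\<in>?C. q u v w) = (\<Sum>u\<in>?A. \<Sum>w\<in>?C. \<Sum>v\<in>?B. q u v w)"
      by (rule sum.cong[OF refl sum.swap])
    also have "\<dots> = (\<Sum>w\<in>?C. \<Sum>u\<in>?A. \<Sum>v\<in>?B. q u v w)"
      by (rule sum.swap)
    also have "\<dots> = (\<Sum>w\<in>?C. pz w)"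
    proof (rule sum.cong[OF refl])
      fix w
      have "(\<Sum>u\<in>?A. \<Sum>v\<in>?B. q u v w) = (\<Sum>u\<in>?A. px u w) * (\<Sum>v\<in>?B. py v w) / pz w"
        by (simp add: q_def sum_product sum_divide_distrib)
      then show "(\<Sum>u\<in>?A. \<Sum>v\<in>?B. q u v w) = pz w"
        by (simp add: pz_px pz_py)
    qed
    finally show ?thesis by (simp add: sum_pz)
  qed
  have sum_p: "(\<Sum>u\<in>?A. \<Sum>v\<in>?B. \<Sum>w\<in>?C. p u v w) = 1"
  proof -
    have "(\<Sum>u\<in>?A. \<Sum>v\<in>?B. \<Sum>w\<in>?C. p u v w) = (\<Sum>u\<in>?A. \<Sum>w\<in>?C. \<Sum>v\<in>?B. p u v w)"
      by (rule sum.cong[OF refl sum.swap])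
    also have "\<dots> = (\<Sum>w\<in>?C. \<Sum>u\<in>?A. px u w)"
      by (simp add: px_p) (rule sum.swap)
    finally show ?thesis by (simp add: pz_px sum_pz)
  qed
  have "(\<Sum>u\<in>?A. \<Sum>v\<in>?B. \<Sum>w\<in>?C. p u v w - q u v w)
    \<le> (\<Sum>u\<in>?A. \<Sum>v\<in>?B. \<Sum>w\<in>?C. p u v w * (ln (p u v w) + ln (pz w) - ln (px u w) - ln (py v w)))"
    by (intro sum_mono key)
  then have "0 \<le> (\<Sum>u\<in>?A. \<Sum>v\<in>?B. \<Sum>w\<in>?C. p u v w * ln (p u v w)) + (\<Sum>u\<in>?A. \<Sum>v\<in>?B. \<Sum>w\<in>?C. p u v w * ln (pz w))
    - (\<Sum>u\<in>?A. \<Sum>v\<in>?B. \<Sum>w\<in>?C. p u v w * ln (px u w)) - (\<Sum>u\<in>?A. \<Sum>v\<in>?B. \<Sum>w\<in>?C. p u v w * ln (py v w))"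
    by (simp add: sum_subtractf sum.distrib sum_p sum_q algebra_simps)
  moreover have "(\<Sum>u\<in>?A. \<Sum>v\<in>?B. \<Sum>w\<in>?C. p u v w * ln (p u v w)) = - ent M (\<lambda>x. (X x, Y x, Z x))"
  proof -
    have "ent M (\<lambda>x. (X x, Y x, Z x)) = - (\<Sum>c\<in>?A \<times> ?B \<times> ?C. prob ((\<lambda>x. (X x, Y x, Z x)) -` {c}) * ln (prob ((\<lambda>x. (X x, Y x, Z x)) -` {c})))"
      using X Y Z by (intro ent_superset) (auto simp: finite_rv_def)
    moreover have "prob ((\<lambda>x. (X x, Y x, Z x)) -` {c}) = p (fst c) (fst (snd c)) (snd (snd c))" for c
      unfolding p_def by (rule arg_cong[where f = prob]) (cases c, auto)
    ultimately show ?thesis by (simp add: sum.cartesian_product case_prod_beta')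
  qed
  moreover have "(\<Sum>u\<in>?A. \<Sum>v\<in>?B. \<Sum>w\<in>?C. p u v w * ln (pz w)) = - ent M Z"
  proof -
    have "(\<Sum>u\<in>?A. \<Sum>v\<in>?B. \<Sum>w\<in>?C. p u v w * ln (pz w)) = (\<Sum>u\<in>?A. \<Sum>w\<in>?C. \<Sum>v\<in>?B. p u v w * ln (pz w))"
      by (rule sum.cong[OF refl sum.swap])
    also have "\<dots> = (\<Sum>w\<in>?C. \<Sum>u\<in>?A. px u w * ln (pz w))"
      unfolding sum_distrib_right[symmetric] px_p unfolding sum_distrib_right by (rule sum.swap)
    also have "\<dots> = - ent M Z"
      by (simp add: sum_distrib_right[symmetric] pz_px ent_def pz_def)
    finally show ?thesis .
  qed
  moreover have "(\<Sum>u\<in>?A. \<Sum>v\<in>?B. \<Sum>w\<in>?C. p u v w * ln (px u w)) = - ent M (\<lambda>x. (X x, Z x))"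
  proof -
    have "(\<Sum>u\<in>?A. \<Sum>v\<in>?B. \<Sum>w\<in>?C. p u v w * ln (px u w)) = (\<Sum>u\<in>?A. \<Sum>w\<in>?C. \<Sum>v\<in>?B. p u v w * ln (px u w))"
      by (rule sum.cong[OF refl sum.swap])
    then show ?thesis
      by (simp add: sum_distrib_right[symmetric] px_p ent_Pair[OF X Z] px_def)
  qed
  moreover have "(\<Sum>u\<in>?A. \<Sum>v\<in>?B. \<Sum>w\<in>?C. p u v w * ln (py v w)) = - ent M (\<lambda>x. (Y x, Z x))"
  proof -
    have "(\<Sum>u\<in>?A. \<Sum>v\<in>?B. \<Sum>w\<in>?C. p u v w * ln (py v w)) = (\<Sum>v\<in>?B. \<Sum>u\<in>?A. \<Sum>w\<in>?C. p u v w * ln (py v w))"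
      by (rule sum.swap)
    also have "\<dots> = (\<Sum>v\<in>?B. \<Sum>w\<in>?C. \<Sum>u\<in>?A. p u v w * ln (py v w))"
      by (rule sum.cong[OF refl sum.swap])
    finally show ?thesis
      by (simp add: sum_distrib_right[symmetric] py_p ent_Pair[OF Y Z] py_def)
  qed
  ultimately show ?thesis by linarith
qed

text \<open>If \<open>Z j\<close> equals \<open>X\<close> up to small probability, then the joint law tends to the one concentrated on the
diagonal, and \<open>t * ln t\<close> is continuous, also at zero.\<close>

lemma conditional_entropy_vanishes:
  fixes X :: "'a \<Rightarrow> 'b"
  assumes X: "finite_rv M X" and Z: "\<And>j. finite_rv M (Z j)" "\<And>j. range (Z j) \<subseteq> range X"
    and lim: "(\<lambda>j. prob {x. X x \<noteq> Z j x}) \<longlonglongrightarrow> 0"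
  shows "(\<lambda>j. ent M (\<lambda>x. (X x, Z j x)) - ent M (Z j)) \<longlonglongrightarrow> 0"
proof -
  let ?R = "range X"
  have fin: "finite ?R" using X by (simp add: finite_rv_def)
  have meas: "X -` {u} \<in> sets M" "Z j -` {u} \<in> sets M" for u j
    using X Z by (auto simp: finite_rv_def)
  have D: "{x. X x \<noteq> Z j x} \<in> sets M" for j
  proof -
    have "{x. X x \<noteq> Z j x} = (\<lambda>x. X x \<noteq> Z j x) -` {True}" by auto
    also have "\<dots> \<in> sets M"
      using finite_rv_compose[OF finite_rv_Pair[OF X Z(1)[of j]], of "\<lambda>(a, b). a \<noteq> b"] by (simp add: finite_rv_def)
    finally show ?thesis .
  qed
  define p where "p j u v = prob (X -` {u} \<inter> Z j -` {v})" for j u v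
  define r where "r u = prob (X -` {u})" for u
  have p_lim: "(\<lambda>j. p j u v) \<longlonglongrightarrow> (if u = v then r u else 0)" for u v
  proof -
    have "norm (p j u v - (if u = v then r u else 0)) \<le> prob {x. X x \<noteq> Z j x}" for j
    proof (cases "u = v")
      case True
      have "r u = p j u u + prob (X -` {u} - Z j -` {u})"
        unfolding r_def p_def using meas by (simp add: finite_measure_Diff' )
      moreover have "prob (X -` {u} - Z j -` {u}) \<le> prob {x. X x \<noteq> Z j x}"
        using D by (intro finite_measure_mono) auto
      ultimately show ?thesis using True by simp
    next
      case False
      have "p j u v \<le> prob {x. X x \<noteq> Z j x}"
        unfolding p_def using D False by (intro finite_measure_mono) auto
      then show ?thesis using False by (simp add: p_def)
    qed
    then have "(\<lambda>j. p j u v - (if u = v then r u else 0)) \<longlonglongrightarrow> 0"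
      by (intro Lim_null_comparison[OF _ lim]) auto
    then show ?thesis by (rule LIM_zero_cancel)
  qed
  have Zp: "prob (Z j -` {v}) = (\<Sum>u\<in>?R. p j u v)" for j v
    using marginal[OF X meas(2)] by (simp add: p_def)
  have Z_lim: "(\<lambda>j. prob (Z j -` {v})) \<longlonglongrightarrow> r v" if "v \<in> ?R" for v
  proof -
    have "(\<lambda>j. \<Sum>u\<in>?R. p j u v) \<longlonglongrightarrow> (\<Sum>u\<in>?R. if u = v then r u else 0)"
      by (intro tendsto_sum p_lim)
    also have "(\<Sum>u\<in>?R. if u = v then r u else 0) = r v" using fin that by simp
    finally show ?thesis by (simp add: Zp)
  qed
  have entZ: "ent M (Z j) = - (\<Sum>v\<in>?R. prob (Z j -` {v}) * ln (prob (Z j -` {v})))" for j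
    by (rule ent_superset[OF fin Z(2)])
  have entXZ: "ent M (\<lambda>x. (X x, Z j x)) = - (\<Sum>u\<in>?R. \<Sum>v\<in>?R. p j u v * ln (p j u v))" for j
  proof -
    have "ent M (\<lambda>x. (X x, Z j x)) = - (\<Sum>c\<in>?R \<times> ?R. prob ((\<lambda>x. (X x, Z j x)) -` {c}) * ln (prob ((\<lambda>x. (X x, Z j x)) -` {c})))"
      using fin Z(2) by (intro ent_superset) auto
    moreover have "prob ((\<lambda>x. (X x, Z j x)) -` {c}) = p j (fst c) (snd c)" for c
      unfolding p_def by (rule arg_cong[where f = prob]) (cases c, auto)
    ultimately show ?thesis by (simp add: sum.cartesian_product case_prod_beta')
  qed
  have "(\<lambda>j. ent M (\<lambda>x. (X x, Z j x)) - ent M (Z j)) \<longlonglongrightarrow>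
     - (\<Sum>u\<in>?R. \<Sum>v\<in>?R. (if u = v then r u else 0) * ln (if u = v then r u else 0)) - - (\<Sum>v\<in>?R. r v * ln (r v))"
    unfolding entZ entXZ
    by (intro tendsto_diff tendsto_minus tendsto_sum tendsto_x_ln_x p_lim Z_lim) (auto simp: p_def)
  moreover have "(\<Sum>u\<in>?R. \<Sum>v\<in>?R. (if u = v then r u else 0) * ln (if u = v then r u else 0)) = (\<Sum>v\<in>?R. r v * ln (r v))"
  proof (rule sum.cong[OF refl])
    fix u assume u: "u \<in> ?R"
    have "(\<Sum>v\<in>?R. (if u = v then r u else 0) * ln (if u = v then r u else 0)) = (\<Sum>v\<in>?R. if u = v then r u * ln (r u) else 0)"
      by (rule sum.cong) auto
    then show "(\<Sum>v\<in>?R. (if u = v then r u else 0) * ln (if u = v then r u else 0)) = r u * ln (r u)"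
      using fin u by simp
  qed
  ultimately show ?thesis by simp
qed

end

section \<open>The Kolmogorov-Sinai theorem for the shift\<close>

definition block :: "('d shift_space \<Rightarrow> 'b) \<Rightarrow> nat \<Rightarrow> 'd shift_space \<Rightarrow> 'b list" where
  "block X n x = map (\<lambda>i. X ((shift ^^ i) x)) [0..<n]"

lemma block_eq_iff: "block X n x = block X n y \<longleftrightarrow> (\<forall>i<n. X ((shift ^^ i) x) = X ((shift ^^ i) y))"
  by (auto simp: block_def)

lemma block_Suc: "block X (Suc n) x = block X n x @ [X ((shift ^^ n) x)]"
  by (simp add: block_def)

lemma block_Suc_shift: "block X (Suc n) x = X x # block X n (shift x)"
  unfolding block_def map_upt_Suc by (simp add: funpow_swap1)

lemma word_eq_block: "word = block (\<lambda>x. coord x 0)"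
  by (simp add: fun_eq_iff word_def block_def)

lemma surj_shift: "surj shift"
  by (rule surjI[of _ "prepend undefined"]) simp

definition cell :: "'a set set \<Rightarrow> 'a \<Rightarrow> 'a set" where
  "cell \<xi> x = (THE B. B \<in> \<xi> \<and> x \<in> B)"

lemma cellI:
  assumes "partition_on UNIV \<xi>" "B \<in> \<xi>" "x \<in> B"
  shows "cell \<xi> x = B"
  unfolding cell_def
proof (rule the_equality)
  fix B' assume "B' \<in> \<xi> \<and> x \<in> B'"
  then show "B' = B"
    using assms disjointD[OF partition_onD2[OF assms(1)], of B' B] by blast
qed (use assms in simp)

lemma cell:
  assumes "partition_on UNIV \<xi>"
  shows "cell \<xi> x \<in> \<xi>" "x \<in> cell \<xi> x"
proof -
  obtain B where "B \<in> \<xi>" "x \<in> B" using partition_onD1[OF assms] by blast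
  then show "cell \<xi> x \<in> \<xi>" "x \<in> cell \<xi> x" using cellI[OF assms, of B x] by simp_all
qed

lemma mem_eq_cell_iff: "partition_on UNIV \<xi> \<Longrightarrow> y \<in> cell \<xi> x \<longleftrightarrow> cell \<xi> y = cell \<xi> x"
  using cell[of \<xi> y] cell[of \<xi> x] cellI[of \<xi> "cell \<xi> x" y] by auto

text \<open>The cells of the iterated join are the level sets of the itinerary. The refinement runs over a set of
partitions, not over the times \<open>i < n\<close>; this does no harm if two of them coincide, since then also the
cells that contain a given point coincide.\<close>

lemma iterated_join_eq:
  assumes \<xi>: "partition_on UNIV \<xi>"
  shows "iterated_join \<xi> n = (\<lambda>v. block (cell \<xi>) n -` {v}) ` range (block (cell \<xi>) n)"
proof -
  let ?P = "(\<lambda>i. (\<lambda>B. (shift ^^ i) -` B) ` \<xi>) ` {..<n}"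
  let ?B = "block (cell \<xi>) n"
  have cls: "y \<in> ?B -` {?B x} \<longleftrightarrow> (\<forall>i<n. (shift ^^ i) y \<in> cell \<xi> ((shift ^^ i) x))" for x y
    by (simp add: block_eq_iff mem_eq_cell_iff[OF \<xi>])
  have inter: "\<Inter> (f ` ?P) = ?B -` {?B x}" if f: "f \<in> (\<Pi> P\<in>?P. P)" and x: "x \<in> \<Inter> (f ` ?P)" for f x
  proof -
    have *: "f ((\<lambda>B. (shift ^^ i) -` B) ` \<xi>) = (shift ^^ i) -` cell \<xi> ((shift ^^ i) x)" if "i < n" for i
    proof -
      have "f ((\<lambda>B. (shift ^^ i) -` B) ` \<xi>) \<in> (\<lambda>B. (shift ^^ i) -` B) ` \<xi>"
        by (rule Pi_mem[OF f]) (use that in blast)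
      then obtain B where B: "B \<in> \<xi>" "f ((\<lambda>B. (shift ^^ i) -` B) ` \<xi>) = (shift ^^ i) -` B" by blast
      have "x \<in> f ((\<lambda>B. (shift ^^ i) -` B) ` \<xi>)" using x that by blast
      then have "cell \<xi> ((shift ^^ i) x) = B" using B by (intro cellI[OF \<xi>]) auto
      then show ?thesis using B by simp
    qed
    have "y \<in> \<Inter> (f ` ?P) \<longleftrightarrow> y \<in> ?B -` {?B x}" for y
      unfolding cls using * by auto
    then show ?thesis by blast
  qed
  show ?thesis
  proof (intro equalityI subsetI)
    fix A assume "A \<in> iterated_join \<xi> n"
    then obtain f where f: "f \<in> (\<Pi> P\<in>?P. P)" "A = \<Inter> (f ` ?P)" "A \<noteq> {}"
      unfolding iterated_join_def common_refinement by blast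
    then obtain x where "x \<in> A" by blast
    then have "A = ?B -` {?B x}" using inter[OF f(1), of x] f(2) by simp
    then show "A \<in> (\<lambda>v. ?B -` {v}) ` range ?B" by blast
  next
    fix A assume "A \<in> (\<lambda>v. ?B -` {v}) ` range ?B"
    then obtain x where A: "A = ?B -` {?B x}" by blast
    define f where "f P = (SOME C. C \<in> P \<and> x \<in> C)" for P
    have f: "f P \<in> P \<and> x \<in> f P" if P: "P \<in> ?P" for P
    proof -
      obtain i where i: "P = (\<lambda>B. (shift ^^ i) -` B) ` \<xi>" using P by blast
      have "(shift ^^ i) -` cell \<xi> ((shift ^^ i) x) \<in> P \<and> x \<in> (shift ^^ i) -` cell \<xi> ((shift ^^ i) x)"
        using cell[OF \<xi>, of "(shift ^^ i) x"] unfolding i by simp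
      then show ?thesis unfolding f_def by (rule someI[of "\<lambda>C. C \<in> P \<and> x \<in> C"])
    qed
    have f1: "f \<in> (\<Pi> P\<in>?P. P)" by (rule Pi_I) (simp only: f)
    have f2: "x \<in> \<Inter> (f ` ?P)" by (rule INT_I) (simp only: f)
    have "A = \<Inter> (f ` ?P)" using inter[OF f1 f2] A by simp
    moreover from this have "A \<noteq> {}" using f2 by blast
    ultimately show "A \<in> iterated_join \<xi> n"
      unfolding iterated_join_def common_refinement using f1 by blast
  qed
qed

locale invariant_measure =
  fixes M :: "'d::finite shift_space measure"
  assumes inv: "invariant_prob M"
begin

lemma sets_M: "sets M = sets borel"
  using inv by (simp add: invariant_prob_def)

sublocale full_prob_space M
proof -
  interpret prob_space M using inv by (simp add: invariant_prob_def)
  show "full_prob_space M"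
    using sets_eq_imp_space_eq[OF sets_M] by unfold_locales simp
qed

lemma shift_M: "shift \<in> M \<rightarrow>\<^sub>M M"
  using shift_measurable by (simp add: measurable_cong_sets[OF sets_M sets_M])

lemma vimage_shift_sets: "B \<in> sets M \<Longrightarrow> shift -` B \<in> sets M"
  using measurable_sets[OF shift_M, of B] by (simp add: space)

lemma measure_shift: "B \<in> sets M \<Longrightarrow> prob (shift -` B) = prob B"
  using inv by (simp add: invariant_prob_def)

lemma integral_shift:
  assumes "f \<in> borel_measurable M"
  shows "(\<integral>x. f (shift x) \<partial>M) = (\<integral>x. f x \<partial>M :: real)"
proof -
  have "distr M M shift = M"
  proof (rule measure_eqI)
    fix A assume "A \<in> sets (distr M M shift)"
    then show "emeasure (distr M M shift) A = emeasure M A"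
      using measure_shift[of A] by (simp add: emeasure_distr[OF shift_M] space emeasure_eq_measure)
  qed simp
  then show ?thesis
    using integral_distr[OF shift_M assms] by simp
qed

lemma finite_rv_shift: "finite_rv M X \<Longrightarrow> finite_rv M (\<lambda>x. X (shift x))"
proof -
  assume X: "finite_rv M X"
  have "(\<lambda>x. X (shift x)) -` {v} = shift -` (X -` {v})" for v by auto
  moreover have "range (\<lambda>x. X (shift x)) \<subseteq> range X" by auto
  ultimately show ?thesis using X vimage_shift_sets finite_subset by (auto simp: finite_rv_def)
qed

lemma ent_shift: "finite_rv M X \<Longrightarrow> ent M (\<lambda>x. X (shift x)) = ent M X"
proof -
  assume X: "finite_rv M X"
  have "range (\<lambda>x. X (shift x)) = range X"
    using surj_shift by (metis image_image)
  moreover have "(\<lambda>x. X (shift x)) -` {v} = shift -` (X -` {v})" for v by auto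
  ultimately show ?thesis using X by (simp add: ent_def finite_rv_def measure_shift)
qed

lemma finite_rv_shift_funpow: "finite_rv M X \<Longrightarrow> finite_rv M (\<lambda>x. X ((shift ^^ n) x))"
proof (induction n)
  case (Suc n)
  then show ?case using finite_rv_shift[of "\<lambda>x. X ((shift ^^ n) x)"] by (simp add: funpow_swap1)
qed simp

lemma ent_shift_funpow: "finite_rv M X \<Longrightarrow> ent M (\<lambda>x. X ((shift ^^ n) x)) = ent M X"
proof (induction n)
  case (Suc n)
  then show ?case using ent_shift[OF finite_rv_shift_funpow[of X n]] by (simp add: funpow_swap1)
qed simp

lemma finite_rv_block: "finite_rv M X \<Longrightarrow> finite_rv M (block X n)"
proof (induction n)
  case 0
  have "block X 0 = (\<lambda>_. [])" by (simp add: block_def fun_eq_iff)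
  then show ?case using finite_rv_const by simp
next
  case (Suc n)
  have "block X (Suc n) = (\<lambda>x. (\<lambda>(u, v). u @ [v]) (block X n x, X ((shift ^^ n) x)))"
    by (simp add: block_Suc fun_eq_iff)
  moreover have "finite_rv M (\<lambda>x. (\<lambda>(u, v). u @ [v]) (block X n x, X ((shift ^^ n) x)))"
    by (rule finite_rv_compose[OF finite_rv_Pair[OF Suc.IH[OF Suc.prems] finite_rv_shift_funpow[OF Suc.prems]]])
  ultimately show ?case by simp
qed

text \<open>Strong subadditivity for the first letter, the last letter and the block between them; by invariance
the two blocks of length \<open>n + 1\<close> have the same entropy.\<close>

lemma block_entropy_concave:
  assumes X: "finite_rv M X"
  shows "ent M (block X (Suc (Suc n))) + ent M (block X n) \<le> 2 * ent M (block X (Suc n))"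
proof -
  let ?B = "\<lambda>x. block X n (shift x)" and ?Y = "\<lambda>x. X ((shift ^^ n) (shift x))"
  have "ent M (\<lambda>x. (X x, ?Y x, ?B x)) + ent M ?B \<le> ent M (\<lambda>x. (X x, ?B x)) + ent M (\<lambda>x. (?Y x, ?B x))"
    using finite_rv_shift[OF finite_rv_block[OF X, of n]] finite_rv_shift[OF finite_rv_shift_funpow[OF X, of n]]
    by (intro strong_subadditivity X)
  moreover have "ent M (\<lambda>x. (X x, ?Y x, ?B x)) = ent M (block X (Suc (Suc n)))"
    by (rule ent_cong) (simp add: block_Suc_shift[of X "Suc n"] block_Suc[of X n], blast)
  moreover have "ent M ?B = ent M (block X n)"
    by (rule ent_shift[OF finite_rv_block[OF X]])
  moreover have "ent M (\<lambda>x. (X x, ?B x)) = ent M (block X (Suc n))"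
    by (rule ent_cong) (simp add: block_Suc_shift)
  moreover have "ent M (\<lambda>x. (?Y x, ?B x)) = ent M (\<lambda>x. block X (Suc n) (shift x))"
    by (rule ent_cong) (simp add: block_Suc, blast)
  moreover have "ent M (\<lambda>x. block X (Suc n) (shift x)) = ent M (block X (Suc n))"
    by (rule ent_shift[OF finite_rv_block[OF X]])
  ultimately show ?thesis by simp
qed

lemma block_entropy_mono: "finite_rv M X \<Longrightarrow> ent M (block X n) \<le> ent M (block X (Suc n))"
  by (rule ent_mono[OF finite_rv_block]) (auto simp: block_Suc)

lemma block_entropy_rate:
  assumes X: "finite_rv M X"
  obtains h where "(\<lambda>n. ent M (block X (Suc n)) - ent M (block X n)) \<longlonglongrightarrow> h"
    "(\<lambda>n. ent M (block X n) / real n) \<longlonglongrightarrow> h" "\<And>n. h \<le> ent M (block X (Suc n)) - ent M (block X n)"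
  using concave_sequence_average[of "\<lambda>n. ent M (block X n)"] block_entropy_concave[OF X] block_entropy_mono[OF X]
  by blast

text \<open>The chain rule: each of the \<open>n\<close> letters of the \<open>X\<close>-block, given the whole \<open>Z\<close>-block, has at most the
conditional entropy that it has given the \<open>Z\<close>-letter at the same time.\<close>

lemma block_entropy_le:
  assumes X: "finite_rv M X" and Z: "finite_rv M Z"
  shows "ent M (block X n) \<le> ent M (block Z n) + real n * (ent M (\<lambda>x. (X x, Z x)) - ent M Z)"
proof -
  let ?D = "ent M (\<lambda>x. (X x, Z x)) - ent M Z"
  have "ent M (\<lambda>x. (block X n x, block Z n x)) - ent M (block Z n) \<le> real n * ?D"
  proof (induction n)
    case 0
    have "ent M (\<lambda>x. (block X 0 x, block Z 0 x)) = ent M (block Z 0)"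
      by (rule ent_cong) (simp add: block_def)
    then show ?case by simp
  next
    case (Suc n)
    let ?U = "block X n" and ?V = "block Z n"
    let ?x = "\<lambda>x. X ((shift ^^ n) x)" and ?z = "\<lambda>x. Z ((shift ^^ n) x)"
    note r = finite_rv_block[OF X, of n] finite_rv_block[OF Z, of n] finite_rv_shift_funpow[OF X, of n] finite_rv_shift_funpow[OF Z, of n]
    have 1: "ent M (\<lambda>x. (?x x, ?U x, (?V x, ?z x))) + ent M (\<lambda>x. (?V x, ?z x))
        \<le> ent M (\<lambda>x. (?x x, (?V x, ?z x))) + ent M (\<lambda>x. (?U x, (?V x, ?z x)))"
      by (intro strong_subadditivity finite_rv_Pair r)
    have 2: "ent M (\<lambda>x. (?x x, ?V x, ?z x)) + ent M ?z \<le> ent M (\<lambda>x. (?x x, ?z x)) + ent M (\<lambda>x. (?V x, ?z x))"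
      by (intro strong_subadditivity finite_rv_Pair r)
    have 3: "ent M (\<lambda>x. (?U x, ?z x, ?V x)) + ent M ?V \<le> ent M (\<lambda>x. (?U x, ?V x)) + ent M (\<lambda>x. (?z x, ?V x))"
      by (intro strong_subadditivity finite_rv_Pair r)
    have e1: "ent M (\<lambda>x. (?x x, ?U x, (?V x, ?z x))) = ent M (\<lambda>x. (block X (Suc n) x, block Z (Suc n) x))"
      by (rule ent_cong) (auto simp: block_Suc)
    have e2: "ent M (\<lambda>x. (?V x, ?z x)) = ent M (block Z (Suc n))"
      by (rule ent_cong) (auto simp: block_Suc)
    have e3: "ent M (\<lambda>x. (?U x, ?z x, ?V x)) = ent M (\<lambda>x. (?U x, (?V x, ?z x)))"
      by (rule ent_cong) auto
    have e4: "ent M (\<lambda>x. (?z x, ?V x)) = ent M (\<lambda>x. (?V x, ?z x))"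
      by (rule ent_cong) auto
    have e5: "ent M ?z = ent M Z" "ent M (\<lambda>x. (?x x, ?z x)) = ent M (\<lambda>x. (X x, Z x))"
      using ent_shift_funpow[OF Z, of n] ent_shift_funpow[OF finite_rv_Pair[OF X Z], of n] by simp_all
    show ?case
      using 1 2 3 Suc unfolding e1 e2 e3 e4 e5 by (simp add: algebra_simps)
  qed
  moreover have "ent M (block X n) \<le> ent M (\<lambda>x. (block X n x, block Z n x))"
    by (rule ent_mono[OF finite_rv_Pair[OF finite_rv_block[OF X] finite_rv_block[OF Z]]]) simp
  ultimately show ?thesis by simp
qed

lemma finite_rv_coord: "finite_rv M (\<lambda>x. coord x 0)"
proof -
  have "depends_on_first 1 ((\<lambda>x. coord x 0) -` {a})" for a :: 'd
    by (auto simp: depends_on_first_def agree_def)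
  then have "(\<lambda>x. coord x 0) -` {a} \<in> sets M" for a :: 'd
    unfolding sets_M by (intro clopens_subset_borel) (auto simp: clopens_def)
  then show ?thesis by (simp add: finite_rv_def)
qed

lemma finite_rv_word: "finite_rv M (word n)"
  unfolding word_eq_block by (rule finite_rv_block[OF finite_rv_coord])

text \<open>The sets that can be approximated by clopen ones form a sigma-algebra.\<close>

lemma approx_clopen:
  assumes "B \<in> sets M" "0 < e"
  shows "\<exists>C\<in>clopens. prob ((B - C) \<union> (C - B)) < e"
proof -
  have B: "B \<in> sigma_sets UNIV clopens" using assms(1) by (simp add: sets_M sets_borel_eq_clopens)
  have cl: "C \<in> sets M" if "C \<in> clopens" for C using clopens_subset_borel[OF that] by (simp add: sets_M)
  have sub: "clopens \<subseteq> Pow (UNIV :: 'd shift_space set)" by simp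
  have "\<forall>e>0. \<exists>C\<in>clopens. prob ((B - C) \<union> (C - B)) < e"
    using Int_stable_clopens sub B
  proof (induction rule: sigma_sets_induct_disjoint)
    case (basic A)
    then show ?case by (auto intro!: bexI[of _ A])
  next
    case empty
    show ?case using algebra_clopens by (auto simp: algebra_iff_Un intro!: bexI[of _ "{}"])
  next
    case (compl A)
    show ?case
    proof (intro allI impI)
      fix e :: real assume "0 < e"
      then obtain C where C: "C \<in> clopens" "prob ((A - C) \<union> (C - A)) < e" using compl by blast
      have "((UNIV - A) - (UNIV - C)) \<union> ((UNIV - C) - (UNIV - A)) = (A - C) \<union> (C - A)" by blast
      moreover have "UNIV - C \<in> clopens" using C(1) algebra_clopens by (auto simp: algebra_iff_Un)
      ultimately show "\<exists>C\<in>clopens. prob (((UNIV - A) - C) \<union> (C - (UNIV - A))) < e" using C(2) by metis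
    qed
  next
    case (union A)
    have A: "A i \<in> sets M" for i using union(2) by (auto simp: sets_M sets_borel_eq_clopens)
    show ?case
    proof (intro allI impI)
      fix e :: real assume e: "0 < e"
      have "(\<lambda>n. prob (\<Union>i<n. A i)) \<longlonglongrightarrow> prob (\<Union>n. \<Union>i<n. A i)"
        using A by (intro finite_Lim_measure_incseq incseq_SucI UN_mono) auto
      also have "(\<Union>n. \<Union>i<n. A i) = (\<Union>i. A i)" by blast
      finally have "eventually (\<lambda>n. prob (\<Union>i. A i) - e / 2 < prob (\<Union>i<n. A i)) sequentially"
        using e by (intro order_tendstoD) auto
      then obtain n where n: "prob (\<Union>i. A i) - e / 2 < prob (\<Union>i<n. A i)" by (auto simp: eventually_sequentially)
      have "\<exists>C\<in>clopens. prob ((A i - C) \<union> (C - A i)) < e / (2 * real (Suc n))" for i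
        using union(3) e by simp
      then obtain C where C: "\<And>i. C i \<in> clopens" "\<And>i. prob ((A i - C i) \<union> (C i - A i)) < e / (2 * real (Suc n))"
        by metis
      let ?D = "\<Union>i<n. C i" and ?A = "\<Union>i. A i"
      have D: "?D \<in> clopens"
      proof -
        interpret algebra UNIV "clopens :: 'd shift_space set set" by (rule algebra_clopens)
        show ?thesis using C(1) by (intro finite_UN) auto
      qed
      have "prob ((?A - ?D) \<union> (?D - ?A)) \<le> prob ((?A - (\<Union>i<n. A i)) \<union> (\<Union>i<n. (A i - C i) \<union> (C i - A i)))"
        using A cl[OF C(1)] by (intro finite_measure_mono) auto
      also have "\<dots> \<le> prob (?A - (\<Union>i<n. A i)) + prob (\<Union>i<n. (A i - C i) \<union> (C i - A i))"
        using A cl[OF C(1)] by (intro measure_Un_le) auto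
      also have "prob (?A - (\<Union>i<n. A i)) = prob ?A - prob (\<Union>i<n. A i)"
        using A by (intro finite_measure_Diff) auto
      also have "prob (\<Union>i<n. (A i - C i) \<union> (C i - A i)) \<le> (\<Sum>i<n. prob ((A i - C i) \<union> (C i - A i)))"
        using A cl[OF C(1)] by (intro finite_measure_subadditive_finite) auto
      also have "\<dots> \<le> (\<Sum>i<n. e / (2 * real (Suc n)))"
        using C(2) by (intro sum_mono less_imp_le) blast
      also have "\<dots> = real n * (e / (2 * real (Suc n)))" by simp
      also have "\<dots> \<le> e / 2" using e by (simp add: field_simps)
      finally have "prob ((?A - ?D) \<union> (?D - ?A)) < e" using n by simp
      then show "\<exists>C\<in>clopens. prob ((?A - C) \<union> (C - ?A)) < e" using D by blast
    qed
  qed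
  then show ?thesis using assms(2) by blast
qed

text \<open>Approximate each level set of \<open>X\<close> by a clopen set, and guess from the first \<open>m\<close> letters a value whose clopen
set contains the point. The guess can fail only on the symmetric differences.\<close>

lemma approx_word:
  assumes X: "finite_rv M X" and e: "0 < e"
  shows "\<exists>m F. range F \<subseteq> range X \<and> prob {x. X x \<noteq> F (word m x)} < e"
proof -
  let ?R = "range X"
  have fin: "finite ?R" and meas: "X -` {v} \<in> sets M" for v using X by (auto simp: finite_rv_def)
  define k where "k = real (card ?R)"
  have k: "0 < k" using fin by (simp add: k_def card_gt_0_iff)
  have "\<exists>C\<in>clopens. prob ((X -` {v} - C) \<union> (C - X -` {v})) < e / k" for v
    using approx_clopen[OF meas, of "e / k" v] e k by simp
  then obtain C where C: "\<And>v. C v \<in> clopens" "\<And>v. prob ((X -` {v} - C v) \<union> (C v - X -` {v})) < e / k" by metis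
  then obtain n where n: "\<And>v. depends_on_first (n v) (C v)" by (auto simp: clopens_def) metis
  define m where "m = Max (n ` ?R)"
  have m: "depends_on_first m (C v)" if "v \<in> ?R" for v
    using n fin that by (intro depends_on_first_mono[OF n]) (auto simp: m_def)
  define F where "F w = (if \<exists>v\<in>?R. point w \<in> C v then SOME v. v \<in> ?R \<and> point w \<in> C v else X undefined)" for w
  have F: "F w \<in> ?R" "\<exists>v\<in>?R. point w \<in> C v \<Longrightarrow> point w \<in> C (F w)" for w
    using someI_ex[of "\<lambda>v. v \<in> ?R \<and> point w \<in> C v"] by (auto simp: F_def Bex_def)
  have "{x. X x \<noteq> F (word m x)} \<subseteq> (\<Union>v\<in>?R. (X -` {v} - C v) \<union> (C v - X -` {v}))"
  proof
    fix x assume "x \<in> {x. X x \<noteq> F (word m x)}"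
    then have ne: "X x \<noteq> F (word m x)" by simp
    have mem: "point (word m x) \<in> C v \<longleftrightarrow> x \<in> C v" if "v \<in> ?R" for v
      using depends_on_first_iff[OF m[OF that] agree_point] by blast
    show "x \<in> (\<Union>v\<in>?R. (X -` {v} - C v) \<union> (C v - X -` {v}))"
    proof (cases "x \<in> C (X x)")
      case True
      then have "x \<in> C (F (word m x))"
        using mem F(1)[of "word m x"] F(2)[of "word m x"] by blast
      then show ?thesis using ne F(1)[of "word m x"] by blast
    qed auto
  qed
  moreover have D: "(X -` {v} - C v) \<union> (C v - X -` {v}) \<in> sets M" for v
    by (intro sets.Un sets.Diff meas) (simp_all add: sets_M clopens_subset_borel C(1))
  ultimately have "prob {x. X x \<noteq> F (word m x)} \<le> prob (\<Union>v\<in>?R. (X -` {v} - C v) \<union> (C v - X -` {v}))"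
    using fin by (intro finite_measure_mono sets.finite_UN)
  also have "\<dots> \<le> (\<Sum>v\<in>?R. prob ((X -` {v} - C v) \<union> (C v - X -` {v})))"
    using fin D by (intro finite_measure_subadditive_finite) auto
  also have "\<dots> < (\<Sum>v\<in>?R. e / k)"
    using fin C(2) by (intro sum_strict_mono) auto
  also have "\<dots> = e" using k by (simp add: k_def)
  finally show ?thesis using F(1) by blast
qed

lemma words_generate:
  assumes X: "finite_rv M X" and e: "0 < e"
  shows "\<exists>m. ent M (\<lambda>x. (X x, word m x)) - ent M (word m) < e"
proof -
  have "\<exists>m F. range F \<subseteq> range X \<and> prob {x. X x \<noteq> F (word m x)} < 1 / real (Suc j)" for j
    using approx_word[OF X] by simp
  then obtain m F where F: "\<And>j. range (F j) \<subseteq> range X" "\<And>j. prob {x. X x \<noteq> F j (word (m j) x)} < 1 / real (Suc j)"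
    by metis
  let ?Z = "\<lambda>j x. F j (word (m j) x)"
  have Z: "finite_rv M (?Z j)" for j by (rule finite_rv_compose[OF finite_rv_word])
  have "(\<lambda>j. prob {x. X x \<noteq> ?Z j x}) \<longlonglongrightarrow> 0"
    by (rule Lim_null_comparison[OF _ LIMSEQ_Suc[OF lim_1_over_n]]) (use F(2) in \<open>auto intro!: always_eventually less_imp_le\<close>)
  then have "(\<lambda>j. ent M (\<lambda>x. (X x, ?Z j x)) - ent M (?Z j)) \<longlonglongrightarrow> 0"
    using range_subsetD[OF F(1)] by (intro conditional_entropy_vanishes X Z) auto
  then obtain j where j: "ent M (\<lambda>x. (X x, ?Z j x)) - ent M (?Z j) < e"
    using order_tendstoD(2)[OF _ e] by (force simp: eventually_sequentially)
  have "ent M (\<lambda>x. (X x, word (m j) x, ?Z j x)) + ent M (?Z j) \<le> ent M (\<lambda>x. (X x, ?Z j x)) + ent M (\<lambda>x. (word (m j) x, ?Z j x))"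
    by (intro strong_subadditivity X Z finite_rv_word)
  moreover have "ent M (\<lambda>x. (X x, word (m j) x, ?Z j x)) = ent M (\<lambda>x. (X x, word (m j) x))"
    by (rule ent_cong) auto
  moreover have "ent M (\<lambda>x. (word (m j) x, ?Z j x)) = ent M (word (m j))"
    by (rule ent_cong) auto
  ultimately show ?thesis using j by (intro exI[of _ "m j"]) linarith
qed

text \<open>The partition by the first letter attains the supremum over all finite partitions: the itinerary of
any other one is known from a slightly longer word up to a small entropy per unit of time.\<close>

theorem kolmogorov_sinai:
  shows "(\<lambda>n. ent M (word (Suc n)) - ent M (word n)) \<longlonglongrightarrow> KS_entropy M"
    and "KS_entropy M \<le> ent M (word (Suc n)) - ent M (word n)"
proof -
  let ?W = "\<lambda>n. ent M (word n)"
  obtain h where h: "(\<lambda>n. ?W (Suc n) - ?W n) \<longlonglongrightarrow> h" "(\<lambda>n. ?W n / real n) \<longlonglongrightarrow> h" "\<And>n. h \<le> ?W (Suc n) - ?W n"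
    using block_entropy_rate[OF finite_rv_coord] unfolding word_eq_block by blast
  have entropy_wrt: "entropy_wrt M \<xi> = lim (\<lambda>n. ent M (block (cell \<xi>) n) / real n)" if "partition_on UNIV \<xi>" for \<xi>
    unfolding entropy_wrt_def iterated_join_eq[OF that] ent_eq_partition_entropy ..
  have upper: "entropy_wrt M \<xi> \<le> h" if \<xi>: "finite_borel_partition \<xi>" for \<xi>
  proof -
    have part: "partition_on UNIV \<xi>" using \<xi> by (simp add: finite_borel_partition_def)
    have X: "finite_rv M (cell \<xi>)"
    proof -
      have "range (cell \<xi>) \<subseteq> \<xi>" using cell(1)[OF part] by blast
      moreover have "cell \<xi> -` {B} = (if B \<in> \<xi> then B else {})" for B
        using cell[OF part] cellI[OF part] by auto
      ultimately show ?thesis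
        using \<xi> finite_subset unfolding finite_rv_def finite_borel_partition_def sets_M by (auto split: if_splits)
    qed
    let ?E = "\<lambda>n. ent M (block (cell \<xi>) n)"
    obtain l where l: "(\<lambda>n. ?E n / real n) \<longlonglongrightarrow> l" using block_entropy_rate[OF X] by blast
    have "l \<le> h + e" if e: "0 < e" for e
    proof -
      obtain m where m: "ent M (\<lambda>x. (cell \<xi> x, word m x)) - ent M (word m) < e" using words_generate[OF X e] by blast
      have bound: "?E n \<le> ?W n + real m * ?W 1 + real n * e" for n
      proof -
        have "?E n \<le> ent M (block (word m) n) + real n * (ent M (\<lambda>x. (cell \<xi> x, word m x)) - ent M (word m))"
          by (rule block_entropy_le[OF X finite_rv_word])
        also have "\<dots> \<le> ent M (block (word m) n) + real n * e"
          using m by (intro add_left_mono mult_left_mono) auto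
        \<comment> \<open>Words of length \<open>m\<close> at the times below \<open>n\<close> are known from the first \<open>n + m\<close> letters.\<close>
        also have "ent M (block (word m) n) \<le> ?W (n + m)"
        proof (rule ent_mono[OF finite_rv_word])
          fix x y :: "'d shift_space" assume "word (n + m) x = word (n + m) y"
          then show "block (word m) n x = block (word m) n y"
            unfolding block_eq_iff word_eq_iff by (simp add: agree_def)
        qed
        also have "?W (n + m) \<le> ?W n + real m * ?W 1"
        proof (induction m)
          case (Suc m)
          have "?W (Suc (n + m)) \<le> ?W (n + m) + ?W 1"
          proof -
            have d: "decseq (\<lambda>k. ?W (Suc k) - ?W k)"
              using block_entropy_concave[OF finite_rv_coord] unfolding word_eq_block
              by (intro decseq_SucI) (simp add: algebra_simps)
            have "?W (Suc 0) - ?W 0 \<ge> ?W (Suc (n + m)) - ?W (n + m)" using decseqD[OF d, of 0 "n + m"] by simp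
            moreover have "?W 0 = 0" 
              using ent_cong[of "word 0" "\<lambda>_::'d shift_space. ()" M] prob_space by (simp add: word_def ent_def vimage_def space)
            ultimately show ?thesis by simp
          qed
          then show ?case using Suc by (simp add: algebra_simps)
        qed simp
        finally show ?thesis by simp
      qed
      have "(\<lambda>n. ?W n / real n + real m * ?W 1 * (1 / real n) + e) \<longlonglongrightarrow> h + real m * ?W 1 * 0 + e"
        by (intro tendsto_intros h lim_1_over_n)
      moreover have "\<exists>N. \<forall>n\<ge>N. ?E n / real n \<le> ?W n / real n + real m * ?W 1 * (1 / real n) + e"
      proof (intro exI[of _ 1] allI impI)
        fix n :: nat assume "1 \<le> n"
        then have n: "0 < real n" by simp
        have "?E n / real n \<le> (?W n + real m * ?W 1 + real n * e) / real n"
          using bound n by (intro divide_right_mono) auto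
        then show "?E n / real n \<le> ?W n / real n + real m * ?W 1 * (1 / real n) + e"
          using n by (simp add: add_divide_distrib)
      qed
      ultimately show ?thesis using LIMSEQ_le[OF l] by fastforce
    qed
    then have "l \<le> h" by (rule field_le_epsilon)
    then show ?thesis using limI[OF l] entropy_wrt[OF part] by simp
  qed
  let ?\<alpha> = "(\<lambda>a. {x :: 'd shift_space. coord x 0 = a}) ` UNIV"
  have part: "partition_on UNIV ?\<alpha>"
  proof (rule partition_onI)
    show "\<Union> ?\<alpha> = UNIV" by auto
    show "{} \<notin> ?\<alpha>" by (auto simp: set_eq_iff) (metis coord_prepend_0)
  qed (auto simp: disjnt_def)
  have \<alpha>: "finite_borel_partition ?\<alpha>"
  proof -
    have "{x. coord x 0 = a} \<in> sets M" for a :: 'd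
      using finite_rv_coord by (simp add: finite_rv_def vimage_def)
    then show ?thesis using part by (auto simp: finite_borel_partition_def sets_M)
  qed
  have "entropy_wrt M ?\<alpha> = h"
  proof -
    have c: "cell ?\<alpha> x = {y. coord y 0 = coord x 0}" for x by (rule cellI[OF part]) auto
    have "ent M (block (cell ?\<alpha>) n) = ?W n" for n
      unfolding word_eq_block
    proof (rule ent_cong)
      have "cell ?\<alpha> x = cell ?\<alpha> y \<longleftrightarrow> coord x 0 = coord y 0" for x y by (auto simp: c)
      then show "block (cell ?\<alpha>) n x = block (cell ?\<alpha>) n y \<longleftrightarrow> block (\<lambda>x. coord x 0) n x = block (\<lambda>x. coord x 0) n y" for x y
        by (simp only: block_eq_iff)
    qed
    then show ?thesis using limI[OF h(2)] entropy_wrt[OF part] by simp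
  qed
  then have "KS_entropy M = h"
    unfolding KS_entropy_def using \<alpha> upper by (intro cSup_eq_maximum) (auto simp: image_iff)
  then show "(\<lambda>n. ?W (Suc n) - ?W n) \<longlonglongrightarrow> KS_entropy M" "KS_entropy M \<le> ?W (Suc n) - ?W n"
    using h by auto
qed

end

section \<open>The variational principle\<close>

lemma word_Suc_shift: "word (Suc n) x = coord x 0 # word n (shift x)"
  unfolding word_eq_block by (rule block_Suc_shift)

context invariant_measure begin

lemma integral_finite_rv:
  assumes Y: "finite_rv M Y" and S: "finite S" "range Y \<subseteq> S"
  shows "(\<integral>x. g (Y x) \<partial>M) = (\<Sum>v\<in>S. g v * prob (Y -` {v}) :: real)"
proof -
  have "g (Y x) = (\<Sum>v\<in>S. g v * indicator (Y -` {v}) x)" for x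
  proof -
    have "(\<Sum>v\<in>S. g v * indicator (Y -` {v}) x) = (\<Sum>v\<in>S. if v = Y x then g v else 0)"
      by (rule sum.cong) (auto simp: indicator_def)
    then show ?thesis using S by auto
  qed
  then have "(\<integral>x. g (Y x) \<partial>M) = (\<integral>x. (\<Sum>v\<in>S. g v * indicator (Y -` {v}) x) \<partial>M)" by simp
  also have "\<dots> = (\<Sum>v\<in>S. g v * (\<integral>x. indicator (Y -` {v}) x \<partial>M))"
    using Y by (simp add: finite_rv_def emeasure_eq_measure del: sum_mult_indicator integral_indicator)
  finally show ?thesis by (simp add: space)
qed

text \<open>The measure of the cylinder of the word \<open>a # w\<close>.\<close>

definition "cyl a w = prob {x. coord x 0 = a \<and> word (length w) (shift x) = w}"
definition "base w = prob {x. word (length w) x = w}"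

lemma cyl_nonneg: "0 \<le> cyl a w" and base_nonneg: "0 \<le> base w"
  by (simp_all add: cyl_def base_def)

lemma finite_rv_head_tail: "finite_rv M (\<lambda>x. (coord x 0, word n (shift x)))"
  by (intro finite_rv_Pair finite_rv_coord finite_rv_shift finite_rv_word)

lemma head_tail_vimage:
  "w \<in> words n \<Longrightarrow> prob ((\<lambda>x. (coord x 0, word n (shift x))) -` {(a, w)}) = cyl a w"
  unfolding cyl_def by (rule arg_cong[where f = prob]) (auto simp: words_def)

lemma word_vimage: "w \<in> words n \<Longrightarrow> prob (word n -` {w}) = base w"
  unfolding base_def by (rule arg_cong[where f = prob]) (auto simp: words_def)

lemma sum_cyl: "(\<Sum>a\<in>UNIV. cyl a w) = base w"
proof -
  let ?B = "{x. word (length w) x = w}"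
  have B: "?B \<in> sets M"
    using finite_rv_word[of "length w"] by (simp add: finite_rv_def vimage_def)
  have "range (\<lambda>x :: 'd shift_space. coord x 0) = UNIV"
    by (rule surjI[of _ "\<lambda>a. prepend a undefined"]) simp
  then have "(\<Sum>a\<in>UNIV. prob ((\<lambda>x. coord x 0) -` {a} \<inter> shift -` ?B)) = prob (shift -` ?B)"
    using marginal[OF finite_rv_coord vimage_shift_sets[OF B]] by simp
  moreover have "(\<lambda>x. coord x 0) -` {a} \<inter> shift -` ?B = {x. coord x 0 = a \<and> word (length w) (shift x) = w}" for a
    by auto
  ultimately show ?thesis using measure_shift[OF B] by (simp add: cyl_def base_def)
qed

lemma sum_base: "(\<Sum>w\<in>words n. base w) = 1"
proof -
  have "(\<integral>x. 1 \<partial>M) = (\<Sum>w\<in>words n. 1 * prob (word n -` {w}))"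
    by (rule integral_finite_rv[OF finite_rv_word]) auto
  then show ?thesis by (simp add: word_vimage prob_space)
qed

lemma cyl_le_base: "cyl a w \<le> base w"
  using member_le_sum[of a UNIV "\<lambda>a. cyl a w"] cyl_nonneg by (simp add: sum_cyl)

text \<open>The conditional entropy of the first letter given the next \<open>n\<close>; by invariance the tail has the law of
the word itself.\<close>

lemma word_entropy_step:
  "ent M (word (Suc n)) - ent M (word n) = - (\<Sum>w\<in>words n. \<Sum>a\<in>UNIV. cyl a w * (ln (cyl a w) - ln (base w)))"
proof -
  have "ent M (word (Suc n)) = ent M (\<lambda>x. (coord x 0, word n (shift x)))"
    by (rule ent_cong) (simp add: word_Suc_shift)
  also have "\<dots> = - (\<Sum>c\<in>UNIV \<times> words n. prob ((\<lambda>x. (coord x 0, word n (shift x))) -` {c}) * ln (prob ((\<lambda>x. (coord x 0, word n (shift x))) -` {c})))"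
    by (rule ent_superset) auto
  also have "\<dots> = - (\<Sum>c\<in>UNIV \<times> words n. cyl (fst c) (snd c) * ln (cyl (fst c) (snd c)))"
    by (intro arg_cong[where f = uminus] sum.cong) (auto simp: head_tail_vimage)
  also have "\<dots> = - (\<Sum>a\<in>UNIV. \<Sum>w\<in>words n. cyl a w * ln (cyl a w))"
    by (simp add: sum.cartesian_product case_prod_beta')
  also have "(\<Sum>a\<in>UNIV. \<Sum>w\<in>words n. cyl a w * ln (cyl a w)) = (\<Sum>w\<in>words n. \<Sum>a\<in>UNIV. cyl a w * ln (cyl a w))"
    by (rule sum.swap)
  finally have 1: "ent M (word (Suc n)) = - (\<Sum>w\<in>words n. \<Sum>a\<in>UNIV. cyl a w * ln (cyl a w))" .
  have "ent M (word n) = - (\<Sum>w\<in>words n. prob (word n -` {w}) * ln (prob (word n -` {w})))"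
    by (rule ent_superset) auto
  also have "\<dots> = - (\<Sum>w\<in>words n. base w * ln (base w))"
    by (simp add: word_vimage)
  also have "\<dots> = - (\<Sum>w\<in>words n. \<Sum>a\<in>UNIV. cyl a w * ln (base w))"
    by (simp add: sum_distrib_right[symmetric] sum_cyl)
  finally show ?thesis using 1 by (simp add: right_diff_distrib sum_subtractf)
qed

text \<open>Integrals are sums over cylinders up to the variation of the function on them.\<close>

lemma integral_close_cyl:
  assumes f: "lip \<theta> s f" and theta: "0 < \<theta>" "\<theta> < 1"
  shows "\<bar>(\<integral>x. f x \<partial>M) - (\<Sum>w\<in>words n. \<Sum>a\<in>UNIV. cyl a w * f (prepend a (point w)))\<bar> \<le> s * \<theta> ^ Suc n"
    and "\<bar>(\<integral>x. f x \<partial>M) - (\<Sum>w\<in>words n. base w * f (point w))\<bar> \<le> s * \<theta> ^ n"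
proof -
  have int: "integrable M f" by (rule integrable_lip[OF f theta prob_space_axioms sets_M])
  have gen: "\<bar>(\<integral>x. f x \<partial>M) - (\<Sum>v\<in>S. g v * prob (Y -` {v}))\<bar> \<le> s * \<theta> ^ k"
    if Y: "finite_rv M Y" and S: "finite S" "range Y \<subseteq> S" and c: "\<And>x. \<bar>f x - g (Y x)\<bar> \<le> s * \<theta> ^ k"
    for k S and g :: "'e \<Rightarrow> real" and Y
  proof -
    have "(\<lambda>x. g (Y x)) \<in> borel_measurable M"
    proof (rule measurableI)
      fix B :: "real set" assume "B \<in> sets borel"
      have "(\<lambda>x. g (Y x)) -` B \<inter> space M = (\<lambda>x. g (Y x) \<in> B) -` {True}" by (auto simp: space)
      then show "(\<lambda>x. g (Y x)) -` B \<inter> space M \<in> sets M"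
        using finite_rv_compose[OF Y, of "\<lambda>v. g v \<in> B"] by (simp add: finite_rv_def)
    qed simp
    moreover have "\<bar>g (Y x)\<bar> \<le> \<bar>f undefined\<bar> + s + s * \<theta> ^ k" for x
      using c[of x] lip_bounded[OF f, of x undefined] by linarith
    ultimately have intg: "integrable M (\<lambda>x. g (Y x))"
      by (intro integrable_const_bound[where B = "\<bar>f undefined\<bar> + s + s * \<theta> ^ k"]) auto
    have "\<bar>(\<integral>x. f x \<partial>M) - (\<integral>x. g (Y x) \<partial>M)\<bar> = \<bar>\<integral>x. f x - g (Y x) \<partial>M\<bar>"
      using int intg by simp
    also have "\<dots> \<le> (\<integral>x. \<bar>f x - g (Y x)\<bar> \<partial>M)" by (rule integral_abs_bound)
    also have "\<dots> \<le> (\<integral>x. s * \<theta> ^ k \<partial>M)"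
      using int intg c by (intro integral_mono) auto
    finally show ?thesis by (simp add: integral_finite_rv[OF Y S] prob_space)
  qed
  have "\<bar>(\<integral>x. f x \<partial>M) - (\<Sum>c\<in>UNIV \<times> words n. (\<lambda>(a, w). f (prepend a (point w))) c *
      prob ((\<lambda>x. (coord x 0, word n (shift x))) -` {c}))\<bar> \<le> s * \<theta> ^ Suc n"
  proof (rule gen[OF finite_rv_head_tail])
    fix x :: "'d shift_space"
    have "agree (Suc n) (prepend (coord x 0) (shift x)) (prepend (coord x 0) (point (word n (shift x))))"
      by (simp only: agree_prepend_iff agree_point simp_thms)
    then show "\<bar>f x - (case (coord x 0, word n (shift x)) of (a, w) \<Rightarrow> f (prepend a (point w)))\<bar> \<le> s * \<theta> ^ Suc n"
      using lipD[OF f, of "Suc n" x "prepend (coord x 0) (point (word n (shift x)))"] by simp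
  qed auto
  also have "(\<Sum>c\<in>UNIV \<times> words n. (\<lambda>(a, w). f (prepend a (point w))) c *
      prob ((\<lambda>x. (coord x 0, word n (shift x))) -` {c})) = (\<Sum>c\<in>UNIV \<times> words n. cyl (fst c) (snd c) * f (prepend (fst c) (point (snd c))))"
    by (rule sum.cong) (auto simp: head_tail_vimage)
  also have "\<dots> = (\<Sum>a\<in>UNIV. \<Sum>w\<in>words n. cyl a w * f (prepend a (point w)))"
    by (simp add: sum.cartesian_product case_prod_beta')
  also have "\<dots> = (\<Sum>w\<in>words n. \<Sum>a\<in>UNIV. cyl a w * f (prepend a (point w)))"
    by (rule sum.swap)
  finally show "\<bar>(\<integral>x. f x \<partial>M) - (\<Sum>w\<in>words n. \<Sum>a\<in>UNIV. cyl a w * f (prepend a (point w)))\<bar> \<le> s * \<theta> ^ Suc n" .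
  have "\<bar>(\<integral>x. f x \<partial>M) - (\<Sum>w\<in>words n. f (point w) * prob (word n -` {w}))\<bar> \<le> s * \<theta> ^ n"
    by (rule gen[OF finite_rv_word]) (auto intro: lipD[OF f agree_point])
  then show "\<bar>(\<integral>x. f x \<partial>M) - (\<Sum>w\<in>words n. base w * f (point w))\<bar> \<le> s * \<theta> ^ n"
    by (simp add: word_vimage mult.commute)
qed

end

locale invariant_normalized = invariant_measure M + normalized_potential \<theta> K L
  for M :: "'d::finite shift_space measure" and \<theta> K and L :: "'d shift_space \<Rightarrow> real"
begin

text \<open>The measure that the cylinder of \<open>a # w\<close> would have if the first letter were chosen with the
probabilities of the normalized potential at the representative of \<open>w\<close>.\<close>

definition "pred a w = exp (L (prepend a (point w))) * base w"

lemma pred_nonneg: "0 \<le> pred a w"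
  by (simp add: pred_def base_nonneg)

lemma sum_pred: "(\<Sum>w\<in>words n. \<Sum>a\<in>UNIV. pred a w) = 1"
  by (simp add: pred_def sum_distrib_right[symmetric] sum_L sum_base)

text \<open>Up to the variation of \<open>L\<close> on cylinders the left-hand side is minus the relative entropy of the true
cylinder measures with respect to the predicted ones.\<close>

lemma entropy_step_le:
  "ent M (word (Suc n)) - ent M (word n) + (\<integral>x. L x \<partial>M)
    \<le> K * \<theta> ^ Suc n - (\<Sum>w\<in>words n. \<Sum>a\<in>UNIV. (sqrt (cyl a w) - sqrt (pred a w))\<^sup>2)"
proof -
  have key: "cyl a w * L (prepend a (point w)) - cyl a w * (ln (cyl a w) - ln (base w))
      \<le> pred a w - cyl a w - (sqrt (cyl a w) - sqrt (pred a w))\<^sup>2" for a w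
  proof (cases "cyl a w = 0")
    case True
    then show ?thesis by (simp add: pred_nonneg)
  next
    case False
    then have pos: "0 < cyl a w" "0 < base w"
      using cyl_nonneg[of a w] cyl_le_base[of a w] by linarith+
    then have ln: "ln (pred a w) = L (prepend a (point w)) + ln (base w)" "0 < pred a w"
      by (simp_all add: pred_def ln_mult)
    have "cyl a w - pred a w + (sqrt (cyl a w) - sqrt (pred a w))\<^sup>2 \<le> cyl a w * (ln (cyl a w) - ln (pred a w))"
      using pos ln(2) by (intro kl_term) auto
    also have "\<dots> = cyl a w * (ln (cyl a w) - ln (base w)) - cyl a w * L (prepend a (point w))"
      unfolding ln(1) by (simp add: algebra_simps)
    finally show ?thesis by simp
  qed
  have "(\<Sum>w\<in>words n. \<Sum>a\<in>UNIV. cyl a w * L (prepend a (point w)) - cyl a w * (ln (cyl a w) - ln (base w)))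
    \<le> (\<Sum>w\<in>words n. \<Sum>a\<in>UNIV. pred a w - cyl a w - (sqrt (cyl a w) - sqrt (pred a w))\<^sup>2)"
    by (intro sum_mono key)
  then have "(\<Sum>w\<in>words n. \<Sum>a\<in>UNIV. cyl a w * L (prepend a (point w))) + (ent M (word (Suc n)) - ent M (word n))
    \<le> - (\<Sum>w\<in>words n. \<Sum>a\<in>UNIV. (sqrt (cyl a w) - sqrt (pred a w))\<^sup>2)"
    unfolding word_entropy_step by (simp add: sum_subtractf sum_pred sum_cyl sum_base)
  then show ?thesis
    using integral_close_cyl(1)[OF L theta, of n] by linarith
qed

theorem KS_entropy_le: "KS_entropy M + (\<integral>x. L x \<partial>M) \<le> 0"
proof -
  have "(\<lambda>n. K * \<theta> ^ Suc n) \<longlonglongrightarrow> K * 0"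
    using theta by (intro tendsto_mult tendsto_const LIMSEQ_Suc LIMSEQ_power_zero) auto
  moreover have "KS_entropy M + (\<integral>x. L x \<partial>M) \<le> K * \<theta> ^ Suc n" for n
  proof -
    have "0 \<le> (\<Sum>w\<in>words n. \<Sum>a\<in>UNIV. (sqrt (cyl a w) - sqrt (pred a w))\<^sup>2)"
      by (intro sum_nonneg) simp
    then show ?thesis
      using entropy_step_le[of n] kolmogorov_sinai(2)[of n] by linarith
  qed
  ultimately show ?thesis
    using LIMSEQ_le_const by fastforce
qed

text \<open>In the case of equality the Hellinger distance of true and predicted cylinder measures tends to zero
with the length of the words, and by the Cauchy-Schwarz inequality so does the distance in \<open>l\<^sup>1\<close>. But the
integral of \<open>\<phi>\<close> is a sum over the true measures, and that of its image under the transfer operator is the same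
sum over the predicted ones.\<close>

theorem equality_imp_stationary:
  assumes eq: "KS_entropy M + (\<integral>x. L x \<partial>M) = 0"
  shows "stationary \<theta> L M"
  unfolding stationary_def
proof (intro conjI allI impI)
  show "prob_space M" by (rule prob_space_axioms)
  show "sets M = sets borel" by (rule sets_M)
  fix s \<phi> assume \<phi>: "lip \<theta> s (\<phi> :: 'd shift_space \<Rightarrow> real)"
  obtain t where t: "lip \<theta> t (transfer L \<phi>)" using lip_transfer[OF \<phi>] .
  define B where "B = \<bar>\<phi> undefined\<bar> + s"
  have B: "\<bar>\<phi> x\<bar> \<le> B" for x using lip_bounded[OF \<phi>, of x undefined] by (simp add: B_def)
  have bound: "\<bar>(\<integral>x. transfer L \<phi> x \<partial>M) - (\<integral>x. \<phi> x \<partial>M)\<bar>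
      \<le> t * \<theta> ^ n + s * \<theta> ^ Suc n + B * (2 * sqrt (K * \<theta> ^ Suc n))" for n
  proof -
    let ?P = "words n \<times> (UNIV :: 'd set)"
    let ?c = "\<lambda>c. cyl (snd c) (fst c)" and ?r = "\<lambda>c. pred (snd c) (fst c)"
    have cart: "(\<Sum>w\<in>words n. \<Sum>a\<in>UNIV. F a w) = (\<Sum>c\<in>?P. F (snd c) (fst c))" for F :: "'d \<Rightarrow> 'd list \<Rightarrow> real"
      by (simp add: sum.cartesian_product case_prod_beta')
    have S: "(\<Sum>c\<in>?P. (sqrt (?c c) - sqrt (?r c))\<^sup>2) \<le> K * \<theta> ^ Suc n"
      using entropy_step_le[of n] kolmogorov_sinai(2)[of n] eq unfolding cart by linarith
    have T: "(\<Sum>c\<in>?P. (sqrt (?c c) + sqrt (?r c))\<^sup>2) \<le> 4"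
    proof -
      have "(\<Sum>c\<in>?P. (sqrt (?c c) + sqrt (?r c))\<^sup>2) \<le> (\<Sum>c\<in>?P. 2 * ?c c + 2 * ?r c)"
      proof (rule sum_mono)
        fix c
        have "0 \<le> (sqrt (?c c) - sqrt (?r c))\<^sup>2" by simp
        then show "(sqrt (?c c) + sqrt (?r c))\<^sup>2 \<le> 2 * ?c c + 2 * ?r c"
          by (simp add: power2_diff power2_sum cyl_nonneg pred_nonneg)
      qed
      also have "\<dots> = 2 * (\<Sum>w\<in>words n. \<Sum>a\<in>UNIV. cyl a w) + 2 * (\<Sum>w\<in>words n. \<Sum>a\<in>UNIV. pred a w)"
        unfolding cart by (simp add: sum.distrib sum_distrib_left)
      finally show ?thesis by (simp add: sum_pred sum_cyl sum_base)
    qed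
    have l1: "(\<Sum>c\<in>?P. \<bar>?c c - ?r c\<bar>) \<le> 2 * sqrt (K * \<theta> ^ Suc n)"
    proof -
      have "\<bar>?c c - ?r c\<bar> = \<bar>sqrt (?c c) - sqrt (?r c)\<bar> * (sqrt (?c c) + sqrt (?r c))" for c
      proof -
        have "?c c - ?r c = (sqrt (?c c) - sqrt (?r c)) * (sqrt (?c c) + sqrt (?r c))"
          by (simp add: algebra_simps cyl_nonneg pred_nonneg)
        then have "\<bar>?c c - ?r c\<bar> = \<bar>sqrt (?c c) - sqrt (?r c)\<bar> * \<bar>sqrt (?c c) + sqrt (?r c)\<bar>"
          by (simp only: abs_mult)
        then show ?thesis by (simp add: cyl_nonneg pred_nonneg)
      qed
      then have "(\<Sum>c\<in>?P. \<bar>?c c - ?r c\<bar>)\<^sup>2 = (\<Sum>c\<in>?P. \<bar>sqrt (?c c) - sqrt (?r c)\<bar> * (sqrt (?c c) + sqrt (?r c)))\<^sup>2"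
        by simp
      also have "\<dots> \<le> (\<Sum>c\<in>?P. \<bar>sqrt (?c c) - sqrt (?r c)\<bar>\<^sup>2) * (\<Sum>c\<in>?P. (sqrt (?c c) + sqrt (?r c))\<^sup>2)"
        by (rule Cauchy_Schwarz_ineq_sum)
      also have "\<dots> \<le> (K * \<theta> ^ Suc n) * 4"
        using S T K_nonneg theta by (intro mult_mono) (auto intro!: sum_nonneg)
      finally have "(\<Sum>c\<in>?P. \<bar>?c c - ?r c\<bar>) \<le> sqrt ((K * \<theta> ^ Suc n) * 4)"
        by (rule real_le_rsqrt)
      then show ?thesis by (simp add: real_sqrt_mult)
    qed
    have "(\<Sum>w\<in>words n. base w * transfer L \<phi> (point w)) = (\<Sum>w\<in>words n. \<Sum>a\<in>UNIV. pred a w * \<phi> (prepend a (point w)))"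
      by (simp add: transfer_def pred_def sum_distrib_left mult_ac)
    then have 1: "\<bar>(\<integral>x. transfer L \<phi> x \<partial>M) - (\<Sum>c\<in>?P. ?r c * \<phi> (prepend (snd c) (point (fst c))))\<bar> \<le> t * \<theta> ^ n"
      using integral_close_cyl(2)[OF t theta, of n] unfolding cart by simp
    have 2: "\<bar>(\<integral>x. \<phi> x \<partial>M) - (\<Sum>c\<in>?P. ?c c * \<phi> (prepend (snd c) (point (fst c))))\<bar> \<le> s * \<theta> ^ Suc n"
      using integral_close_cyl(1)[OF \<phi> theta, of n] unfolding cart by simp
    have "\<bar>(\<Sum>c\<in>?P. ?c c * \<phi> (prepend (snd c) (point (fst c)))) - (\<Sum>c\<in>?P. ?r c * \<phi> (prepend (snd c) (point (fst c))))\<bar>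
      \<le> (\<Sum>c\<in>?P. \<bar>(?c c - ?r c) * \<phi> (prepend (snd c) (point (fst c)))\<bar>)"
      unfolding sum_subtractf[symmetric] left_diff_distrib[symmetric] by (rule sum_abs)
    also have "\<dots> \<le> (\<Sum>c\<in>?P. \<bar>?c c - ?r c\<bar> * B)"
      unfolding abs_mult using B by (intro sum_mono mult_left_mono) auto
    also have "\<dots> = B * (\<Sum>c\<in>?P. \<bar>?c c - ?r c\<bar>)" by (simp add: sum_distrib_left mult.commute)
    also have "\<dots> \<le> B * (2 * sqrt (K * \<theta> ^ Suc n))"
      using l1 B[of undefined] by (intro mult_left_mono) auto
    finally show ?thesis using 1 2 by linarith
  qed
  have "(\<lambda>n. t * \<theta> ^ n + s * \<theta> ^ Suc n + B * (2 * sqrt (K * \<theta> ^ Suc n))) \<longlonglongrightarrow> t * 0 + s * 0 + B * (2 * sqrt (K * 0))"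
    using theta by (intro tendsto_intros LIMSEQ_Suc LIMSEQ_power_zero) auto
  then have "\<bar>(\<integral>x. transfer L \<phi> x \<partial>M) - (\<integral>x. \<phi> x \<partial>M)\<bar> \<le> t * 0 + s * 0 + B * (2 * sqrt (K * 0))"
    by (rule LIMSEQ_le_const) (use bound in blast)
  then show "(\<integral>x. transfer L \<phi> x \<partial>M) = (\<integral>x. \<phi> x \<partial>M)" by simp
qed

text \<open>For a stationary measure the conditional probability of the first letter is an average of \<open>exp L\<close> over the
cylinder of the remaining word, so that the prediction is exact up to the variation of \<open>L\<close>.\<close>

theorem stationary_imp_equality:
  assumes stat: "stationary \<theta> L M"
  shows "KS_entropy M + (\<integral>x. L x \<partial>M) = 0"
proof (rule antisym[OF KS_entropy_le])
  have step: "- 2 * (K * \<theta> ^ Suc n) \<le> ent M (word (Suc n)) - ent M (word n) + (\<integral>x. L x \<partial>M)" for n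
  proof -
    have cyl_le: "cyl a w \<le> exp (K * \<theta> ^ Suc n + L (prepend a (point w))) * base w" if w: "w \<in> words n" for a w
    proof -
      let ?C = "{x. coord x 0 = a \<and> word n (shift x) = w}" and ?D = "{x. word n x = w}"
      have len: "length w = n" using w by (simp add: words_def)
      have "?C = {x. word (Suc n) x = a # w}" by (auto simp: word_Suc_shift)
      then have dC: "depends_on_first (Suc n) ?C" using depends_on_first_word[of "Suc n" "\<lambda>v. v = a # w"] by simp
      have dD: "depends_on_first n ?D" by (rule depends_on_first_word)
      have C: "?C \<in> clopens" "?D \<in> clopens" using dC dD by (auto simp: clopens_def)
      have "cyl a w = (\<integral>x. indicator ?C x \<partial>M)"
        using integral_indicator_clopen[OF sets_M C(1)] by (simp add: cyl_def len)
      also have "\<dots> = (\<integral>x. transfer L (indicator ?C) x \<partial>M)"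
        using stat lip_indicator[OF dC theta] by (simp add: stationary_def)
      also have "\<dots> \<le> (\<integral>x. exp (K * \<theta> ^ Suc n + L (prepend a (point w))) * indicator ?D x \<partial>M)"
      proof (rule integral_mono)
        obtain t where t: "lip \<theta> t (transfer L (indicator ?C))" using lip_transfer[OF lip_indicator[OF dC theta]] .
        show "integrable M (transfer L (indicator ?C))"
          by (rule integrable_lip[OF t theta prob_space_axioms sets_M])
        show "integrable M (\<lambda>x. exp (K * \<theta> ^ Suc n + L (prepend a (point w))) * indicator ?D x)"
          by (intro integrable_mult_right integrable_lip[OF lip_indicator[OF dD theta] theta prob_space_axioms sets_M])
        fix x
        have "transfer L (indicator ?C) x = (\<Sum>b\<in>UNIV. if b = a then exp (L (prepend a x)) * indicator ?D x else 0)"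
          unfolding transfer_def by (rule sum.cong) (auto simp: indicator_def)
        then have tr: "transfer L (indicator ?C) x = exp (L (prepend a x)) * indicator ?D x" by simp
        have "exp (L (prepend a x)) \<le> exp (K * \<theta> ^ Suc n + L (prepend a (point w)))" if x: "x \<in> ?D"
        proof -
          have "agree n x (point w)" using x agree_point[of n x] by simp
          then show ?thesis using lipD[OF L, of "Suc n" "prepend a x" "prepend a (point w)"] by simp
        qed
        then show "transfer L (indicator ?C) x \<le> exp (K * \<theta> ^ Suc n + L (prepend a (point w))) * indicator ?D x"
          unfolding tr by (auto simp: indicator_def)
      qed
      also have "\<dots> = exp (K * \<theta> ^ Suc n + L (prepend a (point w))) * base w"
        using integral_indicator_clopen[OF sets_M C(2)] by (simp add: base_def len)
      finally show ?thesis .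
    qed
    have "(\<Sum>w\<in>words n. \<Sum>a\<in>UNIV. cyl a w * (ln (cyl a w) - ln (base w)))
       \<le> (\<Sum>w\<in>words n. \<Sum>a\<in>UNIV. cyl a w * (K * \<theta> ^ Suc n + L (prepend a (point w))))"
    proof (intro sum_mono)
      fix w a assume w: "w \<in> (words n :: 'd list set)"
      show "cyl a w * (ln (cyl a w) - ln (base w)) \<le> cyl a w * (K * \<theta> ^ Suc n + L (prepend a (point w)))"
      proof (cases "cyl a w = 0")
        case False
        then have pos: "0 < cyl a w" "0 < base w"
          using cyl_nonneg[of a w] cyl_le_base[of a w] by linarith+
        have "ln (cyl a w) \<le> ln (exp (K * \<theta> ^ Suc n + L (prepend a (point w))) * base w)"
          by (rule ln_mono[OF cyl_le[OF w] pos(1)])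
        also have "\<dots> = K * \<theta> ^ Suc n + L (prepend a (point w)) + ln (base w)"
          using pos by (subst ln_mult) auto
        finally show ?thesis using pos by (intro mult_left_mono) auto
      qed simp
    qed
    also have "\<dots> = (\<Sum>w\<in>words n. \<Sum>a\<in>UNIV. cyl a w) * (K * \<theta> ^ Suc n) + (\<Sum>w\<in>words n. \<Sum>a\<in>UNIV. cyl a w * L (prepend a (point w)))"
      by (simp add: distrib_left sum.distrib sum_distrib_right)
    also have "(\<Sum>w\<in>words n. \<Sum>a\<in>UNIV. cyl a w) = 1" by (simp add: sum_cyl sum_base)
    finally show ?thesis
      using integral_close_cyl(1)[OF L theta, of n] unfolding word_entropy_step by linarith
  qed
  have "(\<lambda>n. - 2 * (K * \<theta> ^ Suc n)) \<longlonglongrightarrow> - 2 * (K * 0)"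
    using theta by (intro tendsto_mult tendsto_const LIMSEQ_Suc LIMSEQ_power_zero) auto
  moreover have "(\<lambda>n. ent M (word (Suc n)) - ent M (word n) + (\<integral>x. L x \<partial>M)) \<longlonglongrightarrow> KS_entropy M + (\<integral>x. L x \<partial>M)"
    by (intro tendsto_intros kolmogorov_sinai)
  ultimately have "- 2 * (K * 0) \<le> KS_entropy M + (\<integral>x. L x \<partial>M)"
    using step by (intro LIMSEQ_le) blast+
  then show "0 \<le> KS_entropy M + (\<integral>x. L x \<partial>M)" by simp
qed

end

text \<open>A coboundary has integral zero against every invariant probability. So the integral of \<open>A\<close> plus the entropy
exceeds that of the normalized potential plus the entropy by \<open>ln \<rho>\<close>, and the latter sum is at most zero,
with equality for the stationary measure alone.\<close>

theorem equilibrium_state: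
  fixes A :: "'d::finite shift_space \<Rightarrow> real"
  assumes theta: "0 < \<theta>" "\<theta> < 1" and A: "lip \<theta> C A"
  obtains \<rho> h \<mu> where "0 < \<rho>" "\<And>x. 0 < h x" "h undefined = 1" "lip \<theta> (\<theta> * C / (1 - \<theta>)) (\<lambda>x. ln (h x))"
    "\<And>x. transfer A h x = \<rho> * h x"
    "stationary \<theta> (\<lambda>x. A x + ln (h x) - ln (h (shift x)) - ln \<rho>) \<mu>" "invariant_prob \<mu>"
    "pressure A = ln \<rho>" "equilibrium_prob A = \<mu>" "(\<integral>x. A x \<partial>\<mu>) + KS_entropy \<mu> = ln \<rho>"
    "\<And>M. invariant_prob M \<Longrightarrow> (\<integral>x. A x \<partial>M) + KS_entropy M \<le> ln \<rho>"
    "\<And>M. invariant_prob M \<Longrightarrow> (\<integral>x. A x \<partial>M) + KS_entropy M = ln \<rho> \<Longrightarrow> M = \<mu>"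
proof -
  interpret ruelle \<theta> C A by unfold_locales (rule theta A)+
  obtain \<rho> h where h: "0 < \<rho>" "\<And>x. 0 < h x" "h undefined = 1" "lip \<theta> K (\<lambda>x. ln (h x))"
    "\<And>x. transfer A h x = \<rho> * h x"
    using eigenfunction_exists by metis
  define L where "L x = A x + ln (h x) - ln (h (shift x)) - ln \<rho>" for x
  have norm: "normalized \<theta> (C + K + K / \<theta>) L"
    unfolding L_def by (rule normalized_cohomologous[OF theta A h(1,2,4,5)])
  interpret N: normalized_potential \<theta> "C + K + K / \<theta>" L by unfold_locales (rule norm)
  obtain \<mu> where \<mu>: "stationary \<theta> L \<mu>" "invariant_prob \<mu>" by (rule N.stationary_exists)
  have int: "(\<integral>x. A x \<partial>M) = (\<integral>x. L x \<partial>M) + ln \<rho>" if "invariant_prob M" for M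
  proof -
    interpret invariant_measure M by unfold_locales (rule that)
    note int = integrable_lip[OF _ theta prob_space_axioms sets_M]
    have 1: "(\<integral>x. ln (h (shift x)) \<partial>M) = (\<integral>x. ln (h x) \<partial>M)"
      by (rule integral_shift[of "\<lambda>x. ln (h x)"]) (rule borel_measurable_integrable[OF int[OF h(4)]])
    have "(\<integral>x. L x \<partial>M) = (\<integral>x. A x \<partial>M) + (\<integral>x. ln (h x) \<partial>M) - (\<integral>x. ln (h (shift x)) \<partial>M) - ln \<rho>"
      unfolding L_def using int[OF A] int[OF h(4)] int[OF lip_shift[OF h(4) theta]] by (simp add: prob_space)
    then show ?thesis using 1 by simp
  qed
  have le: "(\<integral>x. A x \<partial>M) + KS_entropy M \<le> ln \<rho>" if "invariant_prob M" for M
  proof -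
    interpret invariant_normalized M \<theta> "C + K + K / \<theta>" L by unfold_locales (rule that)
    show ?thesis using KS_entropy_le int[OF that] by simp
  qed
  have eq: "(\<integral>x. A x \<partial>\<mu>) + KS_entropy \<mu> = ln \<rho>"
  proof -
    interpret invariant_normalized \<mu> \<theta> "C + K + K / \<theta>" L by unfold_locales (rule \<mu>)
    show ?thesis using stationary_imp_equality[OF \<mu>(1)] int[OF \<mu>(2)] by simp
  qed
  have uniq: "M = \<mu>" if M: "invariant_prob M" "(\<integral>x. A x \<partial>M) + KS_entropy M = ln \<rho>" for M
  proof -
    interpret invariant_normalized M \<theta> "C + K + K / \<theta>" L by unfold_locales (rule M)
    have "stationary \<theta> L M" using equality_imp_stationary M(2) int[OF M(1)] by simp
    then show ?thesis by (rule N.stationary_unique[OF _ \<mu>(1)])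
  qed
  have pressure: "pressure A = ln \<rho>"
    unfolding pressure_def
  proof (rule cSup_eq_maximum)
    show "ln \<rho> \<in> (\<lambda>M. (\<integral>x. A x \<partial>M) + KS_entropy M) ` {M. invariant_prob M}"
      by (rule image_eqI[of _ _ \<mu>]) (simp_all add: eq \<mu>(2))
    show "y \<le> ln \<rho>" if "y \<in> (\<lambda>M. (\<integral>x. A x \<partial>M) + KS_entropy M) ` {M. invariant_prob M}" for y
      using that le by blast
  qed
  have "equilibrium_prob A = \<mu>"
    unfolding equilibrium_prob_def pressure
  proof (rule the_equality)
    show "invariant_prob \<mu> \<and> (\<integral>x. A x \<partial>\<mu>) + KS_entropy \<mu> = ln \<rho>" using eq \<mu>(2) by blast
    show "M = \<mu>" if "invariant_prob M \<and> (\<integral>x. A x \<partial>M) + KS_entropy M = ln \<rho>" for M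
      using that uniq by blast
  qed
  then show thesis
    by (rule that[OF h(1,2,3) h(4)[unfolded K_def] h(5) \<mu>(1)[unfolded L_def[abs_def]] \<mu>(2) pressure _ eq le uniq])
qed

section \<open>Derivative and strict convexity of the pressure\<close>

lemma abs_exp_minus_affine_le:
  fixes v :: real
  assumes v: "\<bar>v\<bar> \<le> 1"
  shows "\<bar>exp v - 1 - v\<bar> \<le> v\<^sup>2"
proof -
  have "1 + v \<le> exp v" by (rule exp_ge_add_one_self)
  moreover have "exp v \<le> 1 + v + v\<^sup>2"
  proof (cases "0 \<le> v")
    case True
    then show ?thesis using v by (intro exp_bound) auto
  next
    case False
    have "exp v * (1 - v) \<le> exp v * exp (- v)"
      using exp_ge_add_one_self[of "- v"] by (intro mult_left_mono) auto
    also have "\<dots> = 1" by (rule exp_minus_inverse)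
    also have "1 \<le> (1 + v + v\<^sup>2) * (1 - v)"
    proof -
      have "(1 + v + v\<^sup>2) * (1 - v) = 1 - v ^ 3"
        by (simp add: algebra_simps power2_eq_square power3_eq_cube)
      moreover have "v ^ 3 \<le> 0" using False by (simp add: power_le_zero_eq)
      ultimately show ?thesis by linarith
    qed
    finally show ?thesis using False by (simp add: mult_le_cancel_right)
  qed
  ultimately show ?thesis by linarith
qed

context normalized_potential begin

lemma transfer_diff_le:
  assumes "\<And>y. \<bar>\<phi> y - \<psi> y\<bar> \<le> B"
  shows "\<bar>transfer L \<phi> x - transfer L \<psi> x\<bar> \<le> B"
proof -
  have "\<bar>transfer L \<phi> x - transfer L \<psi> x\<bar> = \<bar>\<Sum>a\<in>UNIV. exp (L (prepend a x)) * (\<phi> (prepend a x) - \<psi> (prepend a x))\<bar>"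
    by (simp add: transfer_def right_diff_distrib sum_subtractf)
  also have "\<dots> \<le> (\<Sum>a\<in>UNIV. \<bar>exp (L (prepend a x)) * (\<phi> (prepend a x) - \<psi> (prepend a x))\<bar>)"
    by (rule sum_abs)
  also have "\<dots> \<le> (\<Sum>a\<in>UNIV. exp (L (prepend a x)) * B)"
    using assms by (intro sum_mono) (simp add: abs_mult)
  finally show ?thesis by (simp add: sum_distrib_right[symmetric] sum_L)
qed

text \<open>Stability of the constants as the only fixed points: if one step changes \<open>\<phi>\<close> by at most \<open>c\<close>, then \<open>n\<close> steps
change it by at most \<open>n * c\<close>, and after \<open>n\<close> steps it is almost constant.\<close>

lemma almost_fixed_imp_almost_constant:
  obtains C \<tau> where "0 \<le> C" "0 < \<tau>" "\<tau> < 1"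
    "\<And>s \<phi> c n x y. lip \<theta> s \<phi> \<Longrightarrow> (\<And>x. \<bar>transfer L \<phi> x - \<phi> x\<bar> \<le> c) \<Longrightarrow>
      \<bar>\<phi> x - \<phi> y\<bar> \<le> 2 * real n * c + C * s * \<tau> ^ n"
proof -
  obtain C \<tau> where C: "0 \<le> C" "0 < \<tau>" "\<tau> < 1"
    "\<And>s \<phi> n x y. lip \<theta> s \<phi> \<Longrightarrow> \<bar>(transfer L ^^ n) \<phi> x - (transfer L ^^ n) \<phi> y\<bar> \<le> C * s * \<tau> ^ n"
    using iterates_oscillation_decays by blast
  have "\<bar>\<phi> x - \<phi> y\<bar> \<le> 2 * real n * c + C * s * \<tau> ^ n"
    if \<phi>: "lip \<theta> s \<phi>" and c: "\<And>x. \<bar>transfer L \<phi> x - \<phi> x\<bar> \<le> c" for s \<phi> c n x y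
  proof -
    have "\<bar>(transfer L ^^ n) \<phi> x - \<phi> x\<bar> \<le> real n * c" for x
    proof (induction n arbitrary: x)
      case (Suc n)
      have "\<bar>transfer L ((transfer L ^^ n) \<phi>) x - transfer L \<phi> x\<bar> \<le> real n * c"
        by (rule transfer_diff_le) (rule Suc.IH)
      then show ?case using c[of x] by (simp add: algebra_simps)
    qed simp
    from this[of x] this[of y] C(4)[OF \<phi>, of n x y] show ?thesis by linarith
  qed
  then show thesis by (rule that[OF C(1-3)])
qed

end

locale potential_line =
  fixes \<theta> C :: real and f :: "'d::finite shift_space \<Rightarrow> real"
  assumes theta: "0 < \<theta>" "\<theta> < 1" and f: "lip \<theta> C f"
begin

definition "p b = pressure (\<lambda>x. b * f x)"
definition "\<mu> b = equilibrium_prob (\<lambda>x. b * f x)"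
definition "m b = (\<integral>x. f x \<partial>\<mu> b)"

lemma gibbs_state:
  obtains h where "\<And>x. 0 < h x" "h undefined = 1" "lip \<theta> (\<theta> * (\<bar>b\<bar> * C) / (1 - \<theta>)) (\<lambda>x. ln (h x))"
    "\<And>x. transfer (\<lambda>x. b * f x) h x = exp (p b) * h x"
    "stationary \<theta> (\<lambda>x. b * f x + ln (h x) - ln (h (shift x)) - p b) (\<mu> b)" "invariant_prob (\<mu> b)"
    "b * m b + KS_entropy (\<mu> b) = p b"
    "\<And>M. invariant_prob M \<Longrightarrow> b * (\<integral>x. f x \<partial>M) + KS_entropy M \<le> p b"
    "\<And>M. invariant_prob M \<Longrightarrow> b * (\<integral>x. f x \<partial>M) + KS_entropy M = p b \<Longrightarrow> M = \<mu> b"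
proof -
  obtain \<rho> h \<nu> where e: "0 < \<rho>" "\<And>x. 0 < h x" "h undefined = 1" "lip \<theta> (\<theta> * (\<bar>b\<bar> * C) / (1 - \<theta>)) (\<lambda>x. ln (h x))"
    "\<And>x. transfer (\<lambda>x. b * f x) h x = \<rho> * h x"
    "stationary \<theta> (\<lambda>x. b * f x + ln (h x) - ln (h (shift x)) - ln \<rho>) \<nu>" "invariant_prob \<nu>"
    "pressure (\<lambda>x. b * f x) = ln \<rho>" "equilibrium_prob (\<lambda>x. b * f x) = \<nu>"
    "(\<integral>x. b * f x \<partial>\<nu>) + KS_entropy \<nu> = ln \<rho>"
    "\<And>M. invariant_prob M \<Longrightarrow> (\<integral>x. b * f x \<partial>M) + KS_entropy M \<le> ln \<rho>"
    "\<And>M. invariant_prob M \<Longrightarrow> (\<integral>x. b * f x \<partial>M) + KS_entropy M = ln \<rho> \<Longrightarrow> M = \<nu>"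
    by (rule equilibrium_state[OF theta lip_cmult[OF f, of b]]) (rule that; assumption)
  have p: "ln \<rho> = p b" and \<nu>: "\<nu> = \<mu> b"
    using e(8,9) by (simp_all add: p_def \<mu>_def)
  have \<rho>: "\<rho> = exp (p b)" using e(1) by (simp flip: p)
  note e' = e(2-7,10-12)[unfolded p \<nu> integral_mult_right_zero]
  show thesis
    by (rule that[OF e'(1,2,3) e'(4)[unfolded \<rho>] e'(5,6) _ e'(8,9)]) (use e'(7) in \<open>simp_all add: m_def\<close>)
qed

lemma invariant_\<mu>: "invariant_prob (\<mu> b)"
  by (rule gibbs_state[of b])

lemma entropy_\<mu>: "KS_entropy (\<mu> b) = p b - b * m b"
  by (rule gibbs_state[of b]) linarith

lemma pressure_ge: "invariant_prob M \<Longrightarrow> b * (\<integral>x. f x \<partial>M) + KS_entropy M \<le> p b"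
  by (rule gibbs_state[of b]) blast

lemma pressure_eqD: "invariant_prob M \<Longrightarrow> b * (\<integral>x. f x \<partial>M) + KS_entropy M = p b \<Longrightarrow> M = \<mu> b"
  by (rule gibbs_state[of b]) blast

text \<open>The equilibrium probability at \<open>b\<close> is a competitor at \<open>c\<close>.\<close>

lemma subgradient: "p b + (c - b) * m b \<le> p c"
  using pressure_ge[OF invariant_\<mu>[of b], of c] entropy_\<mu>[of b] by (simp add: m_def algebra_simps)

definition "F = \<bar>f undefined\<bar> + C"

lemma abs_f_le: "\<bar>f x\<bar> \<le> F"
  using lip_bounded[OF f, of x undefined] by (simp add: F_def)

lemma F_nonneg: "0 \<le> F"
  using abs_f_le[of undefined] by linarith

lemma abs_m_le: "\<bar>m b\<bar> \<le> F"
proof -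
  interpret invariant_measure "\<mu> b" by unfold_locales (rule invariant_\<mu>)
  have int: "integrable (\<mu> b) f" by (rule integrable_lip[OF f theta prob_space_axioms sets_M])
  have "\<bar>m b\<bar> \<le> (\<integral>x. \<bar>f x\<bar> \<partial>\<mu> b)" unfolding m_def by (rule integral_abs_bound)
  also have "\<dots> \<le> (\<integral>x. F \<partial>\<mu> b)" using int abs_f_le by (intro integral_mono) auto
  finally show ?thesis by (simp add: prob_space)
qed

lemma pressure_diff_le: "\<bar>p (b + t) - p b\<bar> \<le> \<bar>t\<bar> * F"
proof -
  have "\<bar>t * m c\<bar> \<le> \<bar>t\<bar> * F" for c
    unfolding abs_mult by (intro mult_left_mono abs_m_le) simp
  from this[of b] this[of "b + t"] show ?thesis
    using subgradient[of b "b + t"] subgradient[of "b + t" b] by (simp add: abs_le_iff)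
qed

text \<open>First-order perturbation theory. Relative to the normalized potential at \<open>b\<close>, the eigenfunction \<open>u t\<close> at
\<open>b + t\<close> satisfies \<open>G (exp (t * f) * u t) = r t * u t\<close>, where \<open>G\<close> is the transfer operator of that normalized
potential and \<open>r t = exp (p (b + t) - p b)\<close>. Hence \<open>u t\<close> is almost
fixed by \<open>G\<close> and tends uniformly to 1. The integral of the equation against the stationary measure gives
\<open>(r t - 1) * \<integral>u t = \<integral>(exp (t * f) - 1) * u t\<close>, and division by \<open>t\<close> gives the derivative \<open>\<integral>f\<close>.\<close>

theorem pressure_derivative: "(p has_real_derivative m b) (at b)"
proof -
  \<comment> \<open>A common bound for the logarithmic variation of the eigenfunctions at parameters within distance 1 of \<open>b\<close>.\<close>
  define K where "K = \<theta> * ((\<bar>b\<bar> + 1) * C) / (1 - \<theta>)"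
  have C0: "0 \<le> C" by (rule lip_nonneg[OF f])
  define Q where "Q c h \<longleftrightarrow> (\<forall>x. 0 < h x) \<and> h undefined = 1 \<and> (\<bar>c\<bar> \<le> \<bar>b\<bar> + 1 \<longrightarrow> lip \<theta> K (\<lambda>x. ln (h x))) \<and>
      (\<forall>x. transfer (\<lambda>x. c * f x) h x = exp (p c) * h x) \<and>
      stationary \<theta> (\<lambda>x. c * f x + ln (h x) - ln (h (shift x)) - p c) (\<mu> c)" for c h
  have "\<exists>h. Q c h" for c
  proof -
    obtain h where h: "\<And>x. 0 < h x" "h undefined = 1" "lip \<theta> (\<theta> * (\<bar>c\<bar> * C) / (1 - \<theta>)) (\<lambda>x. ln (h x))"
      "\<And>x. transfer (\<lambda>x. c * f x) h x = exp (p c) * h x"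
      "stationary \<theta> (\<lambda>x. c * f x + ln (h x) - ln (h (shift x)) - p c) (\<mu> c)"
      by (rule gibbs_state[of c]) (rule that; assumption)
    have "\<theta> * (\<bar>c\<bar> * C) / (1 - \<theta>) \<le> K" if "\<bar>c\<bar> \<le> \<bar>b\<bar> + 1"
      unfolding K_def using theta C0 that by (intro divide_right_mono mult_left_mono mult_right_mono) auto
    then have "\<bar>c\<bar> \<le> \<bar>b\<bar> + 1 \<longrightarrow> lip \<theta> K (\<lambda>x. ln (h x))"
      using lip_mono[OF h(3)] theta(1) by simp
    then show ?thesis using h(1,2,4,5) unfolding Q_def by blast
  qed
  then obtain h where "\<And>c. Q c (h c)" by metis
  then have h: "\<And>c x. 0 < h c x" "\<And>c. h c undefined = 1" "\<And>c. \<bar>c\<bar> \<le> \<bar>b\<bar> + 1 \<Longrightarrow> lip \<theta> K (\<lambda>x. ln (h c x))"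
    "\<And>c x. transfer (\<lambda>x. c * f x) (h c) x = exp (p c) * h c x"
    "\<And>c. stationary \<theta> (\<lambda>x. c * f x + ln (h c x) - ln (h c (shift x)) - p c) (\<mu> c)"
    by (simp_all add: Q_def)
  define L where "L x = b * f x + ln (h b x) - ln (h b (shift x)) - p b" for x
  have norm: "normalized \<theta> (\<bar>b\<bar> * C + K + K / \<theta>) L"
    using normalized_cohomologous[OF theta lip_cmult[OF f, of b] exp_gt_zero[of "p b"] h(1) h(3)[of b] h(4)]
    by (simp add: L_def[abs_def])
  interpret N: normalized_potential \<theta> "\<bar>b\<bar> * C + K + K / \<theta>" L by unfold_locales (rule norm)
  have stat: "stationary \<theta> L (\<mu> b)" using h(5)[of b] by (simp add: L_def[abs_def])
  interpret invariant_measure "\<mu> b" by unfold_locales (rule invariant_\<mu>)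
  note int = integrable_lip[OF _ theta prob_space_axioms sets_M]
  define u where "u t x = h (b + t) x / h b x" for t x
  define r where "r t = exp (p (b + t) - p b)" for t
  define U where "U = exp (2 * K)"
  define s where "s = U * (2 * K)"
  have U0: "0 \<le> U" by (simp add: U_def)
  have twist: "transfer L (\<lambda>x. exp (t * f x) * u t x) x = r t * u t x" for t x
  proof -
    have "exp (L (prepend a x)) * (exp (t * f (prepend a x)) * u t (prepend a x))
       = exp ((b + t) * f (prepend a x)) * h (b + t) (prepend a x) / (h b x * exp (p b))" for a
      using h(1)[of b "prepend a x"] h(1)[of b x]
      by (simp add: L_def u_def exp_diff exp_add distrib_right)
    then have "transfer L (\<lambda>x. exp (t * f x) * u t x) x = transfer (\<lambda>x. (b + t) * f x) (h (b + t)) x / (h b x * exp (p b))"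
      by (simp add: transfer_def sum_divide_distrib)
    then show ?thesis by (simp add: h(4) u_def r_def exp_diff)
  qed
  have u_lip: "lip \<theta> s (u t)" and u_bounds: "0 < u t x" "u t x \<le> U" if t: "\<bar>t\<bar> \<le> 1" for t x
  proof -
    have lnu: "ln (u t x) = ln (h (b + t) x) - ln (h b x)" for x
      using h(1) by (simp add: u_def ln_div less_imp_neq[THEN not_sym])
    have "lip \<theta> (K + K) (\<lambda>x. ln (h (b + t) x) - ln (h b x))"
      using t by (intro lip_diff h) auto
    then have l: "lip \<theta> (2 * K) (\<lambda>x. ln (u t x))" by (simp add: lnu)
    have "ln (u t undefined) = 0" by (simp add: u_def h(2))
    then have le: "ln (u t x) \<le> 2 * K" for x using lip_osc[OF l, of x undefined] by linarith
    show pos: "0 < u t x" for x using h(1) by (simp add: u_def)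
    show "lip \<theta> s (u t)" using lip_exp[OF l le] pos by (simp add: s_def U_def)
    show "u t x \<le> U" using le[of x] pos[of x] unfolding U_def by (metis exp_le_cancel_iff exp_ln)
  qed
  have near_one: "\<bar>exp v - 1\<bar> \<le> exp 1 * \<bar>v\<bar>" if "\<bar>v\<bar> \<le> 1" for v :: real
    using abs_exp_diff_le[of v 1 0] that by simp
  define c where "c = 2 * (exp 1 * F * U)"
  have c0: "0 \<le> c" using F_nonneg U0 by (simp add: c_def)
  have small: "\<bar>exp v - 1\<bar> \<le> exp 1 * F * \<bar>t\<bar>" if "\<bar>v\<bar> \<le> \<bar>t\<bar> * F" "\<bar>t\<bar> * F \<le> 1" for v t
  proof -
    have "\<bar>exp v - 1\<bar> \<le> exp 1 * \<bar>v\<bar>" using that by (intro near_one) linarith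
    also have "\<dots> \<le> exp 1 * (\<bar>t\<bar> * F)" using that by (intro mult_left_mono) auto
    finally show ?thesis by (simp only: mult_ac)
  qed
  have tf: "\<bar>t * f x\<bar> \<le> \<bar>t\<bar> * F" for t x
    unfolding abs_mult by (intro mult_left_mono abs_f_le) simp
  have almost: "\<bar>transfer L (u t) x - u t x\<bar> \<le> c * \<bar>t\<bar>" if t: "\<bar>t\<bar> \<le> 1" "\<bar>t\<bar> * F \<le> 1" for t x
  proof -
    have "\<bar>transfer L (u t) x - transfer L (\<lambda>x. exp (t * f x) * u t x) x\<bar> \<le> exp 1 * F * \<bar>t\<bar> * U"
    proof (rule N.transfer_diff_le)
      fix y
      have "\<bar>u t y - exp (t * f y) * u t y\<bar> = \<bar>exp (t * f y) - 1\<bar> * u t y"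
      proof -
        have "u t y - exp (t * f y) * u t y = - ((exp (t * f y) - 1) * u t y)" by (simp add: algebra_simps)
        then show ?thesis using u_bounds(1)[OF t(1), of y] by (simp add: abs_mult)
      qed
      also have "\<dots> \<le> exp 1 * F * \<bar>t\<bar> * U"
        using small[OF tf t(2)] u_bounds[OF t(1), of y] F_nonneg by (intro mult_mono) auto
      finally show "\<bar>u t y - exp (t * f y) * u t y\<bar> \<le> exp 1 * F * \<bar>t\<bar> * U" .
    qed
    moreover have "\<bar>r t * u t x - u t x\<bar> \<le> exp 1 * F * \<bar>t\<bar> * U"
    proof -
      have "\<bar>r t * u t x - u t x\<bar> = \<bar>r t - 1\<bar> * u t x"
        using u_bounds(1)[OF t(1), of x] by (simp add: abs_mult flip: left_diff_distrib[of "r t" 1 "u t x", simplified])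
      also have "\<dots> \<le> exp 1 * F * \<bar>t\<bar> * U"
        using small[OF pressure_diff_le t(2)] u_bounds[OF t(1), of x] F_nonneg
        unfolding r_def by (intro mult_mono) auto
      finally show ?thesis .
    qed
    ultimately show ?thesis unfolding twist c_def by (simp add: algebra_simps)
  qed
  have ev: "eventually (\<lambda>t. \<bar>t\<bar> \<le> 1 \<and> \<bar>t\<bar> * F \<le> 1) (at 0)"
  proof -
    have 1: "((\<lambda>t::real. \<bar>t\<bar>) \<longlongrightarrow> \<bar>0\<bar>) (at 0)" by (intro tendsto_intros)
    have 2: "((\<lambda>t::real. \<bar>t\<bar> * F) \<longlongrightarrow> \<bar>0\<bar> * F) (at 0)" by (intro tendsto_intros)
    have "eventually (\<lambda>t::real. \<bar>t\<bar> < 1) (at 0)" by (rule order_tendstoD(2)[OF 1]) simp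
    moreover have "eventually (\<lambda>t::real. \<bar>t\<bar> * F < 1) (at 0)" by (rule order_tendstoD(2)[OF 2]) simp
    ultimately show ?thesis by eventually_elim auto
  qed
  have u_unif: "eventually (\<lambda>t. \<forall>x. \<bar>u t x - 1\<bar> < \<epsilon>) (at 0)" if \<epsilon>: "0 < \<epsilon>" for \<epsilon>
  proof -
    obtain D \<tau> where D: "0 \<le> D" "0 < \<tau>" "\<tau> < 1"
      "\<And>s \<phi> c n x y. lip \<theta> s \<phi> \<Longrightarrow> (\<And>x. \<bar>transfer L \<phi> x - \<phi> x\<bar> \<le> c) \<Longrightarrow>
        \<bar>\<phi> x - \<phi> y\<bar> \<le> 2 * real n * c + D * s * \<tau> ^ n"
      using N.almost_fixed_imp_almost_constant by blast
    have "(\<lambda>n. D * s * \<tau> ^ n) \<longlonglongrightarrow> D * s * 0"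
      using D by (intro tendsto_mult tendsto_const LIMSEQ_power_zero) auto
    then have "eventually (\<lambda>n. D * s * \<tau> ^ n < \<epsilon> / 2) sequentially"
      using \<epsilon> by (intro order_tendstoD) auto
    then obtain n where n: "D * s * \<tau> ^ n < \<epsilon> / 2" by (auto simp: eventually_sequentially)
    have "((\<lambda>t. 2 * real n * (c * \<bar>t\<bar>)) \<longlongrightarrow> 2 * real n * (c * \<bar>0\<bar>)) (at 0)"
      by (intro tendsto_intros)
    then have "eventually (\<lambda>t. 2 * real n * (c * \<bar>t\<bar>) < \<epsilon> / 2) (at 0)"
      using \<epsilon> by (intro order_tendstoD) auto
    with ev show ?thesis
    proof eventually_elim
      case (elim t)
      have "u t undefined = 1" by (simp add: u_def h(2))
      then have "\<bar>u t x - 1\<bar> \<le> 2 * real n * (c * \<bar>t\<bar>) + D * s * \<tau> ^ n" for x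
        using D(4)[OF u_lip[of t], of "c * \<bar>t\<bar>" x undefined n] almost[of t] elim by simp
      moreover have "2 * real n * (c * \<bar>t\<bar>) + D * s * \<tau> ^ n < \<epsilon>"
        using n elim by linarith
      ultimately show ?case by (meson order_le_less_trans)
    qed
  qed
  have lim_integral: "((\<lambda>t. \<integral>x. g x * u t x \<partial>\<mu> b) \<longlongrightarrow> (\<integral>x. g x \<partial>\<mu> b)) (at 0)"
    if g: "lip \<theta> s' g" for g s'
  proof (rule tendstoI)
    fix e :: real assume e: "0 < e"
    define B where "B = \<bar>g undefined\<bar> + s'"
    have B: "\<bar>g x\<bar> \<le> B" for x using lip_bounded[OF g, of x undefined] by (simp add: B_def)
    then have B0: "0 \<le> B" using abs_ge_zero order_trans by blast
    have "eventually (\<lambda>t. \<forall>x. \<bar>u t x - 1\<bar> < e / (B + 1)) (at 0)"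
      using e B0 by (intro u_unif) simp
    with ev show "eventually (\<lambda>t. dist (\<integral>x. g x * u t x \<partial>\<mu> b) (\<integral>x. g x \<partial>\<mu> b) < e) (at 0)"
    proof eventually_elim
      case (elim t)
      have "lip \<theta> (s' * U + B * s) (\<lambda>x. g x * u t x)"
      proof (rule lip_mult[OF g B u_lip])
        show "\<bar>u t x\<bar> \<le> U" for x using u_bounds[of t x] elim by simp
      qed (use elim in simp)
      note i = int[OF this] int[OF g]
      have "\<bar>(\<integral>x. g x * u t x \<partial>\<mu> b) - (\<integral>x. g x \<partial>\<mu> b)\<bar> = \<bar>\<integral>x. g x * u t x - g x \<partial>\<mu> b\<bar>"
        using i by simp
      also have "\<dots> \<le> (\<integral>x. \<bar>g x * u t x - g x\<bar> \<partial>\<mu> b)" by (rule integral_abs_bound)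
      also have "\<dots> \<le> (\<integral>x. B * (e / (B + 1)) \<partial>\<mu> b)"
      proof (rule integral_mono)
        fix x
        have "\<bar>g x * u t x - g x\<bar> = \<bar>g x\<bar> * \<bar>u t x - 1\<bar>" by (simp add: right_diff_distrib flip: abs_mult)
        also have "\<dots> \<le> B * (e / (B + 1))"
          using B elim e B0 by (intro mult_mono) (auto intro: less_imp_le)
        finally show "\<bar>g x * u t x - g x\<bar> \<le> B * (e / (B + 1))" .
      qed (use i in auto)
      also have "\<dots> < e" using e B0 by (simp add: prob_space field_simps)
      finally show ?case by (simp add: dist_real_def)
    qed
  qed
  have quot: "((\<lambda>t. (r t - 1) / t) \<longlongrightarrow> m b) (at 0)"
  proof -
    \<comment> \<open>The error of replacing the difference quotient of the exponential by \<open>f\<close>.\<close>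
    define R where "R t x = (exp (t * f x) - 1) / t - f x" for t x
    have R: "\<bar>R t x\<bar> \<le> F * (F * \<bar>t\<bar>)" if t: "t \<noteq> 0" "\<bar>t\<bar> * F \<le> 1" for t x
    proof -
      let ?v = "t * f x"
      have v: "\<bar>?v\<bar> \<le> 1" using tf[of t x] t by linarith
      from v have "\<bar>exp ?v - 1 - ?v\<bar> \<le> ?v\<^sup>2" by (rule abs_exp_minus_affine_le)
      moreover have "exp ?v - 1 - ?v = t * R t x" using t by (simp add: R_def field_simps)
      ultimately have "\<bar>t\<bar> * \<bar>R t x\<bar> \<le> \<bar>t\<bar> * (\<bar>t\<bar> * \<bar>f x\<bar>\<^sup>2)"
        by (simp add: abs_mult power2_eq_square mult_ac)
      then have "\<bar>R t x\<bar> \<le> \<bar>t\<bar> * \<bar>f x\<bar>\<^sup>2" using t by simp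
      also have "\<dots> \<le> \<bar>t\<bar> * F\<^sup>2" using abs_f_le by (intro mult_left_mono power_mono) auto
      finally show ?thesis by (simp add: power2_eq_square mult_ac)
    qed
    have eq: "eventually (\<lambda>t. (r t - 1) / t = ((\<integral>x. f x * u t x \<partial>\<mu> b) + (\<integral>x. R t x * u t x \<partial>\<mu> b)) / (\<integral>x. 1 * u t x \<partial>\<mu> b) \<and>
        \<bar>\<integral>x. R t x * u t x \<partial>\<mu> b\<bar> \<le> F * (F * \<bar>t\<bar>) * U) (at 0)"
    proof -
      have "eventually (\<lambda>t::real. t \<noteq> 0) (at 0)" by (simp add: eventually_at_filter)
      moreover have "eventually (\<lambda>t. 1 / 2 < (\<integral>x. 1 * u t x \<partial>\<mu> b)) (at 0)"
        by (rule order_tendstoD(1)[OF lim_integral[of 0 "\<lambda>_. 1"]]) (simp_all add: prob_space)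
      ultimately show ?thesis using ev
      proof eventually_elim
        case (elim t)
        then have t: "t \<noteq> 0" "\<bar>t\<bar> \<le> 1" "\<bar>t\<bar> * F \<le> 1" and I: "0 < (\<integral>x. u t x \<partial>\<mu> b)" by auto
        note ub = u_bounds[OF t(2)]
        have uab: "\<bar>u t x\<bar> \<le> U" for x using ub[of x] by simp
        have "lip \<theta> (exp (\<bar>t\<bar> * F) * (\<bar>t\<bar> * C)) (\<lambda>x. exp (t * f x))"
          using tf by (intro lip_exp lip_cmult f) (auto simp: abs_le_iff)
        moreover have "\<bar>exp (t * f x)\<bar> \<le> exp (\<bar>t\<bar> * F)" for x using tf[of t x] by simp
        ultimately obtain s1 where e1: "lip \<theta> s1 (\<lambda>x. exp (t * f x) * u t x)"
          using lip_mult[OF _ _ u_lip[OF t(2)] uab] by blast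
        note fu = lip_mult[OF f abs_f_le u_lip[OF t(2)] uab]
        have Ru_eq: "R t x * u t x = (1 / t) * (exp (t * f x) * u t x - u t x) - f x * u t x" for x
          using t(1) by (simp add: R_def field_simps)
        have Ru: "integrable (\<mu> b) (\<lambda>x. R t x * u t x)"
          unfolding Ru_eq using int[OF e1] int[OF u_lip[OF t(2)]] int[OF fu] by simp
        have "r t * (\<integral>x. u t x \<partial>\<mu> b) = (\<integral>x. transfer L (\<lambda>x. exp (t * f x) * u t x) x \<partial>\<mu> b)"
          unfolding twist by simp
        also have "\<dots> = (\<integral>x. exp (t * f x) * u t x \<partial>\<mu> b)"
          using stat e1 unfolding stationary_def by blast
        finally have ru: "r t * (\<integral>x. u t x \<partial>\<mu> b) = (\<integral>x. exp (t * f x) * u t x \<partial>\<mu> b)" .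
        have "(\<integral>x. R t x * u t x \<partial>\<mu> b) = (1 / t) * ((\<integral>x. exp (t * f x) * u t x \<partial>\<mu> b) - (\<integral>x. u t x \<partial>\<mu> b)) - (\<integral>x. f x * u t x \<partial>\<mu> b)"
          unfolding Ru_eq using int[OF e1] int[OF u_lip[OF t(2)]] int[OF fu] by simp
        then have "(\<integral>x. f x * u t x \<partial>\<mu> b) + (\<integral>x. R t x * u t x \<partial>\<mu> b) = (r t - 1) / t * (\<integral>x. u t x \<partial>\<mu> b)"
          unfolding ru[symmetric] by (simp add: algebra_simps diff_divide_distrib)
        then have "(r t - 1) / t = ((\<integral>x. f x * u t x \<partial>\<mu> b) + (\<integral>x. R t x * u t x \<partial>\<mu> b)) / (\<integral>x. 1 * u t x \<partial>\<mu> b)"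
          using I by simp
        moreover have "\<bar>\<integral>x. R t x * u t x \<partial>\<mu> b\<bar> \<le> F * (F * \<bar>t\<bar>) * U"
        proof -
          have "\<bar>\<integral>x. R t x * u t x \<partial>\<mu> b\<bar> \<le> (\<integral>x. \<bar>R t x * u t x\<bar> \<partial>\<mu> b)" by (rule integral_abs_bound)
          also have "\<dots> \<le> (\<integral>x. F * (F * \<bar>t\<bar>) * U \<partial>\<mu> b)"
          proof (rule integral_mono)
            show "\<bar>R t x * u t x\<bar> \<le> F * (F * \<bar>t\<bar>) * U" for x
              unfolding abs_mult using R[OF t(1,3)] uab F_nonneg by (intro mult_mono) auto
          qed (use Ru in auto)
          finally show ?thesis by (simp add: prob_space)
        qed
        ultimately show ?case by blast
      qed
    qed
    have "((\<lambda>t. F * (F * \<bar>t\<bar>) * U) \<longlongrightarrow> F * (F * \<bar>0\<bar>) * U) (at 0)"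
      by (intro tendsto_intros)
    then have bound_lim: "((\<lambda>t. F * (F * \<bar>t\<bar>) * U) \<longlongrightarrow> 0) (at 0)" by simp
    have "eventually (\<lambda>t. norm (\<integral>x. R t x * u t x \<partial>\<mu> b) \<le> F * (F * \<bar>t\<bar>) * U) (at 0)"
      unfolding real_norm_def by (rule eventually_mono[OF eq]) (erule conjunct2)
    then have R0: "((\<lambda>t. \<integral>x. R t x * u t x \<partial>\<mu> b) \<longlongrightarrow> 0) (at 0)"
      using bound_lim by (rule Lim_null_comparison)
    have "((\<lambda>t. ((\<integral>x. f x * u t x \<partial>\<mu> b) + (\<integral>x. R t x * u t x \<partial>\<mu> b)) / (\<integral>x. 1 * u t x \<partial>\<mu> b)) \<longlongrightarrow>
        ((\<integral>x. f x \<partial>\<mu> b) + 0) / (\<integral>x. 1 \<partial>\<mu> b)) (at 0)"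
      by (intro tendsto_divide tendsto_add R0 lim_integral[OF f] lim_integral[OF lip_const]) (simp add: prob_space)
    then have "((\<lambda>t. ((\<integral>x. f x * u t x \<partial>\<mu> b) + (\<integral>x. R t x * u t x \<partial>\<mu> b)) / (\<integral>x. 1 * u t x \<partial>\<mu> b)) \<longlongrightarrow> m b) (at 0)"
      by (simp add: prob_space m_def)
    then show ?thesis
      by (rule Lim_transform_eventually) (rule eventually_mono[OF eq], erule conjunct1[THEN sym])
  qed
  then have "(r has_real_derivative m b) (at 0)"
    by (simp add: has_field_derivative_iff r_def)
  then have "((\<lambda>t. ln (r t)) has_real_derivative (1 / r 0) * m b) (at 0)"
    by (rule DERIV_chain2[OF DERIV_ln_divide, rotated]) (simp add: r_def)
  then have "((\<lambda>t. p (b + t) - p b + p b) has_real_derivative m b + 0) (at 0)"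
    by (intro DERIV_add DERIV_const) (simp add: r_def)
  then have "((\<lambda>t. p (b + t)) has_real_derivative m b) (at 0)"
    by simp
  then show ?thesis
    using DERIV_shift[of p "m b" 0 b] by (simp add: add.commute)
qed

text \<open>If a supporting line touches the pressure at two parameters, then both have the same equilibrium
probability. It determines the normalized potential, so that the two normalized potentials are equal,
which makes \<open>(c - b) * f\<close> a coboundary plus a constant.\<close>

lemma pressure_strictly_convex:
  assumes nc: "\<And>a. cohomologous_to_constant (\<lambda>x. a * f x) \<Longrightarrow> a = 0" and "b \<noteq> c"
  shows "p b + (c - b) * m b < p c"
proof (rule ccontr)
  assume "\<not> p b + (c - b) * m b < p c"
  then have "p c = p b + (c - b) * m b" using subgradient[of b c] by linarith
  then have "\<mu> b = \<mu> c"
    using entropy_\<mu>[of b] by (intro pressure_eqD invariant_\<mu>) (simp add: m_def algebra_simps)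
  obtain h where h: "\<And>x. 0 < h x" "lip \<theta> (\<theta> * (\<bar>b\<bar> * C) / (1 - \<theta>)) (\<lambda>x. ln (h x))"
    "\<And>x. transfer (\<lambda>x. b * f x) h x = exp (p b) * h x"
    "stationary \<theta> (\<lambda>x. b * f x + ln (h x) - ln (h (shift x)) - p b) (\<mu> b)"
    by (rule gibbs_state[of b]) (rule that; assumption)
  obtain k where k: "\<And>x. 0 < k x" "lip \<theta> (\<theta> * (\<bar>c\<bar> * C) / (1 - \<theta>)) (\<lambda>x. ln (k x))"
    "\<And>x. transfer (\<lambda>x. c * f x) k x = exp (p c) * k x"
    "stationary \<theta> (\<lambda>x. c * f x + ln (k x) - ln (k (shift x)) - p c) (\<mu> c)"
    by (rule gibbs_state[of c]) (rule that; assumption)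
  have "(\<lambda>x. b * f x + ln (h x) - ln (h (shift x)) - p b) = (\<lambda>x. c * f x + ln (k x) - ln (k (shift x)) - p c)"
    using normalized_cohomologous[OF theta lip_cmult[OF f, of b] exp_gt_zero[of "p b"] h(1-3)]
      normalized_cohomologous[OF theta lip_cmult[OF f, of c] exp_gt_zero[of "p c"] k(1-3)] h(4) k(4) \<open>\<mu> b = \<mu> c\<close>
    by (intro stationary_determines_potential[where M = "\<mu> b" and \<theta> = \<theta>]) simp_all
  then have "(c - b) * f x = (ln (k (shift x)) - ln (h (shift x))) - (ln (k x) - ln (h x)) + (p c - p b)" for x
    by (auto simp: fun_eq_iff algebra_simps dest!: spec[of _ x])
  moreover have "continuous_on UNIV (\<lambda>x. ln (k x) - ln (h x))"
    by (rule lip_imp_continuous[OF lip_diff[OF k(2) h(2)] theta])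
  ultimately have "cohomologous_to_constant (\<lambda>x. (c - b) * f x)"
    unfolding cohomologous_to_constant_def by (intro exI[of _ "\<lambda>x. ln (k x) - ln (h x)"] exI[of _ "p c - p b"]) simp
  then show False using nc \<open>b \<noteq> c\<close> by fastforce
qed

end

section \<open>Entropy as a function of energy\<close>

text \<open>\<open>S\<close> is the Legendre transform of \<open>p\<close>: by convexity \<open>S E\<close> is the minimum of \<open>p t + t * E\<close> over \<open>t\<close>. Inserting the
minimizer of one energy into the minimum problem of the other bounds the difference quotient of \<open>S\<close>
between the two minimizers. Strict convexity makes the minimizer depend continuously on the energy.\<close>

lemma legendre_derivative:
  fixes p m S :: "real \<Rightarrow> real"
  assumes der: "\<And>b. (p has_real_derivative m b) (at b)"
    and strict: "\<And>b c. b \<noteq> c \<Longrightarrow> p b + (c - b) * m b < p c"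
    and S: "\<And>b. S (- m b) = p b - b * m b"
  shows "(S has_real_derivative b) (at (- m b))"
proof -
  have mono: "m b < m c" if "b < c" for b c
  proof -
    have "(c - b) * m b < (c - b) * m c"
      using strict[of b c] strict[of c b] that by (simp add: algebra_simps)
    then show ?thesis using that by simp
  qed
  let ?E = "- m b"
  have ev: "eventually (\<lambda>E. \<exists>c. \<bar>c - b\<bar> < \<eta> \<and> E = - m c) (at ?E)" if \<eta>: "0 < \<eta>" for \<eta>
  proof -
    have "eventually (\<lambda>E. E \<in> {- m (b + \<eta>)<..<- m (b - \<eta>)}) (at ?E)"
      using mono[of b "b + \<eta>"] mono[of "b - \<eta>" b] \<eta> by (intro eventually_at_in_open') auto
    then show ?thesis
    proof eventually_elim
      case (elim E)
      \<comment> \<open>The minimum of \<open>q\<close> over the interval is not attained at an end point, so that \<open>- E\<close> is a value of \<open>m\<close> inside.\<close>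
      define q where "q t = p t + t * E" for t
      have q: "(q has_real_derivative m t + E) (at t)" for t
        unfolding q_def by (auto intro!: derivative_eq_intros der)
      have "continuous_on {b - \<eta>..b + \<eta>} q"
        using q by (intro DERIV_continuous_on) (auto intro: has_field_derivative_at_within)
      then obtain c where c: "c \<in> {b - \<eta>..b + \<eta>}" "\<And>t. t \<in> {b - \<eta>..b + \<eta>} \<Longrightarrow> q c \<le> q t"
        using continuous_attains_inf[of "{b - \<eta>..b + \<eta>}" q] \<eta> by auto
      have "c \<noteq> b + \<eta>"
      proof
        assume "c = b + \<eta>"
        moreover have "0 < m (b + \<eta>) + E" using elim by simp
        ultimately obtain d where d: "0 < d" "\<And>h. 0 < h \<Longrightarrow> h < d \<Longrightarrow> q (c - h) < q c"
          using DERIV_pos_inc_left[OF q, of c] by auto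
        define k where "k = min (d / 2) \<eta>"
        have k: "0 < k" "k < d" "k \<le> \<eta>" using d(1) \<eta> by (auto simp: k_def)
        show False using c(2)[of "c - k"] d(2)[OF k(1,2)] \<open>c = b + \<eta>\<close> k by simp
      qed
      moreover have "c \<noteq> b - \<eta>"
      proof
        assume "c = b - \<eta>"
        moreover have "m (b - \<eta>) + E < 0" using elim by simp
        ultimately obtain d where d: "0 < d" "\<And>h. 0 < h \<Longrightarrow> h < d \<Longrightarrow> q (c + h) < q c"
          using DERIV_neg_dec_right[OF q, of c] by auto
        define k where "k = min (d / 2) \<eta>"
        have k: "0 < k" "k < d" "k \<le> \<eta>" using d(1) \<eta> by (auto simp: k_def)
        show False using c(2)[of "c + k"] d(2)[OF k(1,2)] \<open>c = b - \<eta>\<close> k by simp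
      qed
      ultimately have in': "b - \<eta> < c" "c < b + \<eta>" using c(1) by auto
      have "m c + E = 0"
      proof (rule DERIV_local_min[OF q])
        show "0 < min (c - (b - \<eta>)) (b + \<eta> - c)" using in' by simp
        show "\<forall>y. \<bar>c - y\<bar> < min (c - (b - \<eta>)) (b + \<eta> - c) \<longrightarrow> q c \<le> q y"
          using c(2) by (auto simp: abs_less_iff)
      qed
      then show ?case using in' by (intro exI[of _ c]) auto
    qed
  qed
  have "((\<lambda>E. (S E - S ?E) / (E - ?E)) \<longlongrightarrow> b) (at ?E)"
  proof (rule tendstoI)
    fix \<eta> :: real assume \<eta>: "0 < \<eta>"
    have "eventually (\<lambda>E. E \<noteq> ?E) (at ?E)" by (simp add: eventually_at_filter)
    with ev[OF \<eta>] show "eventually (\<lambda>E. dist ((S E - S ?E) / (E - ?E)) b < \<eta>) (at ?E)"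
    proof eventually_elim
      case (elim E)
      then obtain c where c: "\<bar>c - b\<bar> < \<eta>" "E = - m c" by blast
      then have bc: "b \<noteq> c" using elim by auto
      have S': "S E = p c + c * E" "S ?E = p b + b * ?E" using c S by simp_all
      have u: "S E - S ?E \<le> b * (E - ?E)"
        using strict[of c b] bc unfolding S' unfolding c(2) by (simp add: algebra_simps)
      have l: "c * (E - ?E) \<le> S E - S ?E"
        using strict[of b c] bc unfolding S' unfolding c(2) by (simp add: algebra_simps)
      have "\<bar>(S E - S ?E) / (E - ?E) - b\<bar> \<le> \<bar>c - b\<bar>"
      proof (cases "0 < E - ?E")
        case True
        then have "c \<le> (S E - S ?E) / (E - ?E)" "(S E - S ?E) / (E - ?E) \<le> b"
          using u l by (simp_all add: pos_le_divide_eq pos_divide_le_eq)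
        then show ?thesis by linarith
      next
        case False
        then have "E - ?E < 0" using elim by simp
        then have "(S E - S ?E) / (E - ?E) \<le> c" "b \<le> (S E - S ?E) / (E - ?E)"
          using u l by (simp_all add: neg_le_divide_eq neg_divide_le_eq)
        then show ?thesis by linarith
      qed
      then show ?case using c(1) by (simp add: dist_real_def)
    qed
  qed
  then show ?thesis by (simp add: has_field_derivative_iff)
qed

theorem proposition42:
  fixes f0 f1 f2 H :: "'d::finite shift_space \<Rightarrow> real" and E :: real
  assumes "CARD('d) \<ge> 2"
    and "holder f0" and "holder f1" and "holder f2"
    and "hypothesis_A f0 f1 f2"
    and "H = (\<lambda>x. - f1 x)"
    and "E \<in> energy_range H"
  shows "(entropy_at_energy H has_real_derivative inverse_temperature H E) (at E)"
proof -
  obtain \<theta> C where \<theta>: "0 < \<theta>" "\<theta> < 1" "lip \<theta> C f1"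
    using holder_imp_lip[OF assms(3)] .
  interpret potential_line \<theta> C f1 by unfold_locales (rule \<theta>)+
  have nc: "a = 0" if "cohomologous_to_constant (\<lambda>x. a * f1 x)" for a
    using assms(5)[unfolded hypothesis_A_def, rule_format, of 0 a 0] that by simp
  note strict = pressure_strictly_convex[OF nc]
  have pot: "(\<lambda>x. - t * H x) = (\<lambda>x. t * f1 x)" for t
    by (simp add: assms(6))
  have energy_iff: "has_energy H b E' \<longleftrightarrow> E' = - m b" for b E'
    unfolding has_energy_def pot p_def[symmetric]
    using pressure_derivative[of b] DERIV_unique[of p "m b" b "- E'"] by auto
  have inj: "b = c" if "m b = m c" for b c
  proof (rule ccontr)
    assume "b \<noteq> c"
    then show False using strict[of b c] strict[of c b] that by (simp add: algebra_simps)
  qed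
  have inv_temp: "inverse_temperature H (- m b) = b" for b
    unfolding inverse_temperature_def energy_iff using inj by (intro the_equality) auto
  obtain b where E: "E = - m b"
    using assms(7) by (auto simp: energy_range_def energy_iff)
  have entropy: "entropy_at_energy H (- m c) = p c - c * m c" for c
    unfolding entropy_at_energy_def gibbs_prob_def pot \<mu>_def[symmetric] inv_temp by (rule entropy_\<mu>)
  show ?thesis
    unfolding E inv_temp by (rule legendre_derivative[OF pressure_derivative strict entropy])
qed

end
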